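(* Let $\varphi$ be an Orlicz function whose conjugate $\psi$ is also an Orlicz function, and let $L^\varphi=L^\varphi[0,1]$. The following statements are equivalent: (1) $L^\varphi$ has the order Banach-Saks property ($oBSP$). (2) $L^\varphi$ has the $L^\psi$-order Banach-Saks property ($L^\psi$-$oBSP$). (3) $L^\varphi$ has the weak order Banach-Saks property ($w$-$oBSP$). (4) $\varphi$ has property $(H)$: every weakly null sequence in $H^\varphi$ has a subsequence whose Cesàro sequence is dominated in $L^\varphi$.
   Context: $L^0$ is the vector lattice of real measurable functions on $[0,1]$ (Lebesgue measure), modulo a.e. equality; inequalities are a.e. An Orlicz function is a convex, increasing (i.e. nondecreasing), non-constant function $\varphi:[0,\infty)\to[0,\infty)$ with $\varphi(0)=0$. Its conjugate is $\psi(s)=\sup\{st-\varphi(t):t\ge0\}$, $s\ge0$; $\psi$ is an Orlicz function exactly when it is finite-valued, i.e. when $\lim_{t\to\infty}\varphi(t)/t=\infty$. The Orlicz space $L^\varphi$ is the space of $f\in L^0$ with $\|f\|_\varphi:=\inf\{\lambda>0:\int_0^1\varphi(|f|/\lambda)\,dt\le1\}<\infty$, normed by $\|\cdot\|_\varphi$. The Orlicz heart is $H^\varphi=\{f\in L^\varphi:\int_0^1\varphi(|f|/\lambda)\,dt<\infty\ \text{for all }\lambda>0\}$ with the same norm. When $\psi$ is an Orlicz function, the associate space of $L^\varphi$ is $L^\psi$. A sequence $\{f_n\}$ in $X=L^\varphi$ is dominated in $X$ if there is $0\le h\in X$ with $|f_n|\le h$ for all $n$. It order converges to $f\in X$ if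 there is a sequence $\{g_n\}$ in $X$ with $g_n\downarrow0$ and $|f_n-f|\le g_n$ for all $n$; equivalently, it is dominated in $X$ and $f_n\to f$ a.e. The Cesàro sequence of $\{f_n\}$ is $\{\frac1m\sum_{n=1}^m f_n\}_m$. $L^\varphi$ has $oBSP$ (resp. $w$-$oBSP$, resp. $L^\psi$-$oBSP$) if every sequence in $L^\varphi$ that is norm bounded (resp. weakly null, resp. norm bounded with $\int_0^1f_ng\,dt\to0$ for every $g\in L^\psi$) has a subsequence whose Cesàro sequence order converges in $L^\varphi$. *)

theory Defs
  imports "HOL-Analysis.Analysis"
begin

text \<open>
  Elements of \<open>L\<^sup>0\<close> are represented by Lebesgue measurable functions; only their values
  on \<open>[0,1]\<close> matter, and all order relations between them are understood almost everywhere.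
  Sequences are indexed from \<open>0\<close>.
\<close>

abbreviation unit_leb :: "real measure" where
  "unit_leb \<equiv> lebesgue_on {0..1}"

definition ae_le :: "(real \<Rightarrow> real) \<Rightarrow> (real \<Rightarrow> real) \<Rightarrow> bool" where
  "ae_le f g \<longleftrightarrow> (AE x in unit_leb. f x \<le> g x)"

text \<open>Only the values of an Orlicz function on \<open>[0,\<infinity>)\<close> are relevant.\<close>

definition orlicz_function :: "(real \<Rightarrow> real) \<Rightarrow> bool" where
  "orlicz_function \<phi> \<longleftrightarrow>
     convex_on {0..} \<phi> \<and> mono_on {0..} \<phi> \<and> (\<forall>t\<ge>0. \<phi> t \<ge> 0) \<and>
     \<phi> 0 = 0 \<and> \<not> \<phi> constant_on {0..}"

definition conjugate :: "(real \<Rightarrow> real) \<Rightarrow> real \<Rightarrow> ereal" where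
  "conjugate \<phi> s = (SUP t\<in>{0..}. ereal (s * t - \<phi> t))"

definition modular :: "(real \<Rightarrow> real) \<Rightarrow> (real \<Rightarrow> real) \<Rightarrow> real \<Rightarrow> ennreal" where
  "modular \<phi> f c = (\<integral>\<^sup>+x. ennreal (\<phi> (\<bar>f x\<bar> / c)) \<partial>unit_leb)"

text \<open>The infimum of the empty set is \<open>\<infinity>\<close> here.\<close>

definition orlicz_norm :: "(real \<Rightarrow> real) \<Rightarrow> (real \<Rightarrow> real) \<Rightarrow> ennreal" where
  "orlicz_norm \<phi> f = (INF c\<in>{c. c > 0 \<and> modular \<phi> f c \<le> 1}. ennreal c)"

definition orlicz_space :: "(real \<Rightarrow> real) \<Rightarrow> (real \<Rightarrow> real) set" where
  "orlicz_space \<phi> = {f \<in> borel_measurable unit_leb. orlicz_norm \<phi> f < \<infinity>}"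

definition orlicz_heart :: "(real \<Rightarrow> real) \<Rightarrow> (real \<Rightarrow> real) set" where
  "orlicz_heart \<phi> = {f \<in> orlicz_space \<phi>. \<forall>c>0. modular \<phi> f c < \<infinity>}"

text \<open>
  The continuous dual of a subspace \<open>X\<close> of \<open>L\<^sup>\<phi>\<close>. Linearity together with the norm bound
  forces a functional to agree on a.e. equal functions in \<open>X\<close>. The values of \<open>l\<close> outside
  \<open>X\<close> are irrelevant.
\<close>

definition bounded_functional ::
  "(real \<Rightarrow> real) \<Rightarrow> (real \<Rightarrow> real) set \<Rightarrow> ((real \<Rightarrow> real) \<Rightarrow> real) \<Rightarrow> bool" where
  "bounded_functional \<phi> X l \<longleftrightarrow>
     (\<forall>f\<in>X. \<forall>g\<in>X. l (\<lambda>x. f x + g x) = l f + l g) \<and>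
     (\<forall>c. \<forall>f\<in>X. l (\<lambda>x. c * f x) = c * l f) \<and>
     (\<exists>C. \<forall>f\<in>X. ennreal \<bar>l f\<bar> \<le> ennreal C * orlicz_norm \<phi> f)"

definition weakly_null ::
  "(real \<Rightarrow> real) \<Rightarrow> (real \<Rightarrow> real) set \<Rightarrow> (nat \<Rightarrow> real \<Rightarrow> real) \<Rightarrow> bool" where
  "weakly_null \<phi> X f \<longleftrightarrow>
     (\<forall>n. f n \<in> X) \<and> (\<forall>l. bounded_functional \<phi> X l \<longrightarrow> (\<lambda>n. l (f n)) \<longlonglongrightarrow> 0)"

definition norm_bounded :: "(real \<Rightarrow> real) \<Rightarrow> (nat \<Rightarrow> real \<Rightarrow> real) \<Rightarrow> bool" where
  "norm_bounded \<phi> f \<longleftrightarrow>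
     (\<forall>n. f n \<in> orlicz_space \<phi>) \<and> (\<exists>C::real. \<forall>n. orlicz_norm \<phi> (f n) \<le> ennreal C)"

definition dominated_in :: "(real \<Rightarrow> real) set \<Rightarrow> (nat \<Rightarrow> real \<Rightarrow> real) \<Rightarrow> bool" where
  "dominated_in X f \<longleftrightarrow>
     (\<exists>h\<in>X. ae_le (\<lambda>_. 0) h \<and> (\<forall>n. ae_le (\<lambda>x. \<bar>f n x\<bar>) h))"

text \<open>The sequence decreases and its infimum in the ordered space \<open>X\<close> is \<open>0\<close>.\<close>

definition decreases_to_zero_in ::
  "(real \<Rightarrow> real) set \<Rightarrow> (nat \<Rightarrow> real \<Rightarrow> real) \<Rightarrow> bool" where
  "decreases_to_zero_in X g \<longleftrightarrow>
     (\<forall>n. g n \<in> X) \<and> (\<forall>n. ae_le (g (Suc n)) (g n)) \<and>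
     (\<forall>n. ae_le (\<lambda>_. 0) (g n)) \<and>
     (\<forall>k\<in>X. (\<forall>n. ae_le k (g n)) \<longrightarrow> ae_le k (\<lambda>_. 0))"

definition order_converges_in ::
  "(real \<Rightarrow> real) set \<Rightarrow> (nat \<Rightarrow> real \<Rightarrow> real) \<Rightarrow> (real \<Rightarrow> real) \<Rightarrow> bool" where
  "order_converges_in X f h \<longleftrightarrow>
     (\<exists>g. decreases_to_zero_in X g \<and> (\<forall>n. ae_le (\<lambda>x. \<bar>f n x - h x\<bar>) (g n)))"

definition cesaro :: "(nat \<Rightarrow> real \<Rightarrow> real) \<Rightarrow> nat \<Rightarrow> real \<Rightarrow> real" where
  "cesaro f m = (\<lambda>x. (\<Sum>n\<le>m. f n x) / real (Suc m))"

definition has_order_cesaro_subseq ::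
  "(real \<Rightarrow> real) set \<Rightarrow> (nat \<Rightarrow> real \<Rightarrow> real) \<Rightarrow> bool" where
  "has_order_cesaro_subseq X f \<longleftrightarrow>
     (\<exists>r::nat \<Rightarrow> nat. strict_mono r \<and>
        (\<exists>h\<in>X. order_converges_in X (cesaro (f \<circ> r)) h))"

definition oBSP :: "(real \<Rightarrow> real) \<Rightarrow> bool" where
  "oBSP \<phi> \<longleftrightarrow>
     (\<forall>f. norm_bounded \<phi> f \<longrightarrow> has_order_cesaro_subseq (orlicz_space \<phi>) f)"

definition assoc_oBSP :: "(real \<Rightarrow> real) \<Rightarrow> (real \<Rightarrow> real) \<Rightarrow> bool" where
  "assoc_oBSP \<phi> \<psi> \<longleftrightarrow>
     (\<forall>f. norm_bounded \<phi> f \<and>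
          (\<forall>g\<in>orlicz_space \<psi>. (\<lambda>n. \<integral>x. f n x * g x \<partial>unit_leb) \<longlonglongrightarrow> 0)
        \<longrightarrow> has_order_cesaro_subseq (orlicz_space \<phi>) f)"

definition weak_oBSP :: "(real \<Rightarrow> real) \<Rightarrow> bool" where
  "weak_oBSP \<phi> \<longleftrightarrow>
     (\<forall>f. weakly_null \<phi> (orlicz_space \<phi>) f \<longrightarrow> has_order_cesaro_subseq (orlicz_space \<phi>) f)"

definition property_H :: "(real \<Rightarrow> real) \<Rightarrow> bool" where
  "property_H \<phi> \<longleftrightarrow>
     (\<forall>f. weakly_null \<phi> (orlicz_heart \<phi>) f \<longrightarrow>
        (\<exists>r::nat \<Rightarrow> nat. strict_mono r \<and> dominated_in (orlicz_space \<phi>) (cesaro (f \<circ> r))))"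

end

theory Submission
  imports Defs "HOL-Library.Diagonal_Subsequence"
begin

text \<open>
  The implications (1) to (2) to (3) to (4) are soft: functions in \<open>L\<^sup>\<psi>\<close> are bounded functionals,
  so weakly null sequences are norm bounded by the uniform boundedness principle, functionals
  restrict to the heart, and order convergent sequences are dominated.

  For (4) to (1), property (H) first forces the growth condition \<open>nabla2\<close>: if it fails, then a
  superposition of independent sequences of scaled indicators, centred at its means, is weakly
  null, while the suprema of \<open>f n / (n + 1)\<close> along any subsequence leave \<open>L\<^sup>\<phi>\<close>. Under
  \<open>nabla2\<close>, a bounded sequence \<open>f n \<ge> 0\<close> is split, along a subsequence, into truncations at height \<open>n\<close>
  minus their weak limits \<open>F n\<close>, the increasing sequence \<open>F n\<close>, and the excess over \<open>n\<close>. The first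
  part is weakly null in the heart, so (H) applies to it; \<open>F n\<close> is dominated by its limit; the excess
  is almost disjointly supported, and there \<open>nabla2\<close> dominates the Cesaro means. Almost everywhere
  convergence is a second moment argument, since \<open>nabla2\<close> gives boundedness in some \<open>L\<^sup>p\<close> with \<open>p > 1\<close>.
\<close>

subsection \<open>Modulars, Orlicz spaces and hearts\<close>

text \<open>A bounded sequence in L^\<phi> need neither lie in the heart nor be weakly null;
  truncating and subtracting weak limits repairs both. Weak nullity has to be tested against
  arbitrary bounded functionals on the heart. Two estimates control them: on uniformly bounded
  sequences asymptotic orthogonality suffices, and under \<open>nabla2\<close> a functional is small
  on unit ball functions of small L^1 norm. The second handles the parts above a fixed height,
  because finiteness of \<psi> makes \<phi> superlinear and the unit ball uniformly integrable. The
  growth condition enters through one exponent p > 1: up to an additive constant, \<phi>(t / j)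
  decays like j^(-p), which is summable; without it \<phi> is almost linear on long intervals and
  the harmonic series appears. The same exponent makes the measures of the sets {f n > n} summable,
  whence the truncation height n. Since (H) chooses a subsequence of its own, all estimates prepared
  beforehand must survive passage to further subsequences.\<close>

lemma unit_leb_finite [simp]: "finite_measure unit_leb"
  by (rule finite_measure_lebesgue_on) simp

lemma emeasure_unit_leb [simp]: "emeasure unit_leb {0..1} = 1"
  by (subst emeasure_restrict_space) auto

interpretation unit_leb: finite_measure unit_leb
  by simp

lemma measure_unit_leb [simp]: "measure unit_leb {0..1} = 1"
  by (simp add: measure_def)

lemma nn_integral_unit_leb_const [simp]: "(\<integral>\<^sup>+x. c \<partial>unit_leb) = c"
  by simp

locale orlicz =
  fixes \<phi> :: "real \<Rightarrow> real"
  assumes orlicz: "orlicz_function \<phi>"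
begin

lemma zero [simp]: "\<phi> 0 = 0"
  using orlicz by (simp add: orlicz_function_def)

lemma nonneg: "0 \<le> t \<Longrightarrow> 0 \<le> \<phi> t"
  using orlicz by (simp add: orlicz_function_def)

lemma mono: "0 \<le> s \<Longrightarrow> s \<le> t \<Longrightarrow> \<phi> s \<le> \<phi> t"
  using orlicz by (auto simp: orlicz_function_def mono_on_def)

lemma convex: "convex_on {0..} \<phi>"
  using orlicz by (simp add: orlicz_function_def)

lemma convex_comb:
  assumes "0 \<le> a" "0 \<le> b" "a + b = 1" "0 \<le> s" "0 \<le> t"
  shows "\<phi> (a * s + b * t) \<le> a * \<phi> s + b * \<phi> t"
  using assms convex unfolding convex_on_def by auto

lemma scale_le: 
  assumes "0 \<le> a" "a \<le> 1" "0 \<le> t" shows "\<phi> (a * t) \<le> a * \<phi> t"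
  using convex_comb[of a "1 - a" t 0] assms by simp

lemma scale_ge: 
  assumes "1 \<le> a" "0 \<le> t" shows "a * \<phi> t \<le> \<phi> (a * t)"
proof -
  have "\<phi> ((1 / a) * (a * t)) \<le> (1 / a) * \<phi> (a * t)"
    using assms by (intro scale_le) auto
  then show ?thesis using assms by (simp add: field_simps)
qed

lemma ex_pos: "\<exists>t>0. \<phi> t > 0"
proof (rule ccontr)
  assume "\<not> ?thesis"
  then have "\<phi> t = 0" if "t \<ge> 0" for t
    using that nonneg[of t] zero by (metis antisym less_eq_real_def)
  then have "\<phi> constant_on {0..}" by (auto simp: constant_on_def)
  then show False using orlicz by (simp add: orlicz_function_def)
qed

text \<open>By convexity and \<phi>(0) = 0 the graph lies above the line through 0 and a point where
  \<phi> is positive, from that point on.\<close>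

lemma tends_to_infinity: "\<exists>t0>0. \<forall>t\<ge>t0. \<phi> t \<ge> K"
proof -
  obtain t where t: "t > 0" "\<phi> t > 0" using ex_pos by blast
  define a where "a = max 1 (K / \<phi> t)"
  have "K \<le> a * \<phi> t" using t by (simp add: a_def max_def field_simps)
  also have "\<dots> \<le> \<phi> (a * t)" using t by (intro scale_ge) (auto simp: a_def)
  finally have K: "K \<le> \<phi> (a * t)" .
  have "a * t > 0" using t by (simp add: a_def)
  then show ?thesis using K mono[of "a * t"] by (meson less_imp_le order_trans)
qed

lemma measurable_abs [measurable]: "(\<lambda>t. \<phi> \<bar>t\<bar>) \<in> borel_measurable borel"
proof -
  \<comment> \<open>The values of \<phi> at negative arguments are arbitrary; composing with
    \<open>max 0\<close> gives a function that is monotone on the whole line, hence Borel.\<close>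
  have "mono (\<lambda>t. \<phi> (max 0 t))"
    by (auto intro!: monoI mono)
  then have "(\<lambda>t. \<phi> (max 0 t)) \<in> borel_measurable borel"
    by (rule borel_measurable_mono)
  then have "(\<lambda>t. \<phi> (max 0 \<bar>t\<bar>)) \<in> borel_measurable borel"
    by measurable
  then show ?thesis by simp
qed

lemma measurable_comp [measurable]:
  assumes "f \<in> borel_measurable M"
  shows "(\<lambda>x. \<phi> \<bar>f x\<bar>) \<in> borel_measurable M"
  using measurable_compose[OF assms measurable_abs] .

lemma measurable_comp_div [measurable]:
  assumes "f \<in> borel_measurable M"
  shows "(\<lambda>x. \<phi> (\<bar>f x\<bar> / \<bar>c\<bar>)) \<in> borel_measurable M"
  using measurable_comp[of "\<lambda>x. f x / c" M] assms by simp

lemma measurable_comp_div_pos: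
  assumes "f \<in> borel_measurable M" "c > 0"
  shows "(\<lambda>x. \<phi> (\<bar>f x\<bar> / c)) \<in> borel_measurable M"
  using measurable_comp_div[of f M c] assms by simp

lemma modular_mono:
  assumes "AE x in unit_leb. \<bar>f x\<bar> \<le> \<bar>g x\<bar>" "0 < c" "c \<le> d"
  shows "modular \<phi> f d \<le> modular \<phi> g c"
  unfolding modular_def
proof (rule nn_integral_mono_AE, use assms(1) in eventually_elim)
  fix x assume "\<bar>f x\<bar> \<le> \<bar>g x\<bar>"
  then have "\<bar>f x\<bar> / d \<le> \<bar>g x\<bar> / c" using assms by (intro frac_le) auto
  then show "ennreal (\<phi> (\<bar>f x\<bar> / d)) \<le> ennreal (\<phi> (\<bar>g x\<bar> / c))"
    using assms by (intro ennreal_leI mono) auto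
qed

lemma modular_cmult:
  assumes "a \<noteq> 0"
  shows "modular \<phi> (\<lambda>x. a * f x) c = modular \<phi> f (c / \<bar>a\<bar>)"
  using assms by (simp add: modular_def abs_mult ac_simps)

lemma modular_zero [simp]: "modular \<phi> (\<lambda>x. 0) c = 0"
  by (simp add: modular_def)

text \<open>The convexity behind the triangle inequality of the Luxemburg norm: (f + g) / (c + d) is
  the convex combination of f / c and g / d with weights c / (c + d) and d / (c + d).\<close>

lemma modular_add:
  assumes [measurable]: "f \<in> borel_measurable unit_leb" "g \<in> borel_measurable unit_leb" 
    and cd: "c > 0" "d > 0"
  shows "modular \<phi> (\<lambda>x. f x + g x) (c + d) \<le> 
    ennreal (c / (c + d)) * modular \<phi> f c + ennreal (d / (c + d)) * modular \<phi> g d"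
proof -
  have [measurable]: "(\<lambda>x. \<phi> (\<bar>f x\<bar> / c)) \<in> borel_measurable unit_leb"
    "(\<lambda>x. \<phi> (\<bar>g x\<bar> / d)) \<in> borel_measurable unit_leb"
    using cd by (auto intro!: measurable_comp_div_pos)
  have "modular \<phi> (\<lambda>x. f x + g x) (c + d) \<le> (\<integral>\<^sup>+x. ennreal (c / (c + d)) * ennreal (\<phi> (\<bar>f x\<bar> / c)) + 
     ennreal (d / (c + d)) * ennreal (\<phi> (\<bar>g x\<bar> / d)) \<partial>unit_leb)"
    unfolding modular_def
  proof (rule nn_integral_mono)
    fix x 
    have "\<phi> (\<bar>f x + g x\<bar> / (c + d)) \<le> \<phi> (c / (c + d) * (\<bar>f x\<bar> / c) + d / (c + d) * (\<bar>g x\<bar> / d))"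
      using cd by (intro mono) (auto simp flip: add_divide_distrib intro!: divide_right_mono)
    also have "\<dots> \<le> c / (c + d) * \<phi> (\<bar>f x\<bar> / c) + d / (c + d) * \<phi> (\<bar>g x\<bar> / d)"
      using cd by (intro convex_comb) (auto simp flip: add_divide_distrib)
    finally have "ennreal (\<phi> (\<bar>f x + g x\<bar> / (c + d))) 
      \<le> ennreal (c / (c + d) * \<phi> (\<bar>f x\<bar> / c) + d / (c + d) * \<phi> (\<bar>g x\<bar> / d))"
      by (rule ennreal_leI)
    also have "\<dots> = ennreal (c / (c + d)) * ennreal (\<phi> (\<bar>f x\<bar> / c)) + 
     ennreal (d / (c + d)) * ennreal (\<phi> (\<bar>g x\<bar> / d))"
      using cd nonneg[of "\<bar>f x\<bar> / c"] nonneg[of "\<bar>g x\<bar> / d"]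
      by (subst ennreal_plus) (auto simp flip: ennreal_mult)
    finally show "ennreal (\<phi> (\<bar>f x + g x\<bar> / (c + d))) \<le> \<dots>" .
  qed
  also have "\<dots> = ennreal (c / (c + d)) * modular \<phi> f c + ennreal (d / (c + d)) * modular \<phi> g d"
    unfolding modular_def by (subst nn_integral_add) (auto simp: nn_integral_cmult)
  finally show ?thesis .
qed

lemma modular_add_le_1:
  assumes [measurable]: "f \<in> borel_measurable unit_leb" "g \<in> borel_measurable unit_leb" 
    and cd: "c > 0" "d > 0" and le: "modular \<phi> f c \<le> 1" "modular \<phi> g d \<le> 1"
  shows "modular \<phi> (\<lambda>x. f x + g x) (c + d) \<le> 1"
proof -
  have "modular \<phi> (\<lambda>x. f x + g x) (c + d) \<le> 
    ennreal (c / (c + d)) * modular \<phi> f c + ennreal (d / (c + d)) * modular \<phi> g d"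
    using assms by (intro modular_add) auto
  also have "\<dots> \<le> ennreal (c / (c + d)) * 1 + ennreal (d / (c + d)) * 1"
    using le by (intro add_mono mult_left_mono) auto
  also have "\<dots> = 1"
    using cd by (simp flip: ennreal_plus add_divide_distrib)
  finally show ?thesis .
qed

text \<open>Since \<phi>(0) = 0, convexity gives \<phi>(t / K) \<le> \<phi>(t) / K, so a modular
  bound \<open>K\<close> can be traded for a factor \<open>K\<close> in the scale. This is how
  modular bounds become norm bounds.\<close>

lemma modular_scale_le_1:
  assumes [measurable]: "f \<in> borel_measurable unit_leb" and c: "c > 0" 
    and le: "modular \<phi> f c \<le> ennreal K" and K: "K \<ge> 1"
  shows "modular \<phi> f (K * c) \<le> 1"
proof -
  have [measurable]: "(\<lambda>x. \<phi> (\<bar>f x\<bar> / c)) \<in> borel_measurable unit_leb"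
    using c by (auto intro!: measurable_comp_div_pos)
  have "modular \<phi> f (K * c) \<le> (\<integral>\<^sup>+x. ennreal (1 / K) * ennreal (\<phi> (\<bar>f x\<bar> / c)) \<partial>unit_leb)"
    unfolding modular_def
  proof (rule nn_integral_mono)
    fix x 
    have "\<phi> ((1 / K) * (\<bar>f x\<bar> / c)) \<le> (1 / K) * \<phi> (\<bar>f x\<bar> / c)"
      using c K by (intro scale_le) auto
    then have "ennreal (\<phi> (\<bar>f x\<bar> / (K * c))) \<le> ennreal ((1 / K) * \<phi> (\<bar>f x\<bar> / c))"
      by (intro ennreal_leI) auto
    then show "ennreal (\<phi> (\<bar>f x\<bar> / (K * c))) \<le> ennreal (1 / K) * ennreal (\<phi> (\<bar>f x\<bar> / c))"
      using K nonneg[of "\<bar>f x\<bar> / c"] c by (subst (asm) ennreal_mult) auto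
  qed
  also have "\<dots> = ennreal (1 / K) * modular \<phi> f c"
    unfolding modular_def by (rule nn_integral_cmult) auto
  also have "\<dots> \<le> ennreal (1 / K) * ennreal K"
    using le by (intro mult_left_mono) auto
  also have "\<dots> = 1" using K by (simp flip: ennreal_mult)
  finally show ?thesis .
qed

lemma modular_finite_imp_le_1:
  assumes "f \<in> borel_measurable unit_leb" "c > 0" "modular \<phi> f c < \<infinity>"
  shows "\<exists>d\<ge>c. modular \<phi> f d \<le> 1"
proof -
  define K where "K = max 1 (enn2real (modular \<phi> f c))"
  have "modular \<phi> f c = ennreal (enn2real (modular \<phi> f c))"
    using assms(3) by simp
  also have "\<dots> \<le> ennreal K" by (intro ennreal_leI) (simp add: K_def)
  finally have "modular \<phi> f (K * c) \<le> 1"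
    using assms by (intro modular_scale_le_1) (auto simp: K_def)
  moreover have "K * c \<ge> c" using assms by (simp add: K_def)
  ultimately show ?thesis by blast
qed

lemma norm_le:
  "c > 0 \<Longrightarrow> modular \<phi> f c \<le> 1 \<Longrightarrow> orlicz_norm \<phi> f \<le> ennreal c"
  unfolding orlicz_norm_def by (intro INF_lower) auto

text \<open>The strict inequality yields an admissible constant below \<open>c\<close>, so
  attainment of the infimum plays no part.\<close>

lemma modular_le_1:
  assumes "orlicz_norm \<phi> f < ennreal c"
  shows "modular \<phi> f c \<le> 1"
proof -
  obtain d where d: "d > 0" "modular \<phi> f d \<le> 1" "ennreal d < ennreal c"
    using assms unfolding orlicz_norm_def by (auto simp: INF_less_iff)
  then have "d \<le> c" by (auto simp: ennreal_less_iff)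
  then have "modular \<phi> f c \<le> modular \<phi> f d" using d by (intro modular_mono) auto
  then show ?thesis using d by simp
qed

lemma space_iff_le_1:
  "f \<in> orlicz_space \<phi> \<longleftrightarrow> f \<in> borel_measurable unit_leb \<and> (\<exists>c>0. modular \<phi> f c \<le> 1)"
proof -
  have "orlicz_norm \<phi> f < \<infinity> \<longleftrightarrow> (\<exists>c>0. modular \<phi> f c \<le> 1)"
    unfolding orlicz_norm_def by (auto simp: INF_less_iff)
  then show ?thesis by (auto simp: orlicz_space_def)
qed

lemma space_iff:
  "f \<in> orlicz_space \<phi> \<longleftrightarrow> f \<in> borel_measurable unit_leb \<and> (\<exists>c>0. modular \<phi> f c < \<infinity>)"
  unfolding space_iff_le_1 using modular_finite_imp_le_1
  by (metis ennreal_one_less_top infinity_ennreal_def order_le_less_trans order_less_le_trans)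

lemma space_measurable: "f \<in> orlicz_space \<phi> \<Longrightarrow> f \<in> borel_measurable unit_leb"
  by (simp add: orlicz_space_def)

lemma heart_iff:
  "f \<in> orlicz_heart \<phi> \<longleftrightarrow> f \<in> borel_measurable unit_leb \<and> (\<forall>c>0. modular \<phi> f c < \<infinity>)"
  by (auto simp: orlicz_heart_def space_iff intro: exI[of _ 1])

lemma heart_subset: "f \<in> orlicz_heart \<phi> \<Longrightarrow> f \<in> orlicz_space \<phi>"
  by (simp add: orlicz_heart_def)

lemma space_add:
  assumes "f \<in> orlicz_space \<phi>" "g \<in> orlicz_space \<phi>"
  shows "(\<lambda>x. f x + g x) \<in> orlicz_space \<phi>"
proof -
  obtain c d where "c > 0" "modular \<phi> f c \<le> 1" "d > 0" "modular \<phi> g d \<le> 1"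
    using assms by (auto simp: space_iff_le_1)
  then have "modular \<phi> (\<lambda>x. f x + g x) (c + d) \<le> 1" "c + d > 0"
    using assms by (auto intro!: modular_add_le_1 dest: space_measurable)
  moreover have "(\<lambda>x. f x + g x) \<in> borel_measurable unit_leb"
    using assms by (intro borel_measurable_add space_measurable)
  ultimately show ?thesis by (auto simp: space_iff_le_1)
qed

lemma space_cmult:
  assumes "f \<in> orlicz_space \<phi>"
  shows "(\<lambda>x. a * f x) \<in> orlicz_space \<phi>"
proof (cases "a = 0")
  case True
  then show ?thesis by (auto simp: space_iff intro: exI[of _ 1])
next
  case False
  obtain c where c: "c > 0" "modular \<phi> f c \<le> 1"
    using assms by (auto simp: space_iff_le_1)
  then have "modular \<phi> (\<lambda>x. a * f x) (\<bar>a\<bar> * c) \<le> 1" "\<bar>a\<bar> * c > 0"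
    using False by (auto simp: modular_cmult)
  moreover have "(\<lambda>x. a * f x) \<in> borel_measurable unit_leb"
    using assms by (auto dest: space_measurable)
  ultimately show ?thesis by (auto simp: space_iff_le_1)
qed

lemma space_solid:
  assumes "f \<in> borel_measurable unit_leb" "g \<in> orlicz_space \<phi>" "AE x in unit_leb. \<bar>f x\<bar> \<le> \<bar>g x\<bar>"
  shows "f \<in> orlicz_space \<phi>"
  using assms modular_mono[OF assms(3)] unfolding space_iff
  by (meson order.refl order_le_less_trans)

lemma heart_cmult:
  assumes "f \<in> orlicz_heart \<phi>"
  shows "(\<lambda>x. a * f x) \<in> orlicz_heart \<phi>"
  using assms by (cases "a = 0") (auto simp: heart_iff modular_cmult)

lemma heart_add:
  assumes "f \<in> orlicz_heart \<phi>" "g \<in> orlicz_heart \<phi>"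
  shows "(\<lambda>x. f x + g x) \<in> orlicz_heart \<phi>"
proof -
  have "modular \<phi> (\<lambda>x. f x + g x) c < \<infinity>" if "c > 0" for c
  proof -
    have "modular \<phi> (\<lambda>x. f x + g x) (c / 2 + c / 2) \<le> 
    ennreal (c / 2 / (c / 2 + c / 2)) * modular \<phi> f (c / 2) + ennreal (c / 2 / (c / 2 + c / 2)) * modular \<phi> g (c / 2)"
      using assms that by (intro modular_add) (auto simp: heart_iff)
    also have "\<dots> < \<infinity>"
      using assms that unfolding heart_iff 
      by (metis ennreal_add_less_top ennreal_less_top ennreal_mult_less_top half_gt_zero infinity_ennreal_def)
    finally show ?thesis by simp
  qed
  then show ?thesis using assms by (auto simp: heart_iff)
qed

lemma heart_diff:
  assumes "f \<in> orlicz_heart \<phi>" "g \<in> orlicz_heart \<phi>"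
  shows "(\<lambda>x. f x - g x) \<in> orlicz_heart \<phi>"
  using heart_add[OF assms(1) heart_cmult[OF assms(2), of "-1"]] by simp

lemma heart_sum:
  assumes "finite I" "\<And>i. i \<in> I \<Longrightarrow> f i \<in> orlicz_heart \<phi>"
  shows "(\<lambda>x. \<Sum>i\<in>I. f i x) \<in> orlicz_heart \<phi>"
  using assms
proof (induction I rule: finite_induct)
  case empty
  then show ?case by (simp add: heart_iff)
next
  case (insert i I)
  then show ?case by (auto intro!: heart_add)
qed

lemma modular_bounded:
  assumes "AE x in unit_leb. \<bar>f x\<bar> \<le> K" "c > 0" 
  shows "modular \<phi> f c \<le> ennreal (\<phi> (\<bar>K\<bar> / c))"
proof -
  have "modular \<phi> f c \<le> modular \<phi> (\<lambda>x. K) c"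
    using assms by (intro modular_mono) (auto elim!: eventually_mono)
  then show ?thesis by (simp add: modular_def del: nn_integral_const)
qed

lemma heart_bounded:
  assumes "f \<in> borel_measurable unit_leb" "AE x in unit_leb. \<bar>f x\<bar> \<le> K"
  shows "f \<in> orlicz_heart \<phi>"
  using assms modular_bounded[OF assms(2)]
  by (metis ennreal_less_top heart_iff infinity_ennreal_def order_le_less_trans)

text \<open>Bounds on functionals are used in this real form, with the modular at a scale
  \<open>c\<close> in place of the extended-valued norm. The constant is raised to at least 1
  because \<open>ennreal\<close> reads a negative \<open>C\<close> as 0.\<close>

lemma bounded_functionalE:
  assumes "bounded_functional \<phi> X l"
  obtains C where "C > 0" "\<And>f c. f \<in> X \<Longrightarrow> c > 0 \<Longrightarrow> modular \<phi> f c \<le> 1 \<Longrightarrow> \<bar>l f\<bar> \<le> C * c"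
proof -
  obtain C where C: "\<And>f. f \<in> X \<Longrightarrow> ennreal \<bar>l f\<bar> \<le> ennreal C * orlicz_norm \<phi> f"
    using assms unfolding bounded_functional_def by blast
  have "\<bar>l f\<bar> \<le> max 1 C * c" if f: "f \<in> X" "c > 0" "modular \<phi> f c \<le> 1" for f c
  proof -
    have "ennreal \<bar>l f\<bar> \<le> ennreal C * orlicz_norm \<phi> f" using C f by auto
    also have "\<dots> \<le> ennreal (max 1 C) * ennreal c"
      using norm_le[OF f(2,3)] by (intro mult_mono) (auto intro: ennreal_leI)
    also have "\<dots> = ennreal (max 1 C * c)" using f by (intro ennreal_mult[symmetric]) auto
    finally show ?thesis using f by (subst (asm) ennreal_le_iff) auto
  qed
  then show ?thesis by (intro that[of "max 1 C"]) auto
qed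

end

lemma bounded_functional_add:
  "bounded_functional \<phi> X l \<Longrightarrow> f \<in> X \<Longrightarrow> g \<in> X \<Longrightarrow> l (\<lambda>x. f x + g x) = l f + l g"
  by (simp add: bounded_functional_def)

lemma bounded_functional_cmult:
  "bounded_functional \<phi> X l \<Longrightarrow> f \<in> X \<Longrightarrow> l (\<lambda>x. c * f x) = c * l f"
  by (simp add: bounded_functional_def)

context orlicz
begin

lemma heart_functional_diff:
  assumes "bounded_functional \<phi> (orlicz_heart \<phi>) l" "f \<in> orlicz_heart \<phi>" "g \<in> orlicz_heart \<phi>"
  shows "l (\<lambda>x. f x - g x) = l f - l g"
  using bounded_functional_add[OF assms(1,2) heart_cmult[OF assms(3), of "-1"]]
    bounded_functional_cmult[OF assms(1,3), of "-1"] by simp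

lemma heart_functional_sum:
  assumes l: "bounded_functional \<phi> (orlicz_heart \<phi>) l" 
    and I: "finite I" "\<And>i. i \<in> I \<Longrightarrow> f i \<in> orlicz_heart \<phi>"
  shows "l (\<lambda>x. \<Sum>i\<in>I. f i x) = (\<Sum>i\<in>I. l (f i))"
  using I
proof (induction I rule: finite_induct)
  case empty
  have "(\<lambda>x. 0) \<in> orlicz_heart \<phi>" by (simp add: heart_iff)
  from bounded_functional_cmult[OF l this, of 0] show ?case by simp
next
  case (insert i I)
  then have "l (\<lambda>x. f i x + (\<Sum>i\<in>I. f i x)) = l (f i) + l (\<lambda>x. \<Sum>i\<in>I. f i x)"
    by (intro bounded_functional_add[OF l] heart_sum) auto
  then show ?case using insert by simp
qed

end

subsection \<open>Bounded functionals on the heart\<close>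

lemma unit_leb_integrable_bounded:
  assumes "f \<in> borel_measurable unit_leb" "\<And>x. \<bar>f x\<bar> \<le> (K::real)"
  shows "integrable unit_leb f"
  using assms by (intro unit_leb.integrable_const_bound[of f K]) auto

context orlicz
begin

text \<open>On [0, K / c] convexity bounds \<phi> by its chord, so the modular is at most the L^1
  norm times \<phi>(K / c) / K. For uniformly bounded functions convergence in L^1 therefore implies
  convergence in norm.\<close>

lemma modular_le_1_if_L1_small:
  assumes [measurable]: "f \<in> borel_measurable unit_leb" 
    and K: "\<And>x. \<bar>f x\<bar> \<le> K" "K > 0" and c: "c > 0" 
    and le: "(\<integral>x. \<bar>f x\<bar> \<partial>unit_leb) * \<phi> (K / c) \<le> K"
  shows "modular \<phi> f c \<le> 1"
proof -
  have int: "integrable unit_leb (\<lambda>x. \<bar>f x\<bar>)"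
    by (rule unit_leb_integrable_bounded[of _ K]) (use K in auto)
  have "modular \<phi> f c \<le> (\<integral>\<^sup>+x. ennreal (\<bar>f x\<bar> * (\<phi> (K / c) / K)) \<partial>unit_leb)"
    unfolding modular_def
  proof (intro nn_integral_mono ennreal_leI)
    fix x
    have "\<phi> ((\<bar>f x\<bar> / K) * (K / c)) \<le> (\<bar>f x\<bar> / K) * \<phi> (K / c)"
      using K(2) K(1)[of x] c by (intro scale_le) auto
    then show "\<phi> (\<bar>f x\<bar> / c) \<le> \<bar>f x\<bar> * (\<phi> (K / c) / K)" using K(2) by simp
  qed
  also have "\<dots> = ennreal (\<integral>x. \<bar>f x\<bar> * (\<phi> (K / c) / K) \<partial>unit_leb)"
    using K(2) c nonneg[of "K / c"] by (intro nn_integral_eq_integral) (auto intro!: integrable_mult_left int)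
  also have "\<dots> = ennreal ((\<integral>x. \<bar>f x\<bar> \<partial>unit_leb) * (\<phi> (K / c) / K))"
    using int by simp
  also have "\<dots> \<le> 1"
    using le K(2) by (simp add: field_simps)
  finally show ?thesis .
qed

text \<open>
  If \<open>l (x n)\<close> did not tend to \<open>0\<close>, one could select greedily sign combinations \<open>y\<close> of \<open>m\<close>
  nearly orthogonal terms with \<open>l y\<close> of order \<open>m\<close> but \<open>L\<^sup>2\<close> norm of order \<open>\<surd>m\<close> only.
\<close>

lemma functional_bounded_L2_null:
  assumes l: "bounded_functional \<phi> (orlicz_heart \<phi>) l"
    and meas [measurable]: "\<And>n. x n \<in> borel_measurable unit_leb"
    and K: "\<And>n t. \<bar>x n t\<bar> \<le> K"
    and null: "\<And>m. (\<lambda>n. \<integral>t. x m t * x n t \<partial>unit_leb) \<longlonglongrightarrow> 0"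
  shows "(\<lambda>n. l (x n)) \<longlonglongrightarrow> 0"
proof (rule ccontr)
  assume "\<not> ?thesis"
  then obtain \<epsilon> where \<epsilon>: "\<epsilon> > 0" "\<not> (\<forall>\<^sub>F n in sequentially. \<bar>l (x n)\<bar> < \<epsilon>)"
    by (auto simp: tendsto_iff dist_real_def)
  then have freq: "\<exists>\<^sub>F n in sequentially. \<bar>l (x n)\<bar> \<ge> \<epsilon>"
    by (simp add: frequently_def not_le)
  have K0: "K \<ge> 0" using K[of 0 0] by linarith
  have heart: "x n \<in> orlicz_heart \<phi>" for n
    using K by (intro heart_bounded[of _ K]) auto
  have "\<exists>y. y \<in> borel_measurable unit_leb \<and> (\<forall>t. \<bar>y t\<bar> \<le> m * K) \<and>
     (\<integral>t. (y t)\<^sup>2 \<partial>unit_leb) \<le> m * (K\<^sup>2 + 1) \<and> l y \<ge> m * \<epsilon> \<and>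
     (\<lambda>n. \<integral>t. y t * x n t \<partial>unit_leb) \<longlonglongrightarrow> 0" (is "\<exists>y. ?P m y") for m :: nat
  proof (induction m)
    case 0
    have "l (\<lambda>t. 0 * x 0 t) = 0 * l (x 0)"
      by (rule bounded_functional_cmult[OF l heart])
    then show ?case by (intro exI[of _ "\<lambda>t. 0"]) auto
  next
    case (Suc m)
    then obtain y where y [measurable]: "y \<in> borel_measurable unit_leb" 
      and yb: "\<And>t. \<bar>y t\<bar> \<le> m * K" and y2: "(\<integral>t. (y t)\<^sup>2 \<partial>unit_leb) \<le> m * (K\<^sup>2 + 1)"
      and ly: "l y \<ge> m * \<epsilon>" and ynull: "(\<lambda>n. \<integral>t. y t * x n t \<partial>unit_leb) \<longlonglongrightarrow> 0"
      by blast
    have yheart: "y \<in> orlicz_heart \<phi>" using yb by (intro heart_bounded[of _ "m * K"]) auto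
    have "\<forall>\<^sub>F n in sequentially. \<bar>\<integral>t. y t * x n t \<partial>unit_leb\<bar> < 1 / 2"
      using tendstoD[OF ynull, of "1 / 2"] by (simp add: dist_real_def)
    from frequently_ex[OF frequently_eventually_conj[OF freq this]]
    obtain n where n: "\<bar>\<integral>t. y t * x n t \<partial>unit_leb\<bar> < 1 / 2" "\<bar>l (x n)\<bar> \<ge> \<epsilon>"
      by blast
    \<comment> \<open>The sign makes the new contribution to \<open>l\<close> positive. In the
      second moment the new term costs at most \<open>K\<^sup>2\<close> and the cross term at most
      1, because the inner product with \<open>y\<close> was made smaller than 1/2.\<close>
    define \<sigma> where "\<sigma> = (if l (x n) \<ge> 0 then 1 else - 1 :: real)"
    define z where "z = (\<lambda>t. y t + \<sigma> * x n t)"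
    have \<sigma>: "\<sigma>\<^sup>2 = 1" "\<sigma> * l (x n) = \<bar>l (x n)\<bar>" "\<bar>\<sigma>\<bar> = 1" by (auto simp: \<sigma>_def)
    have "l z = l y + \<sigma> * l (x n)"
      unfolding z_def using yheart heart[of n]
      by (subst bounded_functional_add[OF l]) (auto intro: heart_cmult simp: bounded_functional_cmult[OF l])
    then have lz: "l z \<ge> Suc m * \<epsilon>" using n ly \<sigma> by (simp add: algebra_simps)
    have yx: "integrable unit_leb (\<lambda>t. y t * x k t)" for k
      by (rule unit_leb_integrable_bounded[of _ "m * K * K"]) 
        (use yb K K0 in \<open>auto simp: abs_mult intro!: mult_mono\<close>)
    have xx: "integrable unit_leb (\<lambda>t. x j t * x k t)" for j k
      by (rule unit_leb_integrable_bounded[of _ "K * K"]) 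
        (use K K0 in \<open>auto simp: abs_mult intro!: mult_mono\<close>)
    have yy: "integrable unit_leb (\<lambda>t. (y t)\<^sup>2)"
    proof (rule unit_leb_integrable_bounded[of _ "(m * K)\<^sup>2"])
      fix t show "\<bar>(y t)\<^sup>2\<bar> \<le> (m * K)\<^sup>2" 
        using power_mono[OF yb[of t], of 2] by simp
    qed auto
    have "(\<integral>t. x n t * x n t \<partial>unit_leb) \<le> (\<integral>t. K * K \<partial>unit_leb)"
    proof (intro integral_mono xx)
      fix t show "x n t * x n t \<le> K * K"
        using abs_le_square_iff[of "x n t" K] K[of n t] K0 by (simp add: power2_eq_square)
    qed auto
    then have x2: "(\<integral>t. x n t * x n t \<partial>unit_leb) \<le> K\<^sup>2" by (simp add: power2_eq_square)
    have "(\<integral>t. (z t)\<^sup>2 \<partial>unit_leb) = (\<integral>t. (y t)\<^sup>2 + 2 * \<sigma> * (y t * x n t) + x n t * x n t \<partial>unit_leb)"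
      unfolding z_def using \<sigma>(1) 
      by (intro Bochner_Integration.integral_cong) (auto simp: power2_eq_square algebra_simps \<sigma>_def)
    also have "\<dots> = (\<integral>t. (y t)\<^sup>2 \<partial>unit_leb) + 2 * \<sigma> * (\<integral>t. y t * x n t \<partial>unit_leb) + (\<integral>t. x n t * x n t \<partial>unit_leb)"
      using yx xx yy by simp
    also have "2 * \<sigma> * (\<integral>t. y t * x n t \<partial>unit_leb) \<le> 1"
      using n(1) \<sigma>(3) by (auto simp: \<sigma>_def abs_if split: if_splits)
    finally have z2: "(\<integral>t. (z t)\<^sup>2 \<partial>unit_leb) \<le> Suc m * (K\<^sup>2 + 1)"
      using x2 y2 by (simp add: algebra_simps)
    have zb: "\<bar>z t\<bar> \<le> Suc m * K" for t
      using yb[of t] K[of n t] abs_triangle_ineq[of "y t" "\<sigma> * x n t"] \<sigma>(3)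
      by (simp add: z_def abs_mult algebra_simps)
    have "(\<lambda>k. (\<integral>t. y t * x k t \<partial>unit_leb) + \<sigma> * (\<integral>t. x n t * x k t \<partial>unit_leb)) \<longlonglongrightarrow> 0 + \<sigma> * 0"
      by (intro tendsto_intros ynull null)
    moreover have "(\<integral>t. y t * x k t \<partial>unit_leb) + \<sigma> * (\<integral>t. x n t * x k t \<partial>unit_leb)
       = (\<integral>t. z t * x k t \<partial>unit_leb)" for k
    proof -
      have "(\<integral>t. z t * x k t \<partial>unit_leb) = (\<integral>t. y t * x k t + \<sigma> * (x n t * x k t) \<partial>unit_leb)"
        unfolding z_def by (intro Bochner_Integration.integral_cong) (auto simp: algebra_simps)
      then show ?thesis using yx xx by simp
    qed
    ultimately have "(\<lambda>k. \<integral>t. z t * x k t \<partial>unit_leb) \<longlonglongrightarrow> 0" by simp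
    moreover have "z \<in> borel_measurable unit_leb" unfolding z_def by measurable
    ultimately show ?case using z2 zb lz by blast
  qed
  then have "\<forall>m. \<exists>y. ?P m y" by blast
  from choice[OF this] obtain y where y [measurable]: "\<And>m::nat. y m \<in> borel_measurable unit_leb" 
      and yb: "\<And>m t. \<bar>y m t\<bar> \<le> m * K" and y2: "\<And>m. (\<integral>t. (y m t)\<^sup>2 \<partial>unit_leb) \<le> m * (K\<^sup>2 + 1)"
      and ly: "\<And>m. l (y m) \<ge> m * \<epsilon>"
    by blast
  obtain C where C: "C > 0" "\<And>f c. f \<in> orlicz_heart \<phi> \<Longrightarrow> c > 0 \<Longrightarrow> modular \<phi> f c \<le> 1 \<Longrightarrow> \<bar>l f\<bar> \<le> C * c"
    using bounded_functionalE[OF l] by blast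
  \<comment> \<open>At scale \<open>c\<close> the functional is bounded by C c, half of \<epsilon>.
    The threshold \<delta> is such that an L^1 norm of at most 2 \<delta> meets the hypothesis of
    \<open>modular_le_1_if_L1_small\<close> with bound \<open>K + 1\<close>, which is positive even
    if \<open>K\<close> is 0.\<close>
  define c where "c = \<epsilon> / (2 * C)"
  have c: "c > 0" using C \<epsilon> by (simp add: c_def)
  define \<delta> where "\<delta> = (K + 1) / (2 * (\<phi> ((K + 1) / c) + 1))"
  have ph: "\<phi> ((K + 1) / c) \<ge> 0" using K0 c by (intro nonneg) auto
  then have \<delta>: "\<delta> > 0" using K0 by (simp add: \<delta>_def)
  obtain m :: nat where m: "real m > (K\<^sup>2 + 1) / \<delta>\<^sup>2"
    using reals_Archimedean2 by blast
  have "(K\<^sup>2 + 1) / \<delta>\<^sup>2 > 0" using \<delta> by (intro divide_pos_pos) (auto simp: add_nonneg_pos)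
  then have m0: "real m > 0" using m by linarith
  define z where "z = (\<lambda>t. 1 / m * y m t)"
  have [measurable]: "z \<in> borel_measurable unit_leb" unfolding z_def by measurable
  have zb: "\<bar>z t\<bar> \<le> K" for t
    using yb[of m t] m0 by (simp add: z_def abs_mult field_simps)
  have zb': "\<bar>z t\<bar> \<le> K + 1" for t using zb[of t] by linarith
  have z2i: "integrable unit_leb (\<lambda>t. (z t)\<^sup>2)"
  proof (rule unit_leb_integrable_bounded[of _ "K\<^sup>2"])
    fix t show "\<bar>(z t)\<^sup>2\<bar> \<le> K\<^sup>2" 
      using power_mono[OF zb[of t], of 2] by simp
  qed auto
  have "(\<integral>t. (z t)\<^sup>2 \<partial>unit_leb) = (\<integral>t. (y m t)\<^sup>2 \<partial>unit_leb) / m\<^sup>2"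
    unfolding z_def by (simp add: power_divide)
  also have "\<dots> \<le> m * (K\<^sup>2 + 1) / m\<^sup>2" using y2[of m] by (intro divide_right_mono) auto
  also have "\<dots> = (K\<^sup>2 + 1) / m" using m0 by (simp add: power2_eq_square)
  also have "\<dots> \<le> \<delta>\<^sup>2" using m m0 \<delta> by (simp add: field_simps)
  finally have z2: "(\<integral>t. (z t)\<^sup>2 \<partial>unit_leb) \<le> \<delta>\<^sup>2" .
  have "(\<integral>t. \<bar>z t\<bar> \<partial>unit_leb) \<le> (\<integral>t. \<delta> + (z t)\<^sup>2 / \<delta> \<partial>unit_leb)"
  proof (intro integral_mono)
    show "integrable unit_leb (\<lambda>t. \<bar>z t\<bar>)" by (rule unit_leb_integrable_bounded[of _ K]) (use zb in auto)
    show "integrable unit_leb (\<lambda>t. \<delta> + (z t)\<^sup>2 / \<delta>)" using z2i by simp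
    fix t
    show "\<bar>z t\<bar> \<le> \<delta> + (z t)\<^sup>2 / \<delta>"
    proof (cases "\<bar>z t\<bar> \<le> \<delta>")
      case True
      then show ?thesis using \<delta> by (simp add: add_increasing2)
    next
      case False
      then have "\<delta> * \<bar>z t\<bar> \<le> \<bar>z t\<bar> * \<bar>z t\<bar>" by (intro mult_right_mono) auto
      then show ?thesis using \<delta> by (simp add: power2_eq_square field_simps add_increasing)
    qed
  qed
  also have "\<dots> = \<delta> + (\<integral>t. (z t)\<^sup>2 \<partial>unit_leb) / \<delta>" using z2i by simp
  also have "\<dots> \<le> \<delta> + \<delta>\<^sup>2 / \<delta>" using z2 \<delta> by (intro add_left_mono divide_right_mono) auto
  finally have z1: "(\<integral>t. \<bar>z t\<bar> \<partial>unit_leb) \<le> 2 * \<delta>" using \<delta> by (simp add: power2_eq_square)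
  have "(\<integral>t. \<bar>z t\<bar> \<partial>unit_leb) * \<phi> ((K + 1) / c) \<le> (2 * \<delta>) * (\<phi> ((K + 1) / c) + 1)"
    using z1 ph \<delta> by (intro mult_mono) auto
  also have "\<dots> = K + 1" 
  proof -
    have "\<phi> ((K + 1) / c) + 1 \<noteq> 0" using ph by linarith
    then show ?thesis unfolding \<delta>_def
      by (simp add: divide_simps) (simp add: algebra_simps)
  qed
  finally have "modular \<phi> z c \<le> 1"
    using K0 c zb' by (intro modular_le_1_if_L1_small[of z "K + 1"]) auto
  then have "\<bar>l z\<bar> \<le> C * c" 
    using c zb by (intro C(2) heart_bounded[of z K]) auto
  also have "\<dots> < \<epsilon>" using C \<epsilon> by (simp add: c_def)
  finally have "l z < \<epsilon>" by simp
  moreover have "l z = 1 / m * l (y m)"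
    unfolding z_def using yb[of m] by (intro bounded_functional_cmult[OF l] heart_bounded[of "y m" "m * K"]) auto
  then have "real m * \<epsilon> \<le> real m * l z" using ly[of m] m0 by (simp add: field_simps)
  then have "l z \<ge> \<epsilon>" using m0 by (simp only: mult_le_cancel_left_pos)
  ultimately show False by simp
qed

text \<open>Any choice of subgradients is monotone: adding the inequalities at \<open>s\<close> and
  at \<open>t\<close> gives (d s - d t) (t - s) \<le> 0. Monotonicity in turn gives measurability.
  The function serves to build norming elements and to linearise modulars under weak limits.\<close>

lemma subgradient:
  obtains d where "\<And>s t. 0 \<le> s \<Longrightarrow> s \<le> t \<Longrightarrow> d s \<le> d t" "\<And>t. 0 \<le> t \<Longrightarrow> 0 \<le> d t"
    "\<And>s t. 0 \<le> s \<Longrightarrow> 0 \<le> t \<Longrightarrow> \<phi> t + d t * (s - t) \<le> \<phi> s" "(\<lambda>t. d \<bar>t\<bar>) \<in> borel_measurable borel"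
proof -
  have "\<exists>a\<ge>0. \<forall>s\<ge>0. \<phi> t + a * (s - t) \<le> \<phi> s" if t: "t \<ge> 0" for t
  proof (cases "t = 0")
    case True
    then show ?thesis using nonneg by (intro exI[of _ 0]) simp
  next
    case False
    \<comment> \<open>For t > 0 this is the right derivative; its inequality at s = 0 shows that it
      is nonnegative.\<close>
    define a where "a = Inf ((\<lambda>s. (\<phi> t - \<phi> s) / (t - s)) ` ({t<..} \<inter> {0..}))"
    have a: "\<phi> t + a * (s - t) \<le> \<phi> s" if "s \<ge> 0" for s
      unfolding a_def 
      by (rule convex_le_Inf_differential[OF convex]) (use t False that in simp_all)
    have "a * t \<ge> \<phi> t" using a[of 0] by simp
    moreover have "\<phi> t \<ge> 0" "t > 0" using nonneg[OF t] t False by auto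
    ultimately have "a * t \<ge> 0" by linarith
    then have "a \<ge> 0" using \<open>t > 0\<close> by (simp add: zero_le_mult_iff)
    then show ?thesis using a by (intro exI[of _ a]) simp
  qed
  then have "\<forall>t. \<exists>a. t \<ge> 0 \<longrightarrow> a \<ge> 0 \<and> (\<forall>s\<ge>0. \<phi> t + a * (s - t) \<le> \<phi> s)" by blast
  from choice[OF this]
  obtain d where d: "\<And>t. t \<ge> 0 \<Longrightarrow> d t \<ge> 0" "\<And>s t. t \<ge> 0 \<Longrightarrow> s \<ge> 0 \<Longrightarrow> \<phi> t + d t * (s - t) \<le> \<phi> s"
    by blast
  have mono: "d s \<le> d t" if "0 \<le> s" "s \<le> t" for s t
  proof (cases "s = t")
    case False
    have "(d s - d t) * (t - s) \<le> 0"
      using d(2)[of s t] d(2)[of t s] that by (simp add: algebra_simps)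
    then show ?thesis using False that by (simp add: mult_le_0_iff)
  qed auto
  have "mono (\<lambda>t. d (max 0 t))" by (auto intro!: monoI mono)
  then have "(\<lambda>t. d (max 0 t)) \<in> borel_measurable borel" by (rule borel_measurable_mono)
  then have "(\<lambda>t. d (max 0 \<bar>t\<bar>)) \<in> borel_measurable borel" by measurable
  then show ?thesis using that[of d] d mono by simp
qed

text \<open>Jensen's inequality for infinitely many terms. At scale \<open>2 * W\<close> some finite
  partial sum already exceeds half of the series, which reduces the claim to finite convex
  combinations.\<close>

lemma modular_weighted_suminf:
  assumes meas: "\<And>k. g k \<in> borel_measurable unit_leb" and g1: "\<And>k::nat. modular \<phi> (g k) 1 \<le> 1"
    and w: "\<And>k. 0 \<le> w k" "w sums W" "W > 0"
  shows "AE x in unit_leb. summable (\<lambda>k. w k * \<bar>g k x\<bar>)"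
    and "modular \<phi> (\<lambda>x. \<Sum>k. w k * \<bar>g k x\<bar>) (2 * W) \<le> 1"
proof -
  note [measurable] = meas
  have W: "(\<Sum>k. ennreal (w k / W)) = 1"
    using w sums_divide[OF w(2), of W]
    by (subst suminf_ennreal2) (auto simp: sums_iff)
  define S where "S = (\<lambda>x. \<Sum>k. ennreal (w k / W) * ennreal (\<phi> \<bar>g k x\<bar>))"
  have "(\<integral>\<^sup>+x. S x \<partial>unit_leb) = (\<Sum>k. ennreal (w k / W) * modular \<phi> (g k) 1)"
    unfolding S_def modular_def by (subst nn_integral_suminf) (auto simp: nn_integral_cmult)
  also have "\<dots> \<le> (\<Sum>k. ennreal (w k / W) * 1)"
    using g1 by (intro suminf_le mult_left_mono) auto
  finally have S1: "(\<integral>\<^sup>+x. S x \<partial>unit_leb) \<le> 1" using W by simp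
  have [measurable]: "S \<in> borel_measurable unit_leb" unfolding S_def by measurable
  have fin: "AE x in unit_leb. S x \<noteq> \<infinity>"
    by (rule nn_integral_PInf_AE) (use S1 in \<open>auto simp: top_unique\<close>)
  obtain t where t: "t > 0" "\<phi> t > 0" using ex_pos by blast
  have sumw: "summable w" "suminf w = W" using w by (auto simp: sums_iff)
  show summ: "AE x in unit_leb. summable (\<lambda>k. w k * \<bar>g k x\<bar>)"
    using fin
  proof eventually_elim
    fix x assume "S x \<noteq> \<infinity>"
    moreover have "ennreal (w k / W * \<phi> \<bar>g k x\<bar>) = ennreal (w k / W) * ennreal (\<phi> \<bar>g k x\<bar>)" for k
      using w(1,3) by (intro ennreal_mult nonneg) auto
    ultimately have "(\<Sum>k. ennreal (w k / W * \<phi> \<bar>g k x\<bar>)) \<noteq> \<infinity>"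
      by (simp add: S_def)
    then have s: "summable (\<lambda>k. w k / W * \<phi> \<bar>g k x\<bar>)"
      using w nonneg by (intro summable_suminf_not_top) auto
    have "summable (\<lambda>k. w k * t + W * t / \<phi> t * (w k / W * \<phi> \<bar>g k x\<bar>))"
      using s sumw by (intro summable_add summable_mult summable_mult2)
    then show "summable (\<lambda>k. w k * \<bar>g k x\<bar>)"
    proof (rule summable_comparison_test'[of _ 0])
      fix k
      \<comment> \<open>At least linear growth of \<phi> beyond \<open>t\<close> turns summability
        of the weighted \<phi>(|g k x|) into summability of the weighted |g k x|.\<close>
      have "\<bar>g k x\<bar> \<le> t + t / \<phi> t * \<phi> \<bar>g k x\<bar>"
      proof (cases "\<bar>g k x\<bar> \<le> t")
        case True
        then show ?thesis using t nonneg by (simp add: add_increasing2)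
      next
        case False
        have "(\<bar>g k x\<bar> / t) * \<phi> t \<le> \<phi> ((\<bar>g k x\<bar> / t) * t)"
          using False t by (intro scale_ge) auto
        then show ?thesis using t by (simp add: field_simps add_increasing)
      qed
      then have "w k * \<bar>g k x\<bar> \<le> w k * (t + t / \<phi> t * \<phi> \<bar>g k x\<bar>)"
        using w by (intro mult_left_mono) auto
      then show "norm (w k * \<bar>g k x\<bar>) \<le> w k * t + W * t / \<phi> t * (w k / W * \<phi> \<bar>g k x\<bar>)"
        using w(1,3) by (simp add: algebra_simps abs_mult)
    qed
  qed
  have "modular \<phi> (\<lambda>x. \<Sum>k. w k * \<bar>g k x\<bar>) (2 * W) \<le> (\<integral>\<^sup>+x. S x \<partial>unit_leb)"
    unfolding modular_def
  proof (rule nn_integral_mono_AE, use summ in eventually_elim)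
    fix x assume s: "summable (\<lambda>k. w k * \<bar>g k x\<bar>)"
    define T where "T = (\<Sum>k. w k * \<bar>g k x\<bar>)"
    have T0: "T \<ge> 0" unfolding T_def using s w by (intro suminf_nonneg) auto
    show "ennreal (\<phi> (\<bar>\<Sum>k. w k * \<bar>g k x\<bar>\<bar> / (2 * W))) \<le> S x"
    proof (cases "T = 0")
      case True
      then show ?thesis by (simp add: T_def)
    next
      case False
      have "(\<lambda>n. \<Sum>k<n. w k * \<bar>g k x\<bar>) \<longlonglongrightarrow> T"
        using s unfolding T_def by (rule summable_LIMSEQ)
      then have "\<forall>\<^sub>F n in sequentially. (\<Sum>k<n. w k * \<bar>g k x\<bar>) > T / 2"
        using False T0 by (intro order_tendstoD) auto
      then obtain n where n: "(\<Sum>k<n. w k * \<bar>g k x\<bar>) > T / 2"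
        by (meson eventually_happens sequentially_bot)
      have le: "(\<Sum>k<n. w k / W) \<le> 1"
      proof -
        have "(\<Sum>k<n. w k) \<le> W" using sumw w(1) by (metis sum_le_suminf finite_lessThan)
        then show ?thesis using w(3) by (simp flip: sum_divide_distrib)
      qed
      have "\<phi> (\<Sum>k<m. w k / W * \<bar>g k x\<bar>) \<le> (\<Sum>k<m. w k / W * \<phi> \<bar>g k x\<bar>)" if "m \<le> n" for m
      proof -
        \<comment> \<open>The weights of the partial sum add up to at most 1; the missing mass is
          placed at the point 0, where \<phi> vanishes.\<close>
        define v where "v = (\<lambda>k. if k < m then w k / W else 1 - (\<Sum>k<m. w k / W))"
        have "(\<Sum>k<m. w k / W) \<le> (\<Sum>k<n. w k / W)"
          using that w by (intro sum_mono2) auto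
        then have v: "v k \<ge> 0" for k using le w by (auto simp: v_def)
        have v1: "(\<Sum>k\<in>{..m}. v k) = 1" unfolding v_def by (simp add: lessThan_Suc_atMost[symmetric])
        have "\<phi> (\<Sum>k\<in>{..m}. v k *\<^sub>R (if k < m then \<bar>g k x\<bar> else 0)) 
          \<le> (\<Sum>k\<in>{..m}. v k * \<phi> (if k < m then \<bar>g k x\<bar> else 0))"
          using v v1 by (intro convex_on_sum[OF _ _ convex]) auto
        also have "(\<Sum>k\<in>{..m}. v k * \<phi> (if k < m then \<bar>g k x\<bar> else 0)) = (\<Sum>k<m. w k / W * \<phi> \<bar>g k x\<bar>)"
          by (simp add: lessThan_Suc_atMost[symmetric] v_def)
        also have "(\<Sum>k\<in>{..m}. v k *\<^sub>R (if k < m then \<bar>g k x\<bar> else 0)) = (\<Sum>k<m. w k / W * \<bar>g k x\<bar>)"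
          by (simp add: lessThan_Suc_atMost[symmetric] v_def)
        finally show ?thesis .
      qed
      from this[of n] have conv: "\<phi> (\<Sum>k<n. w k / W * \<bar>g k x\<bar>) \<le> (\<Sum>k<n. w k / W * \<phi> \<bar>g k x\<bar>)" by simp
      have "\<phi> (\<bar>T\<bar> / (2 * W)) \<le> \<phi> (\<Sum>k<n. w k / W * \<bar>g k x\<bar>)"
        using n T0 w(3) by (intro mono) (auto simp: field_simps simp flip: sum_divide_distrib)
      also note conv
      finally have "ennreal (\<phi> (\<bar>T\<bar> / (2 * W))) \<le> ennreal (\<Sum>k<n. w k / W * \<phi> \<bar>g k x\<bar>)"
        by (rule ennreal_leI)
      also have "\<dots> = (\<Sum>k<n. ennreal (w k / W) * ennreal (\<phi> \<bar>g k x\<bar>))"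
        using w(1,3) nonneg by (subst sum_ennreal[symmetric]) (auto intro!: sum.cong simp: ennreal_mult[symmetric])
      also have "\<dots> \<le> S x" unfolding S_def by (rule sum_le_suminf) auto
      finally show ?thesis by (simp add: T_def)
    qed
  qed
  then show "modular \<phi> (\<lambda>x. \<Sum>k. w k * \<bar>g k x\<bar>) (2 * W) \<le> 1" using S1 by simp
qed

end

subsection \<open>Conjugate pairs\<close>

locale orlicz_pair = orlicz \<phi> + conj: orlicz \<psi> for \<phi> \<psi> +
  assumes conjugate: "\<And>s. s \<ge> 0 \<Longrightarrow> ereal (\<psi> s) = conjugate \<phi> s"
begin

lemma young: 
  assumes "0 \<le> s" "0 \<le> t"
  shows "s * t \<le> \<phi> t + \<psi> s"
proof -
  have "ereal (s * t - \<phi> t) \<le> ereal (\<psi> s)"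
    unfolding conjugate[OF assms(1)] conjugate_def using assms by (intro SUP_upper) auto
  then show ?thesis by simp
qed

lemma conjugate_le:
  assumes "0 \<le> s" "\<And>t. 0 \<le> t \<Longrightarrow> s * t - \<phi> t \<le> a"
  shows "\<psi> s \<le> a"
proof -
  have "ereal (\<psi> s) \<le> ereal a"
    unfolding conjugate[OF assms(1)] conjugate_def using assms by (intro SUP_least) auto
  then show ?thesis by simp
qed

text \<open>Young's inequality with slope 2 / \<epsilon> bounds 2 t by \<epsilon> \<phi>(t) plus a
  constant, and for large \<open>t\<close> the constant is absorbed by one of the two copies of
  \<open>t\<close>. This yields uniform integrability of the unit ball.\<close>

lemma superlinear:
  assumes "\<epsilon> > 0"
  obtains K where "K > 0" "\<And>t. t \<ge> K \<Longrightarrow> t \<le> \<epsilon> * \<phi> t"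
proof (rule that[of "\<epsilon> * (\<psi> (2 / \<epsilon>)) + 1"])
  have \<psi>: "\<psi> (2 / \<epsilon>) \<ge> 0" using assms by (intro conj.nonneg) auto
  then show "\<epsilon> * (\<psi> (2 / \<epsilon>)) + 1 > 0" using assms by (simp add: add_nonneg_pos)
  fix t assume t: "t \<ge> \<epsilon> * (\<psi> (2 / \<epsilon>)) + 1"
  then have "t \<ge> 0" using assms \<psi> by (smt (verit) mult_nonneg_nonneg)
  then have "2 / \<epsilon> * t \<le> \<phi> t + \<psi> (2 / \<epsilon>)" using assms by (intro young) auto
  then have "\<epsilon> * (2 / \<epsilon> * t) \<le> \<epsilon> * (\<phi> t + \<psi> (2 / \<epsilon>))" using assms by (intro mult_left_mono) auto
  then have "2 * t \<le> \<epsilon> * \<phi> t + \<epsilon> * \<psi> (2 / \<epsilon>)" using assms by (simp add: algebra_simps)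
  then show "t \<le> \<epsilon> * \<phi> t" using t by simp
qed

text \<open>Young's inequality is integrated after normalising both factors; the factor 2 is the sum
  of the two modular bounds.\<close>

lemma hoelder:
  assumes [measurable]: "f \<in> borel_measurable unit_leb" "g \<in> borel_measurable unit_leb"
    and ab: "a > 0" "b > 0" and le: "modular \<phi> f a \<le> 1" "modular \<psi> g b \<le> 1"
  shows "integrable unit_leb (\<lambda>x. f x * g x)" "\<bar>\<integral>x. f x * g x \<partial>unit_leb\<bar> \<le> 2 * a * b"
proof -
  have [measurable]: "(\<lambda>x. \<phi> (\<bar>f x\<bar> / a)) \<in> borel_measurable unit_leb" "(\<lambda>x. \<psi> (\<bar>g x\<bar> / b)) \<in> borel_measurable unit_leb"
    using ab by (auto intro!: measurable_comp_div_pos conj.measurable_comp_div_pos)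
  have "(\<integral>\<^sup>+x. ennreal (norm (f x * g x)) \<partial>unit_leb) \<le> 
    (\<integral>\<^sup>+x. ennreal (a * b) * (ennreal (\<phi> (\<bar>f x\<bar> / a)) + ennreal (\<psi> (\<bar>g x\<bar> / b))) \<partial>unit_leb)"
  proof (rule nn_integral_mono)
    fix x
    have "(\<bar>g x\<bar> / b) * (\<bar>f x\<bar> / a) \<le> \<phi> (\<bar>f x\<bar> / a) + \<psi> (\<bar>g x\<bar> / b)"
      using ab by (intro young) auto
    then have "\<bar>f x\<bar> * \<bar>g x\<bar> \<le> (a * b) * (\<phi> (\<bar>f x\<bar> / a) + \<psi> (\<bar>g x\<bar> / b))"
      using ab by (simp add: field_simps)
    then have "ennreal (norm (f x * g x)) \<le> ennreal ((a * b) * (\<phi> (\<bar>f x\<bar> / a) + \<psi> (\<bar>g x\<bar> / b)))"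
      by (intro ennreal_leI) (simp add: abs_mult)
    also have "\<dots> = ennreal (a * b) * (ennreal (\<phi> (\<bar>f x\<bar> / a)) + ennreal (\<psi> (\<bar>g x\<bar> / b)))"
      using ab nonneg[of "\<bar>f x\<bar> / a"] conj.nonneg[of "\<bar>g x\<bar> / b"] by (simp add: ennreal_mult ennreal_plus)
    finally show "ennreal (norm (f x * g x)) \<le> \<dots>" .
  qed
  also have "\<dots> = ennreal (a * b) * (modular \<phi> f a + modular \<psi> g b)"
    unfolding modular_def by (simp add: nn_integral_cmult nn_integral_add)
  also have "\<dots> \<le> ennreal (a * b) * (1 + 1)"
    using le by (intro mult_left_mono add_mono) auto
  also have "(1 + 1 :: ennreal) = ennreal 2" by simp
  also have "ennreal (a * b) * ennreal 2 = ennreal (2 * a * b)"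
    using ab by (subst ennreal_mult[symmetric]) (auto simp: ac_simps)
  finally have le: "(\<integral>\<^sup>+x. ennreal (norm (f x * g x)) \<partial>unit_leb) \<le> ennreal (2 * a * b)" .
  then show int: "integrable unit_leb (\<lambda>x. f x * g x)" 
    by (intro integrableI_bounded) (auto intro: order_le_less_trans)
  have "ennreal (norm (\<integral>x. f x * g x \<partial>unit_leb)) \<le> ennreal (2 * a * b)"
    using integral_norm_bound_ennreal[OF int] le by (rule order_trans)
  then show "\<bar>\<integral>x. f x * g x \<partial>unit_leb\<bar> \<le> 2 * a * b" using ab by simp
qed

lemma bounded_functional_integral:
  assumes g: "g \<in> orlicz_space \<psi>"
  shows "bounded_functional \<phi> (orlicz_space \<phi>) (\<lambda>f. \<integral>x. f x * g x \<partial>unit_leb)"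
proof -
  obtain b where b: "b > 0" "modular \<psi> g b \<le> 1" using g by (auto simp: conj.space_iff_le_1)
  have gm [measurable]: "g \<in> borel_measurable unit_leb" using g by (rule conj.space_measurable)
  have int: "integrable unit_leb (\<lambda>x. f x * g x)" if f: "f \<in> orlicz_space \<phi>" for f
  proof -
    obtain a where "a > 0" "modular \<phi> f a \<le> 1" using f by (auto simp: space_iff_le_1)
    then show ?thesis using b by (intro hoelder[of f g a b] space_measurable[OF f] gm)
  qed
  have "ennreal \<bar>\<integral>x. f x * g x \<partial>unit_leb\<bar> \<le> ennreal (2 * b) * orlicz_norm \<phi> f" 
    if f: "f \<in> orlicz_space \<phi>" for f
  proof -
    \<comment> \<open>Dividing by \<open>2 * b\<close> first lets the Hoelder bound be compared with
      every admissible constant in the infimum that defines the norm.\<close>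
    have "ennreal \<bar>\<integral>x. f x * g x \<partial>unit_leb\<bar> / ennreal (2 * b) \<le> orlicz_norm \<phi> f"
      unfolding orlicz_norm_def
    proof (rule INF_greatest)
      fix a assume a: "a \<in> {c. 0 < c \<and> modular \<phi> f c \<le> 1}"
      then have "\<bar>\<integral>x. f x * g x \<partial>unit_leb\<bar> \<le> 2 * a * b"
        using b by (intro hoelder space_measurable[OF f] gm) auto
      then have "\<bar>\<integral>x. f x * g x \<partial>unit_leb\<bar> / (2 * b) \<le> a" using b by (simp add: field_simps)
      then show "ennreal \<bar>\<integral>x. f x * g x \<partial>unit_leb\<bar> / ennreal (2 * b) \<le> ennreal a"
        using b by (simp add: divide_ennreal ennreal_leI)
    qed
    then have "ennreal (2 * b) * (ennreal \<bar>\<integral>x. f x * g x \<partial>unit_leb\<bar> / ennreal (2 * b)) \<le> ennreal (2 * b) * orlicz_norm \<phi> f"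
      by (intro mult_left_mono) auto
    moreover have "ennreal (2 * b) * (ennreal \<bar>\<integral>x. f x * g x \<partial>unit_leb\<bar> / ennreal (2 * b)) 
        = ennreal \<bar>\<integral>x. f x * g x \<partial>unit_leb\<bar>"
      using b by (simp add: divide_ennreal ennreal_mult[symmetric])
    ultimately show ?thesis by simp
  qed
  then show ?thesis
    unfolding bounded_functional_def using int by (auto simp: distrib_right mult.assoc)
qed

text \<open>A subgradient \<open>d\<close> of \<phi> gives equality in Young's inequality, so
  \<open>d (h x)\<close>, cut off where \<open>h\<close> is large, nearly norms \<open>f\<close>.
  With \<open>B\<close> the integral of \<open>h * u\<close>, the modular of \<open>h\<close> on the
  cut-off set and the \<psi>-modular of \<open>u\<close> are both at most \<open>B\<close>, and B >
  1; dividing by \<open>B\<close> normalises \<open>g\<close> and makes the pairing exactly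
  \<open>R\<close>.\<close>

lemma ex_norming:
  assumes f: "f \<in> orlicz_space \<phi>" and R: "R > 0" "\<not> modular \<phi> f R \<le> 1"
  shows "\<exists>g. g \<in> borel_measurable unit_leb \<and> modular \<psi> g 1 \<le> 1 \<and> (\<integral>x. f x * g x \<partial>unit_leb) = R"
proof -
  have [measurable]: "f \<in> borel_measurable unit_leb" using f by (rule space_measurable)
  define h where "h = (\<lambda>x. \<bar>f x\<bar> / R)"
  have h0: "h x \<ge> 0" for x using R by (simp add: h_def)
  have [measurable]: "h \<in> borel_measurable unit_leb" unfolding h_def by measurable
  have habs: "\<bar>h x\<bar> = h x" for x using h0 by simp
  define E where "E = (\<lambda>k::nat. {x \<in> space unit_leb. h x \<le> k})"
  have [measurable]: "E k \<in> sets unit_leb" for k unfolding E_def by measurable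
  have [measurable]: "(\<lambda>x. \<phi> (h x)) \<in> borel_measurable unit_leb"
    using measurable_comp[of h unit_leb] by (simp add: habs)
  have "modular \<phi> f R = (\<integral>\<^sup>+x. (SUP k. ennreal (\<phi> (h x)) * indicator (E k) x) \<partial>unit_leb)"
    unfolding modular_def
  proof (rule nn_integral_cong)
    fix x assume x: "x \<in> space unit_leb"
    obtain k :: nat where k: "h x \<le> k" using real_arch_simple by blast
    have "(SUP k. ennreal (\<phi> (h x)) * indicator (E k) x) = ennreal (\<phi> (h x))"
    proof (rule antisym)
      show "(SUP k. ennreal (\<phi> (h x)) * indicator (E k) x) \<le> ennreal (\<phi> (h x))"
        by (intro SUP_least) (auto simp: indicator_def)
      show "ennreal (\<phi> (h x)) \<le> (SUP k. ennreal (\<phi> (h x)) * indicator (E k) x)"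
        using k x by (intro SUP_upper2[of k]) (auto simp: indicator_def E_def)
    qed
    then show "ennreal (\<phi> (\<bar>f x\<bar> / R)) = (SUP k. ennreal (\<phi> (h x)) * indicator (E k) x)"
      by (simp add: h_def)
  qed
  also have "\<dots> = (SUP k. \<integral>\<^sup>+x. ennreal (\<phi> (h x)) * indicator (E k) x \<partial>unit_leb)"
  proof (rule nn_integral_monotone_convergence_SUP)
    show "incseq (\<lambda>k x. ennreal (\<phi> (h x)) * indicator (E k) x)"
      by (auto simp: incseq_def le_fun_def indicator_def E_def)
  qed measurable
  finally have "(SUP k. \<integral>\<^sup>+x. ennreal (\<phi> (h x)) * indicator (E k) x \<partial>unit_leb) > 1"
    using R by auto
  \<comment> \<open>Monotone convergence supplies a cut-off level at which the modular still exceeds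
    1; on the cut-off set \<open>h\<close> and its subgradient are bounded, hence
    \<open>h * u\<close> is integrable.\<close>
  then obtain k where k: "(\<integral>\<^sup>+x. ennreal (\<phi> (h x)) * indicator (E k) x \<partial>unit_leb) > 1"
    by (auto simp: less_SUP_iff)
  obtain d where d: "\<And>s t. 0 \<le> s \<Longrightarrow> s \<le> t \<Longrightarrow> d s \<le> d t" "\<And>t. 0 \<le> t \<Longrightarrow> 0 \<le> d t"
    "\<And>s t. 0 \<le> s \<Longrightarrow> 0 \<le> t \<Longrightarrow> \<phi> t + d t * (s - t) \<le> \<phi> s" "(\<lambda>t. d \<bar>t\<bar>) \<in> borel_measurable borel"
    using subgradient by blast
  have \<psi>d: "\<psi> (d t) \<le> t * d t - \<phi> t" if "t \<ge> 0" for t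
  proof (rule conjugate_le)
    fix s :: real assume "s \<ge> 0"
    then show "d t * s - \<phi> s \<le> t * d t - \<phi> t" using d(3)[of s t] that by (simp add: algebra_simps)
  qed (use d that in auto)
  have [measurable]: "(\<lambda>x. d (h x)) \<in> borel_measurable unit_leb"
    using measurable_compose[of h unit_leb borel "\<lambda>t. d \<bar>t\<bar>"] d(4) by (simp add: habs)
  define u where "u = (\<lambda>x. d (h x) * indicator (E k) x)"
  have u0: "u x \<ge> 0" for x using d(2) h0 by (simp add: u_def)
  have uk: "u x \<le> d k" for x using d(1)[of "h x" k] d(2)[of k] h0 by (auto simp: u_def E_def indicator_def)
  have [measurable]: "u \<in> borel_measurable unit_leb" unfolding u_def by measurable
  have hu: "integrable unit_leb (\<lambda>x. h x * u x)"
  proof (rule unit_leb_integrable_bounded[of _ "k * d k"])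
    fix x
    have "h x * u x \<le> k * d k" if "x \<in> E k"
      using that uk[of x] h0 u0 by (intro mult_mono) (auto simp: E_def)
    then show "\<bar>h x * u x\<bar> \<le> k * d k"
      using h0[of x] u0[of x] d(2)[of k] by (cases "x \<in> E k") (auto simp: u_def)
  qed auto
  define B where "B = (\<integral>x. h x * u x \<partial>unit_leb)"
  have Bnn: "ennreal B = (\<integral>\<^sup>+x. ennreal (h x * u x) \<partial>unit_leb)"
    unfolding B_def using hu h0 u0 by (intro nn_integral_eq_integral[symmetric]) auto
  have "(\<integral>\<^sup>+x. ennreal (\<phi> (h x)) * indicator (E k) x \<partial>unit_leb) \<le> ennreal B"
    unfolding Bnn
  proof (rule nn_integral_mono)
    fix x
    have "\<phi> (h x) \<le> h x * d (h x)" using \<psi>d[OF h0[of x]] conj.nonneg[OF d(2)[OF h0[of x]]] by linarith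
    then show "ennreal (\<phi> (h x)) * indicator (E k) x \<le> ennreal (h x * u x)"
      by (auto simp: u_def indicator_def intro: ennreal_leI)
  qed
  with k have "1 < ennreal B" by (rule less_le_trans)
  then have B: "B > 1" by (simp add: ennreal_less_iff flip: ennreal_1)
  have \<psi>u: "(\<integral>\<^sup>+x. ennreal (\<psi> (u x)) \<partial>unit_leb) \<le> ennreal B"
    unfolding Bnn
  proof (rule nn_integral_mono)
    fix x
    have "\<psi> (d (h x)) \<le> h x * d (h x)" using \<psi>d[OF h0[of x]] nonneg[OF h0[of x]] by linarith
    then show "ennreal (\<psi> (u x)) \<le> ennreal (h x * u x)"
      by (auto simp: u_def indicator_def intro: ennreal_leI)
  qed
  define g where "g = (\<lambda>x. sgn (f x) * u x / B)"
  have [measurable]: "g \<in> borel_measurable unit_leb" unfolding g_def by measurable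
  have "modular \<psi> u (B * 1) \<le> 1"
    using B \<psi>u u0 by (intro conj.modular_scale_le_1) (auto simp: modular_def)
  moreover have "modular \<psi> g 1 \<le> modular \<psi> u (B * 1)"
    unfolding modular_def using B 
    by (intro nn_integral_mono ennreal_leI conj.mono) (auto simp: g_def abs_mult sgn_if)
  ultimately have "modular \<psi> g 1 \<le> 1" by simp
  moreover have "f x * g x = R / B * (h x * u x)" for x
    using R B by (auto simp: g_def h_def sgn_if abs_if)
  then have "(\<integral>x. f x * g x \<partial>unit_leb) = R"
    using B by (simp add: B_def)
  ultimately show ?thesis using \<open>g \<in> borel_measurable unit_leb\<close> by blast
qed

text \<open>
  The uniform boundedness principle, by a gliding hump: otherwise there are \<open>n j\<close> and normalised
  \<open>g j\<close> for which the integral of \<open>f (n j) * g j\<close> is of the order of the norm \<open>\<ge> 32\<^sup>j\<close>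
  of \<open>f (n j)\<close>, and \<open>\<Sum>j. \<plusminus> 16\<^sup>-\<^sup>j * g j\<close> with suitable signs is a test function with unbounded
  integrals.
\<close>

lemma norm_bounded_if_weak_null:
  assumes f: "\<And>n. f n \<in> orlicz_space \<phi>"
    and null: "\<And>g. g \<in> orlicz_space \<psi> \<Longrightarrow> (\<lambda>n. \<integral>x. f n x * g x \<partial>unit_leb) \<longlonglongrightarrow> 0"
  shows "norm_bounded \<phi> f"
proof (rule ccontr)
  assume "\<not> ?thesis"
  then have unb: "\<exists>n. \<not> orlicz_norm \<phi> (f n) \<le> ennreal C" for C
    using f by (auto simp: norm_bounded_def)
  note fm [measurable] = space_measurable[OF f]
  have "\<exists>n R. R \<ge> 32 ^ j \<and> \<not> modular \<phi> (f n) R \<le> 1 \<and> modular \<phi> (f n) (2 * R) \<le> 1" for j :: nat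
  proof -
    obtain n where n: "\<not> orlicz_norm \<phi> (f n) \<le> ennreal (2 * 32 ^ j)" using unb by blast
    define a where "a = enn2real (orlicz_norm \<phi> (f n))"
    have a: "orlicz_norm \<phi> (f n) = ennreal a" using f[of n] by (simp add: a_def orlicz_space_def)
    have ab: "a > 2 * 32 ^ j" using n unfolding a by (simp add: ennreal_le_iff2)
    then have a0: "a > 0" by (meson less_trans mult_pos_pos zero_less_numeral zero_less_power)
    \<comment> \<open>\<open>R\<close> is two thirds of the norm \<open>a\<close>: any fraction
      strictly between 1/2 and 1 puts \<open>R\<close> below the norm and \<open>2 * R\<close> above
      it.\<close>
    have "\<not> modular \<phi> (f n) (2 * a / 3) \<le> 1"
    proof
      assume "modular \<phi> (f n) (2 * a / 3) \<le> 1"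
      then have "orlicz_norm \<phi> (f n) \<le> ennreal (2 * a / 3)" using a0 by (intro norm_le) auto
      then show False unfolding a using a0 by simp
    qed
    moreover have "modular \<phi> (f n) (2 * (2 * a / 3)) \<le> 1"
      using a a0 by (intro modular_le_1) (auto simp: ennreal_less_iff)
    moreover have "2 * a / 3 \<ge> 32 ^ j" using ab a0 by simp
    ultimately show ?thesis by blast
  qed
  then obtain n R where R: "\<And>j::nat. R j \<ge> (32::real) ^ j" "\<And>j. \<not> modular \<phi> (f (n j)) (R j) \<le> 1" 
    "\<And>j. modular \<phi> (f (n j)) (2 * R j) \<le> 1"
    by metis
  have R0: "R j > 0" for j using R(1)[of j] by (meson less_le_trans zero_less_numeral zero_less_power)
  obtain g where gm: "\<And>j. g j \<in> borel_measurable unit_leb" and g: "\<And>j. modular \<psi> (g j) 1 \<le> 1"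
    "\<And>j. (\<integral>x. f (n j) x * g j x \<partial>unit_leb) = R j"
    using ex_norming[OF f R0 R(2)] by metis
  note [measurable] = gm
  define T where "T = (\<lambda>j (u :: real \<Rightarrow> real). \<integral>x. f (n j) x * u x \<partial>unit_leb)"
  \<comment> \<open>With ratio 1/16 the tail after step \<open>j\<close> contributes at most 8/15 of
    \<theta>^j R j, less than the \<open>j\<close>-th term itself, while 32 / 16 = 2 still leaves
    growth 2^j.\<close>
  define \<theta> :: real where "\<theta> = 1 / 16"
  \<comment> \<open>The sign of each new term agrees with that of \<open>T j\<close> on what has
    been built so far, so the two contributions cannot cancel.\<close>
  define y where "y = rec_nat (\<lambda>_. 0) (\<lambda>j y x. y x + (if T j y \<ge> 0 then 1 else - 1) * \<theta> ^ j * g j x)"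
  define \<sigma> where "\<sigma> = (\<lambda>j. if T j (y j) \<ge> 0 then 1 else - 1 :: real)"
  have y0: "y 0 = (\<lambda>_. 0)" and ySuc: "y (Suc j) = (\<lambda>x. y j x + \<sigma> j * \<theta> ^ j * g j x)" for j
    by (auto simp: y_def \<sigma>_def fun_eq_iff)
  have y: "y j x = (\<Sum>k<j. \<sigma> k * \<theta> ^ k * g k x)" for j x
    by (induction j) (simp_all add: y0 ySuc)
  have \<sigma>: "\<bar>\<sigma> j\<bar> = 1" for j by (simp add: \<sigma>_def)
  have gj: "g j \<in> orlicz_space \<psi>" for j using g gm by (auto simp: conj.space_iff_le_1 intro: exI[of _ 1])
  have ys: "y j \<in> orlicz_space \<psi>" for j
  proof (induction j)
    case 0
    then show ?case by (auto simp: y0 conj.space_iff intro!: exI[of _ 1])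
  next
    case (Suc j)
    then show ?case unfolding ySuc by (intro conj.space_add conj.space_cmult gj)
  qed
  have int: "integrable unit_leb (\<lambda>x. f (n j) x * u x)" if "u \<in> orlicz_space \<psi>" for u j
    using that R0[of j] R(3)[of j] hoelder(1)[OF fm conj.space_measurable[OF that], of "2 * R j"]
    by (auto simp: conj.space_iff_le_1)
  have Tadd: "T j (\<lambda>x. u x + v x) = T j u + T j v" if "u \<in> orlicz_space \<psi>" "v \<in> orlicz_space \<psi>" for u v j
    using int[OF that(1)] int[OF that(2)] by (simp add: T_def distrib_left)
  have Ty: "\<bar>T j (y (Suc j))\<bar> \<ge> \<theta> ^ j * R j" for j
  proof -
    have "T j (y (Suc j)) = T j (y j) + T j (\<lambda>x. \<sigma> j * \<theta> ^ j * g j x)"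
      unfolding ySuc by (intro Tadd ys conj.space_cmult gj)
    also have "T j (\<lambda>x. \<sigma> j * \<theta> ^ j * g j x) = (\<integral>x. (\<sigma> j * \<theta> ^ j) * (f (n j) x * g j x) \<partial>unit_leb)"
      unfolding T_def by (intro Bochner_Integration.integral_cong) (auto simp: ac_simps)
    also have "\<dots> = \<sigma> j * (\<theta> ^ j * R j)" using g(2)[of j] by simp
    finally show ?thesis using R0[of j] by (auto simp: \<sigma>_def \<theta>_def)
  qed
  have sums: "(\<lambda>k. \<theta> ^ (k + m)) sums (\<theta> ^ m * (16 / 15))" for m
  proof -
    have "(\<lambda>k. \<theta> ^ m * \<theta> ^ k) sums (\<theta> ^ m * (1 / (1 - \<theta>)))"
      by (intro sums_mult geometric_sums) (auto simp: \<theta>_def)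
    then show ?thesis by (simp add: power_add mult.commute \<theta>_def)
  qed
  have \<theta>0: "\<theta> > 0" by (simp add: \<theta>_def)
  define x where "x = (\<lambda>t. \<Sum>k. \<sigma> k * \<theta> ^ k * g k t)"
  have [measurable]: "x \<in> borel_measurable unit_leb" unfolding x_def by measurable
  have tail_AE: "AE t in unit_leb. summable (\<lambda>k. \<theta> ^ (k + m) * \<bar>g (k + m) t\<bar>)" 
    and tail: "modular \<psi> (\<lambda>t. \<Sum>k. \<theta> ^ (k + m) * \<bar>g (k + m) t\<bar>) (2 * (\<theta> ^ m * (16 / 15))) \<le> 1" for m
    using conj.modular_weighted_suminf[of "\<lambda>k. g (k + m)", OF gm g(1) _ sums] \<theta>0 by auto
  have xy: "modular \<psi> (\<lambda>t. x t - y m t) (2 * (\<theta> ^ m * (16 / 15))) \<le> 1" for m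
  proof (rule order_trans[OF conj.modular_mono tail])
    show "AE t in unit_leb. \<bar>x t - y m t\<bar> \<le> \<bar>\<Sum>k. \<theta> ^ (k + m) * \<bar>g (k + m) t\<bar>\<bar>"
      using tail_AE[of 0] 
    proof eventually_elim
      fix t assume "summable (\<lambda>k. \<theta> ^ (k + 0) * \<bar>g (k + 0) t\<bar>)"
      then have s: "summable (\<lambda>k. norm (\<sigma> k * \<theta> ^ k * g k t))" using \<sigma> \<theta>0 by (simp add: abs_mult)
      have "x t - y m t = (\<Sum>k. \<sigma> (k + m) * \<theta> ^ (k + m) * g (k + m) t)"
        unfolding x_def y using suminf_minus_initial_segment[OF summable_norm_cancel[OF s], of m] by simp
      also have "norm \<dots> \<le> (\<Sum>k. norm (\<sigma> (k + m) * \<theta> ^ (k + m) * g (k + m) t))"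
        using s by (intro summable_norm summable_ignore_initial_segment[of "\<lambda>k. norm (\<sigma> k * \<theta> ^ k * g k t)"])
      also have "\<dots> = (\<Sum>k. \<theta> ^ (k + m) * \<bar>g (k + m) t\<bar>)" using \<sigma> \<theta>0 by (simp add: abs_mult)
      finally show "\<bar>x t - y m t\<bar> \<le> \<bar>\<Sum>k. \<theta> ^ (k + m) * \<bar>g (k + m) t\<bar>\<bar>" by simp
    qed
  qed (use \<theta>0 in auto)
  have xs: "x \<in> orlicz_space \<psi>" 
    using xy[of 0] by (auto simp: conj.space_iff_le_1 y0 intro!: exI[of _ "2 * (16 / 15)"])
  have Tx: "\<bar>T j x\<bar> \<ge> 7 / 15 * 2 ^ j" for j
  proof -
    have d: "(\<lambda>t. x t - y (Suc j) t) \<in> orlicz_space \<psi>"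
      using conj.space_add[OF xs conj.space_cmult[OF ys, of "-1"]] by simp
    have "\<bar>T j (\<lambda>t. x t - y (Suc j) t)\<bar> \<le> 2 * (2 * R j) * (2 * (\<theta> ^ (Suc j) * (16 / 15)))"
      unfolding T_def using R0[of j] \<theta>0 by (intro hoelder fm conj.space_measurable[OF d] R(3) xy) auto
    also have "\<dots> = 8 / 15 * (\<theta> ^ j * R j)" by (simp add: \<theta>_def)
    finally have "\<bar>T j (\<lambda>t. x t - y (Suc j) t)\<bar> \<le> 8 / 15 * (\<theta> ^ j * R j)" .
    moreover have "T j x = T j (y (Suc j)) + T j (\<lambda>t. x t - y (Suc j) t)"
      using Tadd[OF ys d, of j "Suc j"] by simp
    ultimately have "\<bar>T j x\<bar> \<ge> 7 / 15 * (\<theta> ^ j * R j)" using Ty[of j] by linarith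
    moreover have "\<theta> ^ j * R j \<ge> \<theta> ^ j * 32 ^ j" using R(1)[of j] \<theta>0 by (intro mult_left_mono) auto
    moreover have "\<theta> ^ j * 32 ^ j = 2 ^ j" by (simp add: \<theta>_def power_mult_distrib[symmetric])
    ultimately show ?thesis by linarith
  qed
  have "Bseq (\<lambda>n. \<integral>t. f n t * x t \<partial>unit_leb)"
    using null[OF xs] by (intro convergent_imp_Bseq) (auto simp: convergent_def)
  then obtain B where B: "\<And>n. \<bar>\<integral>t. f n t * x t \<partial>unit_leb\<bar> \<le> B" by (auto simp: Bseq_def)
  have "\<exists>j. B * 15 / 7 < (2::real) ^ j" by (rule real_arch_pow) simp
  then obtain j where "B * 15 / 7 < (2::real) ^ j" by blast
  then show False using Tx[of j] B[of "n j"] unfolding T_def by (simp add: field_simps)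
qed

end

subsection \<open>The growth condition dual to the doubling condition\<close>

text \<open>The classical nabla-two condition, imposed only for large arguments since the measure is
  finite. By convexity it passes from one factor to every larger one, so an integer factor is no
  restriction.\<close>

definition nabla2 :: "(real \<Rightarrow> real) \<Rightarrow> bool" where
  "nabla2 \<phi> \<longleftrightarrow> (\<exists>N::nat. N \<ge> 2 \<and> (\<exists>t0>0. \<forall>t\<ge>t0. 2 * N * \<phi> t \<le> \<phi> (N * t)))"

lemma disjoint_sum_eq:
  fixes v :: "nat \<Rightarrow> real"
  assumes "finite I" "\<And>i j. i < j \<Longrightarrow> v i = 0 \<or> v j = 0"
  shows "sum v I = 0 \<or> (\<exists>i\<in>I. sum v I = v i)"
proof (cases "\<exists>i\<in>I. v i \<noteq> 0")
  case True
  then obtain i where i: "i \<in> I" "v i \<noteq> 0" by blast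
  have "v j = 0" if "j \<noteq> i" for j using assms(2)[of i j] assms(2)[of j i] i that by (cases i j rule: linorder_cases) auto
  then have "sum v I = sum v {i}" using i assms(1) by (intro sum.mono_neutral_right) auto
  then show ?thesis using i by auto
qed auto

context orlicz
begin

text \<open>Iterating the condition along powers of \<open>N\<close> gives \<phi>(N^k t) \<ge> (2
  N)^k \<phi>(t), that is growth with exponent p = 1 + log_N 2, for which N^p = 2 N. The summand 1
  in both bounds absorbs the arguments below the threshold \<open>s\<close>. The bound p \<le> 2,
  used in the second moment estimates, comes from N \<ge> 2.\<close>

lemma nabla2E:
  assumes "nabla2 \<phi>"
  obtains p A where "1 < p" "p \<le> 2" "1 \<le> A" "\<And>t. 0 \<le> t \<Longrightarrow> t powr p \<le> A * (1 + \<phi> t)"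
    "\<And>t j. 0 \<le> t \<Longrightarrow> 1 \<le> j \<Longrightarrow> \<phi> (t / j) \<le> A * (1 + j powr (- p) * \<phi> t)"
proof -
  obtain N0 :: nat and t0 :: real where "N0 \<ge> 2" "t0 > 0" "\<forall>t\<ge>t0. 2 * real N0 * \<phi> t \<le> \<phi> (real N0 * t)"
    using assms by (auto simp: nabla2_def)
  then obtain N :: real where N: "N \<ge> 2" and t0: "t0 > 0" "\<And>t. t \<ge> t0 \<Longrightarrow> 2 * N * \<phi> t \<le> \<phi> (N * t)"
    by (intro that[of "real N0"]) auto
  obtain t1 where t1: "t1 > 0" "\<And>t. t \<ge> t1 \<Longrightarrow> \<phi> t \<ge> 1" using tends_to_infinity[of 1] by blast
  define s where "s = max t0 t1"
  have s: "s > 0" "\<And>t. t \<ge> s \<Longrightarrow> \<phi> t \<ge> 1" "\<And>t. t \<ge> s \<Longrightarrow> 2 * N * \<phi> t \<le> \<phi> (N * t)"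
    using t0 t1 by (auto simp: s_def)
  define p where "p = 1 + log N 2"
  have l: "0 < log N 2" "log N 2 \<le> 1" using N by auto
  have p: "1 < p" "p \<le> 2" using l by (auto simp: p_def)
  have Np: "N powr p = 2 * N" using N by (simp add: p_def powr_add)
  have pow: "(2 * N) ^ k * \<phi> t \<le> \<phi> (N ^ k * t)" if "t \<ge> s" for t k
  proof (induction k)
    case (Suc k)
    have "1 * s \<le> N ^ k * t" using that s N by (intro mult_mono) auto
    then have "2 * N * \<phi> (N ^ k * t) \<le> \<phi> (N * (N ^ k * t))" by (intro s) auto
    moreover have "2 * N * ((2 * N) ^ k * \<phi> t) \<le> 2 * N * \<phi> (N ^ k * t)"
      using Suc N by (intro mult_left_mono) auto
    ultimately show ?case by (simp add: ac_simps)
  qed auto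
  define C where "C = N powr p"
  have C: "C \<ge> 1" using N by (simp add: C_def Np)
  \<comment> \<open>Rounding \<open>q\<close> down to a power of \<open>N\<close> loses at most the
    factor C = N^p.\<close>
  have main: "q powr p * \<phi> t \<le> C * \<phi> (q * t)" if t: "t \<ge> s" and q: "q \<ge> 1" for t q
  proof -
    define k where "k = nat \<lfloor>log N q\<rfloor>"
    have lg: "log N q \<ge> 0" using N q by simp
    have k: "real k \<le> log N q" "log N q < real k + 1" using lg by (auto simp: k_def)
    have k1: "N ^ k \<le> q"
    proof -
      have "N ^ k = N powr real k" using N by (simp add: powr_realpow)
      also have "\<dots> \<le> N powr log N q" using N k(1) by (intro powr_mono) auto
      finally show ?thesis using N q by simp
    qed
    have k2: "q \<le> N ^ Suc k"
    proof -
      have "q = N powr log N q" using N q by simp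
      also have "\<dots> \<le> N powr real (Suc k)" using N k(2) by (intro powr_mono) auto
      also have "\<dots> = N ^ Suc k" using N by (intro powr_realpow) auto
      finally show ?thesis .
    qed
    have "q powr p \<le> (N ^ Suc k) powr p" using k2 q p by (intro powr_mono2) auto
    also have "\<dots> = (N powr p) ^ Suc k"
    proof -
      have "(N ^ Suc k) powr p = (N powr real (Suc k)) powr p" using N by (subst powr_realpow) auto
      also have "\<dots> = (N powr p) powr real (Suc k)" by (simp only: powr_powr mult.commute)
      also have "\<dots> = (N powr p) ^ Suc k" using N by (intro powr_realpow) auto
      finally show ?thesis .
    qed
    also have "\<dots> = C * (2 * N) ^ k" by (simp add: C_def Np)
    finally have "q powr p * \<phi> t \<le> C * (2 * N) ^ k * \<phi> t"
      using s(2)[OF t] by (intro mult_right_mono) auto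
    also have "\<dots> \<le> C * \<phi> (N ^ k * t)" using pow[OF t, of k] C by (simp add: mult.assoc)
    also have "\<dots> \<le> C * \<phi> (q * t)"
      using k1 t s(1) C N by (intro mult_left_mono mono mult_right_mono) auto
    finally show ?thesis .
  qed
  \<comment> \<open>The three entries serve, in turn, quotients t / j above \<open>s\<close>,
    quotients below \<open>s\<close>, and the normalisation of \<open>t\<close> by \<open>s\<close>
    in the power bound.\<close>
  define A where "A = max C (max (\<phi> s) (s powr p * C))"
  have A: "A \<ge> C" "A \<ge> \<phi> s" "A \<ge> s powr p * C" by (auto simp: A_def)
  show ?thesis
  proof (rule that[of p A])
    show "1 \<le> A" using A C by linarith
    fix t :: real assume t: "0 \<le> t"
    show "t powr p \<le> A * (1 + \<phi> t)"
    proof (cases "t \<le> s")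
      case True
      have "t powr p \<le> s powr p * 1" using True t p powr_mono2[of p t s] by simp
      also have "\<dots> \<le> s powr p * C" using C by (intro mult_left_mono) auto
      also have "\<dots> \<le> A * 1" using A by simp
      also have "\<dots> \<le> A * (1 + \<phi> t)" using \<open>1 \<le> A\<close> nonneg[OF t] by (intro mult_left_mono) auto
      finally show ?thesis .
    next
      case False
      have "(t / s) powr p * 1 \<le> (t / s) powr p * \<phi> s" using s(2)[of s] by (intro mult_left_mono) auto
      also have "\<dots> \<le> C * \<phi> ((t / s) * s)" using False s(1) by (intro main) auto
      finally have "(t / s) powr p \<le> C * \<phi> t" using s(1) by simp
      then have "s powr p * (t / s) powr p \<le> s powr p * (C * \<phi> t)" by (intro mult_left_mono) auto
      moreover have "s powr p * (t / s) powr p = t powr p" using s(1) t by (simp add: powr_divide)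
      ultimately have "t powr p \<le> (s powr p * C) * \<phi> t" by simp
      also have "\<dots> \<le> A * \<phi> t" using A nonneg[OF t] by (intro mult_right_mono) auto
      also have "\<dots> \<le> A * (1 + \<phi> t)" using \<open>1 \<le> A\<close> by (intro mult_left_mono) auto
      finally show ?thesis .
    qed
    fix j :: real assume j: "1 \<le> j"
    have n: "j powr (- p) * \<phi> t \<ge> 0" using nonneg[OF t] by simp
    show "\<phi> (t / j) \<le> A * (1 + j powr (- p) * \<phi> t)"
    proof (cases "t / j \<le> s")
      case True
      have "\<phi> (t / j) \<le> \<phi> s" using True t j by (intro mono) auto
      also have "\<dots> \<le> A * 1" using A by simp
      also have "\<dots> \<le> A * (1 + j powr (- p) * \<phi> t)" using \<open>1 \<le> A\<close> n by (intro mult_left_mono) auto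
      finally show ?thesis .
    next
      case False
      have "j powr p * \<phi> (t / j) \<le> C * \<phi> (j * (t / j))" using False j by (intro main) auto
      then have "\<phi> (t / j) \<le> C * (j powr (- p) * \<phi> t)" using j by (simp add: powr_minus field_simps)
      also have "\<dots> \<le> A * (j powr (- p) * \<phi> t)" using A n by (intro mult_right_mono) auto
      also have "\<dots> \<le> A * (1 + j powr (- p) * \<phi> t)" using \<open>1 \<le> A\<close> by (intro mult_left_mono) auto
      finally show ?thesis .
    qed
  qed (use p in auto)
qed

section \<open>Domination in the Orlicz space\<close>

lemma dominated_in_add:
  assumes "dominated_in (orlicz_space \<phi>) a" "dominated_in (orlicz_space \<phi>) b" 
    "\<And>n. AE x in unit_leb. \<bar>c n x\<bar> \<le> \<bar>a n x\<bar> + \<bar>b n x\<bar>"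
  shows "dominated_in (orlicz_space \<phi>) c"
proof -
  obtain g where g: "g \<in> orlicz_space \<phi>" "AE x in unit_leb. 0 \<le> g x" "\<And>n. AE x in unit_leb. \<bar>a n x\<bar> \<le> g x"
    using assms(1) unfolding dominated_in_def ae_le_def by blast
  obtain h where h: "h \<in> orlicz_space \<phi>" "AE x in unit_leb. 0 \<le> h x" "\<And>n. AE x in unit_leb. \<bar>b n x\<bar> \<le> h x"
    using assms(2) unfolding dominated_in_def ae_le_def by blast
  have "AE x in unit_leb. \<bar>c n x\<bar> \<le> g x + h x" for n
    using g(3)[of n] h(3)[of n] assms(3)[of n] by eventually_elim linarith
  moreover have "AE x in unit_leb. 0 \<le> g x + h x" using g(2) h(2) by eventually_elim simp
  ultimately show ?thesis unfolding dominated_in_def ae_le_def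
    using space_add[OF g(1) h(1)] by (intro bexI[of _ "\<lambda>x. g x + h x"]) auto
qed

text \<open>The pointwise supremum of the |c m| is the dominating function. It is finite a.e.
  because \<phi> tends to infinity, and where it is positive, half of it is exceeded by a single |c
  m|, which is why its modular is controlled at scale \<open>2 * b\<close>.\<close>

lemma dominated_inI:
  assumes [measurable]: "\<And>m::nat. c m \<in> borel_measurable unit_leb" and b: "b > 0"
    and Z [measurable]: "Z \<in> borel_measurable unit_leb" "(\<integral>\<^sup>+x. Z x \<partial>unit_leb) < \<infinity>"
    and le: "AE x in unit_leb. \<forall>m. ennreal (\<phi> (\<bar>c m x\<bar> / b)) \<le> Z x"
  shows "dominated_in (orlicz_space \<phi>) c"
proof -
  define H where "H = (\<lambda>x. SUP m. ennreal \<bar>c m x\<bar>)"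
  define h where "h = (\<lambda>x. enn2real (H x))"
  have [measurable]: "H \<in> borel_measurable unit_leb" unfolding H_def by measurable
  have [measurable]: "h \<in> borel_measurable unit_leb" unfolding h_def by measurable
  have "AE x in unit_leb. Z x \<noteq> \<infinity>"
    by (rule nn_integral_PInf_AE) (use Z in auto)
  then have fin: "AE x in unit_leb. H x \<noteq> \<infinity> \<and> (\<forall>m. ennreal (\<phi> (\<bar>c m x\<bar> / b)) \<le> Z x)"
    using le
  proof eventually_elim
    fix x assume x: "Z x \<noteq> \<infinity>" "\<forall>m. ennreal (\<phi> (\<bar>c m x\<bar> / b)) \<le> Z x"
    then obtain z where z: "z \<ge> 0" "Z x = ennreal z" by (metis ennreal_cases infinity_ennreal_def)
    obtain t0 where t0: "t0 > 0" "\<And>t. t \<ge> t0 \<Longrightarrow> \<phi> t \<ge> z + 1" using tends_to_infinity by blast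
    have "\<bar>c m x\<bar> \<le> b * t0" for m
    proof (rule ccontr)
      assume "\<not> ?thesis"
      then have "\<bar>c m x\<bar> / b \<ge> t0" using b by (simp add: field_simps)
      then have "\<phi> (\<bar>c m x\<bar> / b) \<ge> z + 1" using t0 by auto
      moreover have "\<phi> (\<bar>c m x\<bar> / b) \<le> z" using x(2) z by (simp add: ennreal_le_iff)
      ultimately show False by simp
    qed
    then have "H x \<le> ennreal (b * t0)" unfolding H_def by (intro SUP_least ennreal_leI)
    then have "H x \<noteq> \<infinity>" by (auto simp: top_unique)
    then show "H x \<noteq> \<infinity> \<and> (\<forall>m. ennreal (\<phi> (\<bar>c m x\<bar> / b)) \<le> Z x)" using x by simp
  qed
  have "modular \<phi> h (2 * b) \<le> (\<integral>\<^sup>+x. Z x \<partial>unit_leb)"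
    unfolding modular_def
  proof (rule nn_integral_mono_AE, use fin in eventually_elim)
    fix x assume x: "H x \<noteq> \<infinity> \<and> (\<forall>m. ennreal (\<phi> (\<bar>c m x\<bar> / b)) \<le> Z x)"
    then have H: "H x = ennreal (h x)" by (simp add: h_def less_top)
    have h0: "h x \<ge> 0" by (simp add: h_def)
    show "ennreal (\<phi> (\<bar>h x\<bar> / (2 * b))) \<le> Z x"
    proof (cases "h x = 0")
      case False
      then have "ennreal (h x / 2) < H x" using h0 by (simp add: H ennreal_less_iff)
      then obtain m where "ennreal (h x / 2) < ennreal \<bar>c m x\<bar>" by (auto simp: H_def less_SUP_iff)
      then have "h x / 2 < \<bar>c m x\<bar>" by (simp add: ennreal_less_iff h0)
      then have "\<bar>h x\<bar> / (2 * b) \<le> \<bar>c m x\<bar> / b" using h0 b by (simp add: field_simps)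
      then have "ennreal (\<phi> (\<bar>h x\<bar> / (2 * b))) \<le> ennreal (\<phi> (\<bar>c m x\<bar> / b))"
        using h0 b by (intro ennreal_leI mono) auto
      then show ?thesis using x order_trans by blast
    qed auto
  qed
  then have "modular \<phi> h (2 * b) < \<infinity>" using Z(2) by (rule order_le_less_trans)
  then have hL: "h \<in> orlicz_space \<phi>" using b by (auto simp: space_iff intro!: exI[of _ "2 * b"])
  have "AE x in unit_leb. \<bar>c n x\<bar> \<le> h x" for n
    using fin
  proof eventually_elim
    fix x assume x: "H x \<noteq> \<infinity> \<and> (\<forall>m. ennreal (\<phi> (\<bar>c m x\<bar> / b)) \<le> Z x)"
    have "ennreal \<bar>c n x\<bar> \<le> H x" unfolding H_def by (intro SUP_upper) auto
    also have "H x = ennreal (h x)" using x by (simp add: h_def less_top)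
    finally show "\<bar>c n x\<bar> \<le> h x" by (subst (asm) ennreal_le_iff) (auto simp: h_def)
  qed
  then show ?thesis using hL unfolding dominated_in_def ae_le_def
    by (intro bexI[of _ h]) (auto simp: h_def)
qed

lemma summable_powr: "p > 1 \<Longrightarrow> summable (\<lambda>n. real (Suc n) powr (- p))"
  using summable_Suc_iff[of "\<lambda>n. real n powr (- p)"] by (simp add: summable_real_powr_iff)

text \<open>
  Off the set where some later \<open>v j\<close> is nonzero the functions have disjoint supports, and there
  \<open>nabla2\<close> makes the sum of the modulars of \<open>v n / (n + 1)\<close> converge.
\<close>

lemma dominated_cesaro_almost_disjoint:
  assumes n2: "nabla2 \<phi>" and meas [measurable]: "\<And>n. v n \<in> borel_measurable unit_leb"
    and v0: "\<And>n x. v n x \<ge> 0" and v1: "\<And>n. modular \<phi> (v n) 1 \<le> 1"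
    and small: "\<And>i j. i < j \<Longrightarrow> (\<integral>\<^sup>+x. ennreal (\<phi> (v i x)) * indicator {x. v j x \<noteq> 0} x \<partial>unit_leb) \<le> ennreal ((1 / 2) ^ i * (1 / 2) ^ j)"
  shows "dominated_in (orlicz_space \<phi>) (cesaro v)"
proof -
  obtain p A where p: "1 < p" "1 \<le> A" and A: "\<And>t j. 0 \<le> t \<Longrightarrow> 1 \<le> j \<Longrightarrow> \<phi> (t / j) \<le> A * (1 + j powr (- p) * \<phi> t)"
    using nabla2E[OF n2] by metis
  have [measurable]: "(\<lambda>x. \<phi> (v n x)) \<in> borel_measurable unit_leb" for n
    using measurable_comp[OF meas[of n]] v0 by simp
  \<comment> \<open>Removing from \<open>v n\<close> the points where a later function is nonzero
    leaves the disjointly supported \<open>v'\<close>; the removed part \<open>v''\<close> is small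
    in modular.\<close>
  define later where "later = (\<lambda>n x. \<exists>j>n. v j x \<noteq> 0)"
  define v' where "v' = (\<lambda>n x. if later n x then 0 else v n x)"
  define v'' where "v'' = (\<lambda>n x. if later n x then v n x else 0)"
  have [measurable]: "Measurable.pred unit_leb (later n)" for n unfolding later_def by measurable
  have [measurable]: "v' n \<in> borel_measurable unit_leb" "v'' n \<in> borel_measurable unit_leb" for n
    unfolding v'_def v''_def by measurable
  have vv: "v n x = v' n x + v'' n x" "v' n x \<ge> 0" "v'' n x \<ge> 0" for n x using v0 by (auto simp: v'_def v''_def)
  have [measurable]: "(\<lambda>x. \<phi> (v' n x)) \<in> borel_measurable unit_leb" "(\<lambda>x. \<phi> (v'' n x)) \<in> borel_measurable unit_leb" for n
    using measurable_comp[of "v' n"] measurable_comp[of "v'' n"] vv by simp_all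
  have disj: "v' i x = 0 \<or> v' j x = 0" if "i < j" for i j x
    using that by (auto simp: v'_def later_def)
  \<comment> \<open>Wherever \<open>v'' i\<close> is nonzero some later \<open>v j\<close> is
    nonzero, so summing the overlap bounds over \<open>j\<close> gives an upper bound.\<close>
  have int'': "(\<integral>\<^sup>+x. ennreal (\<phi> (v'' i x)) \<partial>unit_leb) \<le> ennreal (2 * (1 / 2) ^ i)" for i
  proof -
    have "(\<integral>\<^sup>+x. ennreal (\<phi> (v'' i x)) \<partial>unit_leb) \<le> 
      (\<integral>\<^sup>+x. (\<Sum>j. if i < j then ennreal (\<phi> (v i x)) * indicator {x. v j x \<noteq> 0} x else 0) \<partial>unit_leb)"
    proof (rule nn_integral_mono)
      fix x
      show "ennreal (\<phi> (v'' i x)) \<le> (\<Sum>j. if i < j then ennreal (\<phi> (v i x)) * indicator {x. v j x \<noteq> 0} x else 0)"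
      proof (cases "later i x")
        case True
        then obtain j where j: "i < j" "v j x \<noteq> 0" by (auto simp: later_def)
        have "ennreal (\<phi> (v'' i x)) = (\<Sum>j\<in>{j}. if i < j then ennreal (\<phi> (v i x)) * indicator {x. v j x \<noteq> 0} x else 0)"
          using j True by (simp add: v''_def)
        also have "\<dots> \<le> (\<Sum>j. if i < j then ennreal (\<phi> (v i x)) * indicator {x. v j x \<noteq> 0} x else 0)"
          by (rule sum_le_suminf) auto
        finally show ?thesis .
      qed (simp add: v''_def)
    qed
    also have "\<dots> = (\<Sum>j. \<integral>\<^sup>+x. (if i < j then ennreal (\<phi> (v i x)) * indicator {x. v j x \<noteq> 0} x else 0) \<partial>unit_leb)"
      by (rule nn_integral_suminf) measurable
    also have "\<dots> \<le> (\<Sum>j. ennreal ((1 / 2) ^ i * (1 / 2) ^ j))"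
    proof (rule suminf_le)
      fix j
      show "(\<integral>\<^sup>+x. (if i < j then ennreal (\<phi> (v i x)) * indicator {x. v j x \<noteq> 0} x else 0) \<partial>unit_leb) \<le> ennreal ((1 / 2) ^ i * (1 / 2) ^ j)"
        using small[of i j] by (cases "i < j") simp_all
    qed auto
    also have "\<dots> = ennreal (2 * (1 / 2) ^ i)"
      using sums_mult[OF geometric_sums[of "1 / 2 :: real"], of "(1 / 2) ^ i"]
      by (subst suminf_ennreal2) (auto simp: sums_iff)
    finally show ?thesis .
  qed
  define w where "w = (\<lambda>n. real (Suc n) powr (- p))"
  have w: "w n \<ge> 0" for n by (simp add: w_def)
  define Z1 where "Z1 = (\<lambda>x. \<Sum>n. ennreal (w n) * ennreal (\<phi> (v n x)))"
  define Z2 where "Z2 = (\<lambda>x. \<Sum>n. ennreal (\<phi> (v'' n x)))"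
  have [measurable]: "Z1 \<in> borel_measurable unit_leb" "Z2 \<in> borel_measurable unit_leb"
    unfolding Z1_def Z2_def by measurable
  have "(\<integral>\<^sup>+x. Z1 x \<partial>unit_leb) = (\<Sum>n. ennreal (w n) * modular \<phi> (v n) 1)"
    unfolding Z1_def modular_def using v0 by (subst nn_integral_suminf) (auto simp: nn_integral_cmult)
  also have "\<dots> \<le> (\<Sum>n. ennreal (w n) * 1)"
    using v1 by (intro suminf_le mult_left_mono) auto
  also have "\<dots> = ennreal (suminf w)"
    using summable_powr[OF p(1)] w by (simp add: suminf_ennreal2 w_def)
  finally have Z1: "(\<integral>\<^sup>+x. Z1 x \<partial>unit_leb) < \<infinity>" by (auto intro: order_le_less_trans)
  have "(\<integral>\<^sup>+x. Z2 x \<partial>unit_leb) = (\<Sum>n. \<integral>\<^sup>+x. ennreal (\<phi> (v'' n x)) \<partial>unit_leb)"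
    unfolding Z2_def by (rule nn_integral_suminf) measurable
  also have "\<dots> \<le> (\<Sum>n. ennreal (2 * (1 / 2) ^ n))"
    using int'' by (intro suminf_le) auto
  also have "\<dots> = ennreal 4"
    using sums_mult[OF geometric_sums[of "1 / 2 :: real"], of "2"]
    by (subst suminf_ennreal2) (auto simp: sums_iff)
  finally have Z2: "(\<integral>\<^sup>+x. Z2 x \<partial>unit_leb) < \<infinity>" by (auto intro: order_le_less_trans)
  define Z where "Z = (\<lambda>x. ennreal A * (1 + Z1 x) + Z2 x)"
  show ?thesis
  proof (rule dominated_inI[where b = 2 and Z = Z])
    show [measurable]: "Z \<in> borel_measurable unit_leb" unfolding Z_def by measurable
    show "(\<integral>\<^sup>+x. Z x \<partial>unit_leb) < \<infinity>"
      unfolding Z_def using Z1 Z2 by (simp add: nn_integral_add nn_integral_cmult ennreal_mult_less_top)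
    show "AE x in unit_leb. \<forall>m. ennreal (\<phi> (\<bar>cesaro v m x\<bar> / 2)) \<le> Z x"
    proof (intro always_eventually allI)
      fix x m
      define a where "a = (\<Sum>n\<le>m. v' n x) / Suc m"
      define b where "b = (\<Sum>n\<le>m. v'' n x) / Suc m"
      have ab: "a \<ge> 0" "b \<ge> 0" using vv by (auto simp: a_def b_def intro!: divide_nonneg_nonneg sum_nonneg)
      have c: "cesaro v m x = a + b"
        by (simp add: cesaro_def a_def b_def vv(1) sum.distrib add_divide_distrib)
      have "ennreal (\<phi> a) \<le> ennreal A * (1 + Z1 x)"
      proof -
        consider "(\<Sum>n\<le>m. v' n x) = 0" | i where "i \<le> m" "(\<Sum>n\<le>m. v' n x) = v' i x"
          using disjoint_sum_eq[of "{..m}" "\<lambda>n. v' n x"] disj by auto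
        then show ?thesis
        proof cases
          case 1
          then show ?thesis by (simp add: a_def)
        next
          case (2 i)
          \<comment> \<open>At most one summand is nonzero and its index satisfies i \<le> m; the
            denominator \<open>Suc m\<close> may be lowered to \<open>Suc i\<close>, which removes
            \<open>m\<close> from the majorant.\<close>
          have "a \<le> v i x / Suc i"
            unfolding a_def 2(2) using 2(1) vv(1)[of i x] vv(2,3)[of i x] by (intro frac_le) auto
          then have "\<phi> a \<le> \<phi> (v i x / Suc i)" using ab by (intro mono)
          also have "\<dots> \<le> A * (1 + w i * \<phi> (v i x))" unfolding w_def using v0 by (intro A) auto
          finally have "ennreal (\<phi> a) \<le> ennreal (A * (1 + w i * \<phi> (v i x)))" by (rule ennreal_leI)
          also have "\<dots> = ennreal A * (1 + ennreal (w i) * ennreal (\<phi> (v i x)))"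
            using p w[of i] nonneg[OF v0[of i x]] by (simp add: ennreal_mult)
          also have "ennreal (w i) * ennreal (\<phi> (v i x)) \<le> Z1 x"
            unfolding Z1_def using sum_le_suminf[of "\<lambda>n. ennreal (w n) * ennreal (\<phi> (v n x))" "{i}"] by auto
          finally show ?thesis by (auto simp: add_left_mono mult_left_mono)
        qed
      qed
      \<comment> \<open>A mean is at most the maximum of its terms, so a single summand of
        \<open>Z2\<close> suffices.\<close>
      moreover have "ennreal (\<phi> b) \<le> Z2 x"
      proof -
        have "(\<lambda>n. v'' n x) ` {..m} \<noteq> {}" by auto
        then have "Max ((\<lambda>n. v'' n x) ` {..m}) \<in> (\<lambda>n. v'' n x) ` {..m}" by (intro Max_in) auto
        then obtain i where i: "Max ((\<lambda>n. v'' n x) ` {..m}) = v'' i x" by (rule imageE)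
        have "v'' n x \<le> v'' i x" if "n \<le> m" for n using that Max_ge[of "(\<lambda>n. v'' n x) ` {..m}" "v'' n x"] i by auto
        then have "(\<Sum>n\<le>m. v'' n x) \<le> real (card {..m}) * v'' i x" by (intro sum_bounded_above) auto
        then have "b \<le> v'' i x" by (simp add: b_def field_simps)
        then have "ennreal (\<phi> b) \<le> ennreal (\<phi> (v'' i x))" using ab by (intro ennreal_leI mono)
        also have "\<dots> \<le> Z2 x"
          unfolding Z2_def using sum_le_suminf[of "\<lambda>n. ennreal (\<phi> (v'' n x))" "{i}"] by auto
        finally show ?thesis .
      qed
      moreover have "\<phi> ((a + b) / 2) \<le> \<phi> a + \<phi> b"
        using convex_comb[of "1/2" "1/2" a b] ab nonneg[OF ab(1)] nonneg[OF ab(2)] by (simp add: add_divide_distrib)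
      then have "ennreal (\<phi> ((a + b) / 2)) \<le> ennreal (\<phi> a) + ennreal (\<phi> b)"
        using ab nonneg by (simp add: ennreal_leI flip: ennreal_plus)
      ultimately show "ennreal (\<phi> (\<bar>cesaro v m x\<bar> / 2)) \<le> Z x"
        unfolding Z_def c using ab by (simp add: add_mono order_trans)
    qed
  qed (auto simp: cesaro_def)
qed

end

lemma harmonic_unbounded: "\<exists>m>n. (\<Sum>j=n..<m. 1 / real (Suc j)) > B"
proof (rule ccontr)
  assume "\<not> ?thesis"
  then have le: "(\<Sum>j=n..<m. 1 / real (Suc j)) \<le> B" if "m > n" for m using that by (meson not_le)
  have "summable (\<lambda>j. 1 / real (Suc j))"
  proof (rule summableI_nonneg_bounded)
    fix m
    have "(\<Sum>j<m. 1 / real (Suc j)) \<le> (\<Sum>j<Suc (n + m). 1 / real (Suc j))"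
      by (intro sum_mono2) auto
    also have "{..<Suc (n + m)} = {..<n} \<union> {n..<Suc (n + m)}" by auto
    also have "(\<Sum>j\<in>\<dots>. 1 / real (Suc j)) = (\<Sum>j<n. 1 / real (Suc j)) + (\<Sum>j=n..<Suc (n + m). 1 / real (Suc j))"
      by (intro sum.union_disjoint) auto
    finally show "(\<Sum>j<m. 1 / real (Suc j)) \<le> (\<Sum>j<n. 1 / real (Suc j)) + B"
      using le[of "Suc (n + m)"] by simp
  qed auto
  then show False using not_summable_harmonic[where 'a = real]
    by (subst (asm) summable_Suc_iff[of "\<lambda>j. 1 / real j"]) (simp add: inverse_eq_divide)
qed

section \<open>Functionals on functions of small support\<close>

context orlicz
begin

text \<open>Bounded functions have absolutely continuous norm; the threshold depends only on the
  bound and on the scale.\<close>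

lemma small_set_modular:
  assumes [measurable]: "g \<in> borel_measurable unit_leb" and B: "\<And>x. \<bar>g x\<bar> \<le> B" and c: "c > 0"
  shows "\<exists>\<theta>>0. \<forall>E\<in>sets unit_leb. measure unit_leb E \<le> \<theta> \<longrightarrow> modular \<phi> (\<lambda>x. g x * indicator E x) c \<le> 1"
proof -
  have B0: "B \<ge> 0" using B[of 0] by linarith
  define \<theta> where "\<theta> = 1 / (\<phi> (B / c) + 1)"
  have ph: "\<phi> (B / c) \<ge> 0" using B0 c by (intro nonneg) auto
  have "modular \<phi> (\<lambda>x. g x * indicator E x) c \<le> 1" if E: "E \<in> sets unit_leb" "measure unit_leb E \<le> \<theta>" for E
  proof -
    have "modular \<phi> (\<lambda>x. g x * indicator E x) c \<le> (\<integral>\<^sup>+x. ennreal (\<phi> (B / c)) * indicator E x \<partial>unit_leb)"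
      unfolding modular_def
    proof (rule nn_integral_mono)
      fix x
      have "\<phi> (\<bar>g x\<bar> / c) \<le> \<phi> (B / c)" using B[of x] c by (intro mono divide_right_mono) auto
      then show "ennreal (\<phi> (\<bar>g x * indicator E x\<bar> / c)) \<le> ennreal (\<phi> (B / c)) * indicator E x"
        by (auto simp: indicator_def intro: ennreal_leI)
    qed
    also have "\<dots> = ennreal (\<phi> (B / c)) * ennreal (measure unit_leb E)"
      using E by (simp add: nn_integral_cmult_indicator unit_leb.emeasure_eq_measure)
    also have "\<dots> = ennreal (\<phi> (B / c) * measure unit_leb E)" using ph by (simp add: ennreal_mult)
    also have "\<phi> (B / c) * measure unit_leb E \<le> \<phi> (B / c) * \<theta>" using E ph by (intro mult_left_mono) auto
    also have "\<phi> (B / c) * \<theta> \<le> 1" using ph by (simp add: \<theta>_def)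
    finally show ?thesis by (simp add: ennreal_leI)
  qed
  moreover have "\<theta> > 0" using ph by (simp add: \<theta>_def)
  ultimately show ?thesis by blast
qed

text \<open>
  Otherwise there are almost disjoint \<open>g j\<close> in the unit ball with \<open>l (g j) \<ge> \<epsilon>\<close>; then
  \<open>\<Sum>j<m. g j / (j + 1)\<close> stays bounded by \<open>nabla2\<close>, but \<open>l\<close> grows on it like the harmonic series.
\<close>

lemma functional_small_support:
  assumes n2: "nabla2 \<phi>" and l: "bounded_functional \<phi> (orlicz_heart \<phi>) l" and \<epsilon>: "\<epsilon> > 0"
  shows "\<exists>\<eta>>0. \<forall>g B. g \<in> borel_measurable unit_leb \<longrightarrow> (\<forall>x. \<bar>g x\<bar> \<le> B) \<longrightarrow> modular \<phi> g 1 \<le> 1 \<longrightarrow>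
    measure unit_leb {x \<in> space unit_leb. g x \<noteq> 0} \<le> \<eta> \<longrightarrow> \<bar>l g\<bar> \<le> \<epsilon>"
proof (rule ccontr)
  define S where "S = (\<lambda>g. {x \<in> space unit_leb. g x \<noteq> (0::real)})"
  assume *: "\<not> ?thesis"
  have ex: "\<exists>g B. g \<in> borel_measurable unit_leb \<and> (\<forall>x. \<bar>g x\<bar> \<le> B) \<and> modular \<phi> g 1 \<le> 1 \<and>
    measure unit_leb (S g) \<le> \<eta> \<and> \<bar>l g\<bar> > \<epsilon>" if "\<eta> > 0" for \<eta>
  proof -
    have "\<not> (\<forall>g B. g \<in> borel_measurable unit_leb \<longrightarrow> (\<forall>x. \<bar>g x\<bar> \<le> B) \<longrightarrow> modular \<phi> g 1 \<le> 1 \<longrightarrow>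
      measure unit_leb (S g) \<le> \<eta> \<longrightarrow> \<bar>l g\<bar> \<le> \<epsilon>)"
      using * that unfolding S_def by blast
    then show ?thesis unfolding not_all not_imp not_le by blast
  qed
  obtain C where C: "C > 0" "\<And>f c. f \<in> orlicz_heart \<phi> \<Longrightarrow> c > 0 \<Longrightarrow> modular \<phi> f c \<le> 1 \<Longrightarrow> \<bar>l f\<bar> \<le> C * c"
    using bounded_functionalE[OF l] by blast
  define c where "c = \<epsilon> / (2 * C)"
  have c: "c > 0" using C \<epsilon> by (simp add: c_def)
  \<comment> \<open>Each chosen function carries a threshold \<theta> such that its restriction to
    any set of measure at most \<theta> has norm at most \<open>c\<close>; \<open>Q\<close> keeps
    the measure of the next support and the next threshold below \<theta> / 2.\<close>
  define P where "P = (\<lambda>(n::nat) (g, \<theta>). g \<in> borel_measurable unit_leb \<and> (\<exists>B. \<forall>x. \<bar>g x\<bar> \<le> B) \<and> modular \<phi> g 1 \<le> 1 \<and>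
    \<bar>l g\<bar> > \<epsilon> \<and> \<theta> > (0::real) \<and> (\<forall>E\<in>sets unit_leb. measure unit_leb E \<le> \<theta> \<longrightarrow> modular \<phi> (\<lambda>x. g x * indicator E x) c \<le> 1))"
  define Q where "Q = (\<lambda>(n::nat) (g :: real \<Rightarrow> real, \<theta>) (g', \<theta>'). measure unit_leb (S g') \<le> \<theta> / 2 \<and> \<theta>' \<le> \<theta> / 2)"
  have step: "\<exists>y. P n y \<and> measure unit_leb (S (fst y)) \<le> \<eta> \<and> snd y \<le> \<eta>" if \<eta>: "\<eta> > 0" for \<eta> n
  proof -
    obtain g B where g: "g \<in> borel_measurable unit_leb" "\<And>x. \<bar>g x\<bar> \<le> B" "modular \<phi> g 1 \<le> 1"
      "measure unit_leb (S g) \<le> \<eta>" "\<bar>l g\<bar> > \<epsilon>"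
      using ex[OF \<eta>] by blast
    obtain \<theta> where \<theta>: "\<theta> > 0" "\<forall>E\<in>sets unit_leb. measure unit_leb E \<le> \<theta> \<longrightarrow> modular \<phi> (\<lambda>x. g x * indicator E x) c \<le> 1"
      using small_set_modular[OF g(1,2) c] by blast
    then have "P n (g, min \<theta> \<eta>)" using g \<eta> unfolding P_def by auto
    then show ?thesis using g(4) by (intro exI[of _ "(g, min \<theta> \<eta>)"]) auto
  qed
  have "\<exists>f. \<forall>n. P n (f n) \<and> Q n (f n) (f (Suc n))"
  proof (rule dependent_nat_choice)
    show "\<exists>y. P 0 y" using step[of 1 0] by auto
    fix y n assume "P n y"
    then have "snd y / 2 > 0" by (simp add: P_def split_beta)
    from step[OF this, of "Suc n"] show "\<exists>z. P (Suc n) z \<and> Q n y z"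
      unfolding Q_def split_beta by blast
  qed
  then obtain f where f: "\<And>n. P n (f n)" "\<And>n. Q n (f n) (f (Suc n))" by blast
  define g where "g = (\<lambda>n. fst (f n))"
  define \<theta> where "\<theta> = (\<lambda>n. snd (f n))"
  have f_eq: "f n = (g n, \<theta> n)" for n by (simp add: g_def \<theta>_def)
  have gm [measurable]: "\<And>n. g n \<in> borel_measurable unit_leb" and gb: "\<And>n. \<exists>B. \<forall>x. \<bar>g n x\<bar> \<le> B"
    and g1: "\<And>n. modular \<phi> (g n) 1 \<le> 1" and lg: "\<And>n. \<bar>l (g n)\<bar> > \<epsilon>" and \<theta>0: "\<And>n. \<theta> n > 0"
    and small: "\<And>n E. E \<in> sets unit_leb \<Longrightarrow> measure unit_leb E \<le> \<theta> n \<Longrightarrow> modular \<phi> (\<lambda>x. g n x * indicator E x) c \<le> 1"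
    using f(1) unfolding P_def f_eq by auto
  have S': "measure unit_leb (S (g (Suc n))) \<le> \<theta> n / 2" "\<theta> (Suc n) \<le> \<theta> n / 2" for n
    using f(2)[of n] unfolding Q_def f_eq by auto
  have \<theta>': "\<theta> (n + k) \<le> \<theta> n * (1 / 2) ^ k" for n k
  proof (induction k)
    case (Suc k)
    then show ?case using S'(2)[of "n + k"] by (simp add: algebra_simps)
  qed auto
  have [measurable]: "S (g n) \<in> sets unit_leb" for n unfolding S_def by measurable
  \<comment> \<open>The supports of all later functions together have measure at most
    \<open>\<theta> n\<close>, by a geometric sum that starts at half of it.\<close>
  define L where "L = (\<lambda>n. \<Union>k. S (g (Suc (n + k))))"
  have [measurable]: "L n \<in> sets unit_leb" for n unfolding L_def by measurable
  have "measure unit_leb (L n) \<le> \<theta> n" for n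
  proof -
    have le: "measure unit_leb (S (g (Suc (n + k)))) \<le> \<theta> n / 2 * (1 / 2) ^ k" for k
      using S'(1)[of "n + k"] \<theta>'[of n k] by simp
    have s: "(\<lambda>k. \<theta> n / 2 * (1 / 2) ^ k) sums (\<theta> n / 2 * 2)"
      using sums_mult[OF geometric_sums[of "1 / 2 :: real"], of "\<theta> n / 2"] by simp
    have s': "summable (\<lambda>k. measure unit_leb (S (g (Suc (n + k)))))"
      by (rule summable_comparison_test'[OF sums_summable[OF s], of 0]) (use le in auto)
    have "measure unit_leb (L n) \<le> (\<Sum>k. measure unit_leb (S (g (Suc (n + k)))))"
      unfolding L_def using s' by (intro unit_leb.finite_measure_subadditive_countably) auto
    also have "\<dots> \<le> (\<Sum>k. \<theta> n / 2 * (1 / 2) ^ k)"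
      using s' s le by (intro suminf_le) (auto simp: sums_iff)
    finally show ?thesis using s by (simp add: sums_iff)
  qed
  then have small': "modular \<phi> (\<lambda>x. g n x * indicator (L n) x) c \<le> 1" for n by (intro small) auto
  \<comment> \<open>Cutting off the later supports makes the functions disjoint. Outside [0,1],
    where the measure sees nothing, the value is set to 0 so that disjointness holds at every
    point.\<close>
  define u where "u = (\<lambda>n x. if x \<in> L n \<or> x \<notin> space unit_leb then 0 else g n x)"
  have [measurable]: "u n \<in> borel_measurable unit_leb" for n
  proof -
    have "(\<lambda>x. g n x * indicator (space unit_leb - L n) x) \<in> borel_measurable unit_leb" by measurable
    then show ?thesis by (rule measurable_cong[THEN iffD1, rotated]) (auto simp: u_def indicator_def)
  qed
  have ub: "\<bar>u n x\<bar> \<le> \<bar>g n x\<bar>" for n x by (auto simp: u_def)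
  have heart: "h \<in> orlicz_heart \<phi>" if "h \<in> borel_measurable unit_leb" "\<And>x. \<bar>h x\<bar> \<le> \<bar>g n x\<bar>" for h n
  proof -
    obtain B where "\<And>x. \<bar>g n x\<bar> \<le> B" using gb by blast
    then have "\<bar>h x\<bar> \<le> B" for x using that(2) order_trans by blast
    then show ?thesis using that(1) by (intro heart_bounded[of h B]) auto
  qed
  have u_heart: "u n \<in> orlicz_heart \<phi>" for n using ub by (intro heart) auto
  \<comment> \<open>The removed part has norm at most \<open>c\<close>, so it changes
    \<open>l\<close> by at most C c = \<epsilon> / 2.\<close>
  have lu: "\<bar>l (u n)\<bar> \<ge> \<epsilon> / 2" for n
  proof -
    define d where "d = (\<lambda>x. g n x - u n x)"
    have dm: "d \<in> borel_measurable unit_leb" unfolding d_def by measurable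
    have "modular \<phi> d c \<le> modular \<phi> (\<lambda>x. g n x * indicator (L n) x) c"
      using c by (intro modular_mono AE_I2) (auto simp: d_def u_def)
    then have "modular \<phi> d c \<le> 1" using small'[of n] by simp
    moreover have "d \<in> orlicz_heart \<phi>" using dm by (intro heart[of d n]) (auto simp: d_def u_def)
    ultimately have "\<bar>l d\<bar> \<le> C * c" using c by (intro C(2)) auto
    moreover have "l d = l (g n) - l (u n)"
      unfolding d_def by (intro heart_functional_diff[OF l] u_heart heart[of _ n]) auto
    moreover have "C * c = \<epsilon> / 2" using C by (simp add: c_def)
    ultimately show ?thesis using lg[of n] by linarith
  qed
  have disj: "u i x = 0 \<or> u j x = 0" if "i < j" for i j x
  proof (rule ccontr)
    assume *: "\<not> ?thesis"
    then have "x \<in> space unit_leb" "g j x \<noteq> 0" "x \<notin> L i" by (auto simp: u_def split: if_splits)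
    moreover obtain k where "j = Suc (i + k)" using less_imp_Suc_add[OF \<open>i < j\<close>] by blast
    ultimately show False by (auto simp: L_def S_def)
  qed
  obtain p A where p: "1 < p" "1 \<le> A" and A: "\<And>t j. 0 \<le> t \<Longrightarrow> 1 \<le> j \<Longrightarrow> \<phi> (t / j) \<le> A * (1 + j powr (- p) * \<phi> t)"
    using nabla2E[OF n2] by metis
  define w where "w = (\<lambda>n. real (Suc n) powr (- p))"
  have w: "w n \<ge> 0" for n by (simp add: w_def)
  have sw: "summable w" using summable_powr[OF p(1)] by (simp add: w_def)
  define M where "M = A * (1 + suminf w)"
  have "1 * 1 \<le> A * (1 + suminf w)" using p suminf_nonneg[OF sw w] by (intro mult_mono) auto
  then have M: "M \<ge> 1" by (simp add: M_def)
  define \<sigma> where "\<sigma> = (\<lambda>n. if l (u n) \<ge> 0 then 1 else - 1 :: real)"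
  have \<sigma>: "\<bar>\<sigma> n\<bar> = 1" "\<sigma> n * l (u n) = \<bar>l (u n)\<bar>" for n by (auto simp: \<sigma>_def)
  \<comment> \<open>The signs make all contributions to \<open>l\<close> nonnegative. By
    disjointness the modular of \<open>h m\<close> is at most \<open>M\<close> for every
    \<open>m\<close>, since the weights (n + 1)^(-p) are summable.\<close>
  define h where "h = (\<lambda>m x. \<Sum>n<m. \<sigma> n / Suc n * u n x)"
  have hm [measurable]: "h m \<in> borel_measurable unit_leb" for m unfolding h_def by measurable
  have h_heart: "h m \<in> orlicz_heart \<phi>" for m
    unfolding h_def by (intro heart_sum heart_cmult u_heart) auto
  have [measurable]: "(\<lambda>x. \<phi> \<bar>g n x\<bar>) \<in> borel_measurable unit_leb" for n by (intro measurable_comp gm)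
  have "modular \<phi> (h m) 1 \<le> ennreal M" for m
  proof -
    have "modular \<phi> (h m) 1 \<le> (\<integral>\<^sup>+x. ennreal A * (1 + (\<Sum>n<m. ennreal (w n) * ennreal (\<phi> \<bar>g n x\<bar>))) \<partial>unit_leb)"
      unfolding modular_def
    proof (rule nn_integral_mono)
      fix x
      consider "h m x = 0" | i where "i < m" "h m x = \<sigma> i / Suc i * u i x"
        using disjoint_sum_eq[of "{..<m}" "\<lambda>n. \<sigma> n / Suc n * u n x"] disj[of _ _ x] by (auto simp: h_def)
      then show "ennreal (\<phi> (\<bar>h m x\<bar> / 1)) \<le> ennreal A * (1 + (\<Sum>n<m. ennreal (w n) * ennreal (\<phi> \<bar>g n x\<bar>)))"
      proof cases
        case (2 i)
        have "\<phi> (\<bar>h m x\<bar> / 1) \<le> \<phi> (\<bar>g i x\<bar> / Suc i)"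
          unfolding 2(2) using \<sigma>(1)[of i] ub[of i x] by (intro mono) (auto simp: abs_mult divide_right_mono)
        also have "\<dots> \<le> A * (1 + w i * \<phi> \<bar>g i x\<bar>)" unfolding w_def by (intro A) auto
        finally have "ennreal (\<phi> (\<bar>h m x\<bar> / 1)) \<le> ennreal (A * (1 + w i * \<phi> \<bar>g i x\<bar>))" by (rule ennreal_leI)
        also have "\<dots> = ennreal A * (1 + ennreal (w i) * ennreal (\<phi> \<bar>g i x\<bar>))"
          using p w[of i] nonneg[of "\<bar>g i x\<bar>"] by (simp add: ennreal_mult)
        also have "ennreal (w i) * ennreal (\<phi> \<bar>g i x\<bar>) \<le> (\<Sum>n<m. ennreal (w n) * ennreal (\<phi> \<bar>g n x\<bar>))"
          using 2(1) by (intro member_le_sum[of i "{..<m}" "\<lambda>n. ennreal (w n) * ennreal (\<phi> \<bar>g n x\<bar>)"]) auto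
        finally show ?thesis by (auto simp: add_left_mono mult_left_mono)
      qed simp
    qed
    also have "\<dots> = ennreal A * (1 + (\<Sum>n<m. ennreal (w n) * modular \<phi> (g n) 1))"
      unfolding modular_def by (simp add: nn_integral_cmult nn_integral_add nn_integral_sum)
    also have "\<dots> \<le> ennreal A * (1 + (\<Sum>n<m. ennreal (w n) * 1))"
      using g1 by (intro mult_left_mono add_left_mono sum_mono) auto
    also have "\<dots> = ennreal (A * (1 + (\<Sum>n<m. w n)))"
      using w p by (simp add: ennreal_mult sum_nonneg)
    also have "\<dots> \<le> ennreal M"
      unfolding M_def using p w sw by (intro ennreal_leI mult_left_mono add_left_mono sum_le_suminf) auto
    finally show ?thesis .
  qed
  then have "modular \<phi> (h m) (M * 1) \<le> 1" for m using M by (intro modular_scale_le_1) auto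
  then have le: "\<bar>l (h m)\<bar> \<le> C * M" for m using M by (intro C(2) h_heart) auto
  have "l (h m) = (\<Sum>n<m. 1 / Suc n * \<bar>l (u n)\<bar>)" for m
  proof -
    have "l (h m) = (\<Sum>n<m. l (\<lambda>x. \<sigma> n / Suc n * u n x))"
      unfolding h_def by (intro heart_functional_sum[OF l] heart_cmult u_heart) auto
    also have "\<dots> = (\<Sum>n<m. \<sigma> n / Suc n * l (u n))"
      by (intro sum.cong bounded_functional_cmult[OF l u_heart]) auto
    also have "\<dots> = (\<Sum>n<m. 1 / Suc n * \<bar>l (u n)\<bar>)"
      using \<sigma>(2) by (intro sum.cong) (simp_all add: field_simps)
    finally show ?thesis .
  qed
  then have lower: "(\<Sum>n<m. 1 / Suc n) * (\<epsilon> / 2) \<le> l (h m)" for m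
    unfolding sum_distrib_right using lu by (auto intro!: sum_mono mult_left_mono simp del: times_divide_eq_left times_divide_eq_right)
  obtain m where "(\<Sum>j=0..<m. 1 / real (Suc j)) > C * M / (\<epsilon> / 2)" using harmonic_unbounded by blast
  then have "(\<Sum>n<m. 1 / Suc n) * (\<epsilon> / 2) > C * M" using \<epsilon> by (simp add: field_simps atLeast0LessThan)
  then show False using lower[of m] le[of m] by linarith
qed

end

text \<open>
  The sets of points with a given digit \<open>0\<close> in base \<open>M\<close>: passing to the preimage under the shift
  \<open>x \<mapsto> M x mod 1\<close> preserves measures of subsets of \<open>[0,1)\<close>.
\<close>

lemma ex_independent_sets:
  fixes M :: nat
  assumes M: "M > 0"
  shows "\<exists>A::nat \<Rightarrow> real set. (\<forall>n. A n \<in> sets unit_leb \<and> measure unit_leb (A n) = 1 / M) \<and>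
     (\<forall>m n. m \<noteq> n \<longrightarrow> measure unit_leb (A m \<inter> A n) = 1 / M\<^sup>2)"
proof -
  \<comment> \<open>\<open>D d B\<close> is the preimage of \<open>B\<close> under the branch x -> M
    x - d of the shift; for B inside [0,1), \<open>P B\<close> is the full preimage.\<close>
  define D where "D = (\<lambda>(d::nat) B. {x::real. M * x - d \<in> B})"
  define P where "P = (\<lambda>B. \<Union>d<M. D d B)"
  define \<mu> where "\<mu> = measure (lborel :: real measure)"
  have Dsets [measurable]: "D d B \<in> sets borel" if "B \<in> sets borel" for d B
  proof -
    have "(\<lambda>x::real. M * x - d) -` B \<inter> space borel \<in> sets borel"
      using that by (intro measurable_sets[of _ borel borel]) auto
    then show ?thesis by (simp add: D_def vimage_def)
  qed
  have Psets: "P B \<in> sets borel" if "B \<in> sets borel" for B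
    unfolding P_def using that Dsets by auto
  have D_emeasure: "emeasure lborel (D d B) = ennreal (1 / M) * emeasure lborel B" if B: "B \<in> sets borel" for d B
  proof -
    have "emeasure lborel (D d B) = (\<integral>\<^sup>+x. indicator (D d B) x \<partial>lborel)" using Dsets[OF B] by simp
    also have "\<dots> = ennreal \<bar>1 / real M\<bar> * (\<integral>\<^sup>+x. indicator (D d B) (d / M + (1 / M) * x) \<partial>lborel)"
      using M Dsets[OF B] by (intro nn_integral_real_affine) auto
    also have "(\<lambda>x. indicator (D d B) (d / M + (1 / M) * x)) = (indicator B :: real \<Rightarrow> ennreal)"
      using M by (auto simp: D_def indicator_def fun_eq_iff field_simps)
    finally show ?thesis using B by simp
  qed
  have D_sub: "D d B \<subseteq> {real d / M..<(real d + 1) / M}" if "B \<subseteq> {0..<1}" for d B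
  proof
    fix x assume "x \<in> D d B"
    then have "M * x - d \<in> {0..<1}" using that by (auto simp: D_def)
    then show "x \<in> {real d / M..<(real d + 1) / M}" using M by (simp add: field_simps)
  qed
  have P_sub: "P B \<subseteq> {0..<1}" if "B \<subseteq> {0..<1}" for B
  proof
    fix x assume "x \<in> P B"
    then obtain d where d: "d < M" "x \<in> D d B" by (auto simp: P_def)
    then have x: "real d / M \<le> x" "x < (real d + 1) / M" using D_sub[OF that, of d] by auto
    have "0 \<le> real d / M" by simp
    moreover have "(real d + 1) / M \<le> 1" using d M by (simp add: field_simps)
    ultimately show "x \<in> {0..<1}" using x unfolding atLeastLessThan_iff by linarith
  qed
  have fin: "emeasure lborel B \<noteq> \<infinity>" if "B \<subseteq> {0..<1}" for B :: "real set"
  proof -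
    have "emeasure lborel B \<le> emeasure lborel {0..<1::real}" using that by (intro emeasure_mono) auto
    then show ?thesis by (auto simp: top_unique)
  qed
  have D_measure: "\<mu> (D d B) = \<mu> B / M" if "B \<in> sets borel" for d B
    using M by (simp add: \<mu>_def measure_def D_emeasure[OF that] enn2real_mult)
  \<comment> \<open>Different branches differ by a nonzero integer, so at most one of them has its
    value in the half-open interval [0,1).\<close>
  have D_disj: "d = e" if "x \<in> D d B" "x \<in> D e C" "B \<subseteq> {0..<1}" "C \<subseteq> {0..<1}" for d e x B C
  proof -
    have "M * x - d \<in> {0..<1}" "M * x - e \<in> {0..<1}" using that by (auto simp: D_def)
    then have "\<bar>real d - real e\<bar> < 1" by auto
    then show ?thesis by linarith
  qed
  have P_measure: "\<mu> (P B) = \<mu> B" if B: "B \<in> sets borel" "B \<subseteq> {0..<1}" for B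
  proof -
    have "\<mu> (P B) = (\<Sum>d<M. \<mu> (D d B))"
      unfolding P_def \<mu>_def
    proof (rule measure_finite_Union)
      show "disjoint_family_on (\<lambda>d. D d B) {..<M}"
        using D_disj[OF _ _ B(2) B(2)] by (auto simp: disjoint_family_on_def)
      fix d
      show "emeasure lborel (D d B) \<noteq> \<infinity>"
        using fin[OF B(2)] by (simp add: D_emeasure[OF B(1)] ennreal_mult_eq_top_iff)
    qed (use Dsets B in auto)
    then show ?thesis using M by (simp add: D_measure[OF B(1)])
  qed
  have P_Int: "P B \<inter> P C = P (B \<inter> C)" if "B \<subseteq> {0..<1}" "C \<subseteq> {0..<1}" for B C
  proof
    show "P (B \<inter> C) \<subseteq> P B \<inter> P C" by (auto simp: P_def D_def)
    show "P B \<inter> P C \<subseteq> P (B \<inter> C)"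
    proof
      fix x assume "x \<in> P B \<inter> P C"
      then obtain d e where de: "d < M" "x \<in> D d B" "e < M" "x \<in> D e C" by (auto simp: P_def)
      then have "d = e" using D_disj that by blast
      then show "x \<in> P (B \<inter> C)" using de by (auto simp: P_def D_def)
    qed
  qed
  define A where "A = (\<lambda>n. (P ^^ n) {0..<1 / real M})"
  have A0: "A 0 = {0..<1 / real M}" and AS: "A (Suc n) = P (A n)" for n by (auto simp: A_def)
  have A: "A n \<in> sets borel" "A n \<subseteq> {0..<1}" "\<mu> (A n) = 1 / M" for n
  proof (induction n)
    case 0
    {
      case 1 then show ?case by (simp add: A0)
      case 2 
      have "1 / real M \<le> 1" using M by simp
      then show ?case unfolding A0 by (auto intro: less_le_trans)
      case 3 then show ?case using M by (simp add: A0 \<mu>_def)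
    }
  next
    case (Suc n)
    {
      case 1 then show ?case using Suc Psets by (simp add: AS)
      case 2 then show ?case using Suc P_sub by (simp add: AS)
      case 3 then show ?case using Suc P_measure by (simp add: AS)
    }
  qed
  \<comment> \<open>On [0, 1/M) only branch 0 is possible, so intersecting a preimage with
    \<open>A 0\<close> divides its measure by \<open>M\<close>; this is the independence.\<close>
  have A0_Int: "A 0 \<inter> P B = D 0 B" if B: "B \<subseteq> {0..<1}" for B
  proof
    show "A 0 \<inter> P B \<subseteq> D 0 B"
    proof
      fix x assume x: "x \<in> A 0 \<inter> P B"
      then obtain d where d: "d < M" "x \<in> D d B" by (auto simp: P_def)
      then have "M * x \<ge> d" "M * x < 1" using D_sub[OF B, of d] x M by (auto simp: A0 field_simps)
      then have "d = 0" by linarith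
      then show "x \<in> D 0 B" using d by simp
    qed
    show "D 0 B \<subseteq> A 0 \<inter> P B" using M D_sub[OF B, of 0] by (auto simp: A0 P_def)
  qed
  \<comment> \<open>Both sets are preimages under a common number \<open>m\<close> of shifts; the
    induction peels these off by measure preservation until the smaller index is 0.\<close>
  have Int: "\<mu> (A m \<inter> A (Suc (m + k))) = 1 / M\<^sup>2" for m k
  proof (induction m)
    case 0
    show ?case using A[of k] D_measure[of "A k" 0] by (simp add: AS A0_Int power2_eq_square)
  next
    case (Suc m)
    have "A (Suc m) \<inter> A (Suc (Suc m + k)) = P (A m \<inter> A (Suc (m + k)))"
      using P_Int[OF A(2) A(2), of m "Suc (m + k)"] by (simp only: AS add_Suc)
    moreover have "\<mu> (P (A m \<inter> A (Suc (m + k)))) = \<mu> (A m \<inter> A (Suc (m + k)))"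
      using A by (intro P_measure) auto
    ultimately show ?case using Suc by simp
  qed
  have Int': "\<mu> (A m \<inter> A n) = 1 / M\<^sup>2" if "m \<noteq> n" for m n
  proof (cases "m < n")
    case True
    then show ?thesis using Int[of m "n - m - 1"] by simp
  next
    case False
    then show ?thesis using Int[of n "m - n - 1"] that by (simp add: Int_commute)
  qed
  have unit: "measure unit_leb B = \<mu> B" "B \<in> sets unit_leb" if "B \<in> sets borel" "B \<subseteq> {0..<1}" for B
  proof -
    have "B \<subseteq> {0..1}" using that(2) by auto
    then show "measure unit_leb B = \<mu> B" "B \<in> sets unit_leb"
      using that(1) by (auto simp: \<mu>_def measure_restrict_space measure_completion sets_restrict_space_iff)
  qed
  show ?thesis
    using A Int' by (intro exI[of _ A]) (simp add: unit le_infI1)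
qed

section \<open>Property (H) forces the growth condition\<close>

context orlicz
begin

text \<open>Failure of the condition for every factor gives arbitrarily large \<open>s\<close> with
  \<phi>(s / q) \<ge> \<phi>(s) / (2 q) for all \<open>q\<close> up to a prescribed size: there
  \<phi> is linear up to a factor 2. Bumps of height \<open>s\<close> on sets of measure about 1 /
  \<phi>(s) are bounded in norm, yet the modular of the supremum of the bumps divided by j + 1
  dominates, up to constants, a piece of the harmonic series.\<close>

lemma property_H_imp_nabla2:
  assumes H: "property_H \<phi>"
  shows "nabla2 \<phi>"
proof (rule ccontr)
  assume "\<not> ?thesis"
  then have n2: "\<not> nabla2 \<phi>" .
  have ex: "\<exists>t\<ge>t0. \<phi> (real N * t) < 2 * real N * \<phi> t" if "N \<ge> 2" "t0 > 0" for N :: nat and t0 :: real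
  proof (rule ccontr)
    assume "\<not> ?thesis"
    then have "\<forall>t\<ge>t0. 2 * real N * \<phi> t \<le> \<phi> (real N * t)" by (auto simp: not_less)
    moreover have "2 \<le> real N" using that by simp
    ultimately show False using that(2) n2 unfolding nabla2_def by blast
  qed
  obtain u where u: "u > 0" "\<phi> u > 0" using ex_pos by blast
  \<comment> \<open>Since \<phi> grows at least linearly beyond \<open>u\<close>, s \<le> \<kappa>
    M; the means s / M of the bumps are thus bounded by \<kappa> at all levels.\<close>
  define \<kappa> where "\<kappa> = u / \<phi> u"
  have \<kappa>: "\<kappa> > 0" using u by (simp add: \<kappa>_def)
  \<comment> \<open>The data of level \<open>i\<close>. The factor 4^i pays for the weight 2^(-i) of
    the level and for the scale 2^i at which the final modular is taken; 16 covers three losses of a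
    factor 2 and still leaves a sum above 2, where 1 is the bound. The inequality 2 J \<le> M lets a
    set of measure 1 / M lose at most half of itself to the fewer than \<open>J\<close>
    others.\<close>
  define R where "R = (\<lambda>i (J::nat) (M::nat) (s::real). J > i \<and> (\<Sum>j=i..<J. 1 / real (Suc j)) > 16 * 4 ^ i \<and> s \<ge> 0 \<and> M > 0 \<and>
     \<phi> s \<le> M \<and> M \<le> 2 * \<phi> s \<and> 2 * real J \<le> M \<and> s \<le> \<kappa> * M \<and>
     (\<forall>q::real. 1 \<le> q \<longrightarrow> q \<le> 4 ^ i * J \<longrightarrow> \<phi> s / (2 * q) \<le> \<phi> (s / q)))"
  have R: "\<exists>J M s. R i J M s" for i
  proof -
    obtain J where J: "J > i" "(\<Sum>j=i..<J. 1 / real (Suc j)) > 16 * 4 ^ i"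
      using harmonic_unbounded by blast
    \<comment> \<open>Twice the largest \<open>q\<close> to be treated, so that N \<ge> 2 even if
      that is 1.\<close>
    define N where "N = 2 * (4 ^ i * J)"
    have "4 ^ i * J \<ge> 1 * 1" using J by (intro mult_mono) auto
    then have N: "N \<ge> 2" by (simp add: N_def)
    obtain t0 where t0: "t0 > 0" "\<And>t. t \<ge> t0 \<Longrightarrow> \<phi> t \<ge> 2 * real J + 1" using tends_to_infinity by blast
    have "max t0 u > 0" using u by simp
    from ex[OF N this] obtain t :: real where t: "t \<ge> t0" "t \<ge> u" "\<phi> (N * t) < 2 * N * \<phi> t"
      by auto
    define s where "s = N * t"
    have tp: "t > 0" using t u by linarith
    have st: "s \<ge> t" using N tp by (simp add: s_def)
    have s1: "\<phi> s \<ge> 2 * real J + 1" using t0(2)[of s] t st by linarith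
    define M where "M = nat \<lceil>\<phi> s\<rceil>"
    have M: "\<phi> s \<le> M" "M \<le> \<phi> s + 1" using s1 unfolding M_def by linarith+
    have "(s / u) * \<phi> u \<le> \<phi> ((s / u) * u)" using st t u by (intro scale_ge) auto
    then have "s \<le> \<kappa> * \<phi> s" using u by (simp add: \<kappa>_def field_simps)
    also have "\<dots> \<le> \<kappa> * M" using M \<kappa> by (intro mult_left_mono) auto
    finally have sM: "s \<le> \<kappa> * M" .
    \<comment> \<open>The failure at \<open>t\<close> bounds \<phi> at s = N t from above, and
      convexity bounds \<phi> at (N / q) t from below.\<close>
    have q: "\<phi> s / (2 * q) \<le> \<phi> (s / q)" if q: "1 \<le> q" "q \<le> 4 ^ i * J" for q :: real
    proof -
      have qN: "q \<le> N" using q by (simp add: N_def)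
      have "\<phi> s / (2 * q) \<le> 2 * N * \<phi> t / (2 * q)"
        using t q unfolding s_def by (intro divide_right_mono) auto
      also have "\<dots> = (N / q) * \<phi> t" by simp
      also have "\<dots> \<le> \<phi> ((N / q) * t)" using qN q tp by (intro scale_ge) auto
      finally show ?thesis by (simp add: s_def)
    qed
    have "R i J M s" unfolding R_def using J M s1 sM q st tp by auto
    then show ?thesis by blast
  qed
  have "\<forall>i. \<exists>w. R i (fst w) (fst (snd w)) (snd (snd w))"
  proof
    fix i
    obtain J M s where "R i J M s" using R by blast
    then show "\<exists>w. R i (fst w) (fst (snd w)) (snd (snd w))" by (intro exI[of _ "(J, M, s)"]) simp
  qed
  from choice[OF this] obtain w where w: "\<And>i. R i (fst (w i)) (fst (snd (w i))) (snd (snd (w i)))" by blast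
  define J where "J = (\<lambda>i. fst (w i))"
  define M where "M = (\<lambda>i. fst (snd (w i)))"
  define s where "s = (\<lambda>i. snd (snd (w i)))"
  have Ri: "R i (J i) (M i) (s i)" for i using w by (simp add: J_def M_def s_def)
  have J: "\<And>i. J i > i" "\<And>i. (\<Sum>j=i..<J i. 1 / real (Suc j)) > 16 * 4 ^ i" and s: "\<And>i. s i \<ge> 0" and
    M: "\<And>i. M i > 0" "\<And>i. \<phi> (s i) \<le> M i" "\<And>i. M i \<le> 2 * \<phi> (s i)" "\<And>i. 2 * real (J i) \<le> M i" "\<And>i. s i \<le> \<kappa> * M i" and
    q: "\<And>i (q::real). 1 \<le> q \<Longrightarrow> q \<le> 4 ^ i * J i \<Longrightarrow> \<phi> (s i) / (2 * q) \<le> \<phi> (s i / q)"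
    using Ri unfolding R_def by blast+
  have "\<forall>i. \<exists>A::nat \<Rightarrow> real set. (\<forall>n. A n \<in> sets unit_leb \<and> measure unit_leb (A n) = 1 / M i) \<and>
     (\<forall>m n. m \<noteq> n \<longrightarrow> measure unit_leb (A m \<inter> A n) = 1 / (M i)\<^sup>2)"
    using ex_independent_sets M by blast
  from choice[OF this] obtain A :: "nat \<Rightarrow> nat \<Rightarrow> real set" where 
    Am [measurable]: "\<And>i n. A i n \<in> sets unit_leb" and A1: "\<And>i n. measure unit_leb (A i n) = 1 / M i"
    and A2: "\<And>i m n. m \<noteq> n \<Longrightarrow> measure unit_leb (A i m \<inter> A i n) = 1 / (M i)\<^sup>2"
    by blast
  \<comment> \<open>Level \<open>i\<close> is centred at its mean. Only the levels i \<le> n enter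
    \<open>y n\<close>, so each \<open>y n\<close> is bounded and hence in the heart.\<close>
  define z where "z = (\<lambda>n i x. s i * indicator (A i n) x - s i / M i)"
  define y where "y = (\<lambda>n x. \<Sum>i\<le>n. (1 / 2) ^ i * z n i x)"
  have [measurable]: "z n i \<in> borel_measurable unit_leb" for n i unfolding z_def by measurable
  have [measurable]: "y n \<in> borel_measurable unit_leb" for n unfolding y_def by measurable
  have sM: "0 \<le> s i / M i" "s i / M i \<le> s i" "s i / M i \<le> \<kappa>" for i
  proof -
    show "0 \<le> s i / M i" using s[of i] by simp
    show "s i / M i \<le> \<kappa>" using M(1,5)[of i] by (simp add: field_simps)
    have "s i / M i \<le> s i / 1" using s[of i] M(1)[of i] by (intro divide_left_mono) auto
    then show "s i / M i \<le> s i" by simp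
  qed
  have zb: "\<bar>z n i x\<bar> \<le> s i" for n i x
    using sM[of i] s[of i] by (cases "x \<in> A i n") (simp_all add: z_def)
  have z_heart: "z n i \<in> orlicz_heart \<phi>" for n i using zb by (intro heart_bounded[of _ "s i"]) auto
  have y_heart: "y n \<in> orlicz_heart \<phi>" for n
    unfolding y_def by (intro heart_sum heart_cmult z_heart) auto
  have z_orth: "(\<integral>x. z m i x * z n i x \<partial>unit_leb) = 0" if "m \<noteq> n" for m n i
  proof -
    have "(\<lambda>x. z m i x * z n i x) = (\<lambda>x. (s i)\<^sup>2 * indicator (A i m \<inter> A i n) x
       - ((s i)\<^sup>2 / M i) * indicator (A i m) x - ((s i)\<^sup>2 / M i) * indicator (A i n) x + (s i)\<^sup>2 / (M i)\<^sup>2)"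
      by (auto simp: z_def indicator_def fun_eq_iff power2_eq_square algebra_simps)
    moreover have "(\<integral>x. (s i)\<^sup>2 * indicator (A i m \<inter> A i n) x
       - ((s i)\<^sup>2 / M i) * indicator (A i m) x - ((s i)\<^sup>2 / M i) * indicator (A i n) x + (s i)\<^sup>2 / (M i)\<^sup>2 \<partial>unit_leb)
      = (s i)\<^sup>2 * measure unit_leb (A i m \<inter> A i n) - ((s i)\<^sup>2 / M i) * measure unit_leb (A i m) 
         - ((s i)\<^sup>2 / M i) * measure unit_leb (A i n) + (s i)\<^sup>2 / (M i)\<^sup>2"
    proof -
      have int: "integrable unit_leb (indicator B :: real \<Rightarrow> real)" if "B \<in> sets unit_leb" for B
        by (intro integrable_real_indicator that) (simp add: less_top[symmetric])
      have sp: "A i n \<inter> {0..1} = A i n" "A i m \<inter> {0..1} = A i m" "A i m \<inter> A i n \<inter> {0..1} = A i m \<inter> A i n"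
        using sets.sets_into_space[OF Am[of i n]] sets.sets_into_space[OF Am[of i m]] by auto
      show ?thesis
        using int[OF Am[of i n]] int[OF Am[of i m]] int[OF sets.Int[OF Am[of i m] Am[of i n]]] by (simp add: sp)
    qed
    ultimately show ?thesis using A1 A2[OF that] by (simp add: power2_eq_square)
  qed
  have "weakly_null \<phi> (orlicz_heart \<phi>) y"
    unfolding weakly_null_def
  proof (intro conjI allI impI y_heart)
    fix l assume l: "bounded_functional \<phi> (orlicz_heart \<phi>) l"
    obtain C where C: "C > 0" "\<And>f c. f \<in> orlicz_heart \<phi> \<Longrightarrow> c > 0 \<Longrightarrow> modular \<phi> f c \<le> 1 \<Longrightarrow> \<bar>l f\<bar> \<le> C * c"
      using bounded_functionalE[OF l] by blast
    have "modular \<phi> (\<lambda>x. \<kappa>) 1 < \<infinity>" using modular_bounded[of "\<lambda>x. \<kappa>" \<kappa> 1] \<kappa> 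
      by (auto intro: order_le_less_trans)
    then obtain c where c: "c \<ge> 1" "modular \<phi> (\<lambda>x. \<kappa>) c \<le> 1"
      using modular_finite_imp_le_1[of "\<lambda>x. \<kappa>" 1] by auto
    \<comment> \<open>A bump has norm at most 1 and the subtracted mean has norm at most
      \<open>c\<close>. The bound is independent of the level, as the exchange of limit and series
      below demands.\<close>
    have lz: "\<bar>l (z n i)\<bar> \<le> C * (1 + c)" for n i
    proof (intro C(2) z_heart)
      have "modular \<phi> (\<lambda>x. s i * indicator (A i n) x) 1 = (\<integral>\<^sup>+x. ennreal (\<phi> (s i)) * indicator (A i n) x \<partial>unit_leb)"
        unfolding modular_def using s by (intro nn_integral_cong) (auto simp: indicator_def)
      also have "\<dots> = ennreal (\<phi> (s i)) * ennreal (1 / M i)"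
        using A1 by (simp add: nn_integral_cmult_indicator unit_leb.emeasure_eq_measure)
      also have "\<dots> = ennreal (\<phi> (s i) / M i)" using nonneg[OF s] by (simp flip: ennreal_mult)
      also have "\<dots> \<le> 1" using M(1,2)[of i] by (simp add: field_simps)
      finally have 1: "modular \<phi> (\<lambda>x. s i * indicator (A i n) x) 1 \<le> 1" .
      have "modular \<phi> (\<lambda>x. - (s i / M i)) c \<le> modular \<phi> (\<lambda>x. \<kappa>) c"
        using c sM[of i] by (intro modular_mono) auto
      then have 2: "modular \<phi> (\<lambda>x. - (s i / M i)) c \<le> 1" using c by simp
      have "modular \<phi> (\<lambda>x. s i * indicator (A i n) x + - (s i / M i)) (1 + c) \<le> 1"
        using c 1 2 by (intro modular_add_le_1) auto
      then show "modular \<phi> (z n i) (1 + c) \<le> 1" by (simp add: z_def)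
    qed (use c in auto)
    define a where "a = (\<lambda>i n. if i \<le> n then (1 / 2) ^ i * l (z n i) else 0)"
    have ly: "l (y n) = (\<Sum>i. a i n)" for n
    proof -
      have "l (y n) = (\<Sum>i\<le>n. l (\<lambda>x. (1 / 2) ^ i * z n i x))"
        unfolding y_def by (intro heart_functional_sum[OF l] heart_cmult z_heart) auto
      also have "\<dots> = (\<Sum>i\<le>n. a i n)"
        by (intro sum.cong) (auto simp: a_def bounded_functional_cmult[OF l z_heart])
      also have "\<dots> = (\<Sum>i. a i n)" by (rule suminf_finite[symmetric]) (auto simp: a_def)
      finally show ?thesis .
    qed
    have a_lim: "a i \<longlonglongrightarrow> 0" for i
    proof -
      have "(\<lambda>n. l (z n i)) \<longlonglongrightarrow> 0"
      proof (rule functional_bounded_L2_null[OF l])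
        fix m
        have "\<forall>\<^sub>F n in sequentially. (\<integral>x. z m i x * z n i x \<partial>unit_leb) = 0"
          using eventually_gt_at_top[of m] by eventually_elim (simp add: z_orth)
        then show "(\<lambda>n. \<integral>x. z m i x * z n i x \<partial>unit_leb) \<longlonglongrightarrow> 0" by (rule tendsto_eventually)
      qed (use zb in auto)
      then have "(\<lambda>n. (1 / 2) ^ i * l (z n i)) \<longlonglongrightarrow> (1 / 2) ^ i * 0" by (intro tendsto_intros)
      moreover have "\<forall>\<^sub>F n in sequentially. (1 / 2) ^ i * l (z n i) = a i n"
        using eventually_ge_at_top[of i] by eventually_elim (simp add: a_def)
      ultimately show ?thesis by (simp add: tendsto_cong)
    qed
    have "((\<lambda>n. \<Sum>i. a i n) \<longlongrightarrow> (\<Sum>i. 0)) sequentially"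
    proof (rule tannerys_theorem[THEN conjunct2, THEN conjunct2])
      show "\<forall>\<^sub>F (i, n) in sequentially \<times>\<^sub>F sequentially. norm (a i n) \<le> C * (1 + c) * (1 / 2) ^ i"
      proof (intro always_eventually, clarify)
        fix i n
        show "norm (a i n) \<le> C * (1 + c) * (1 / 2) ^ i"
          using lz[of n i] C(1) c by (auto simp: a_def abs_mult mult.commute intro!: mult_left_mono)
      qed
      show "summable (\<lambda>i. C * (1 + c) * (1 / 2) ^ i)" by (intro summable_mult summable_geometric) auto
    qed (use a_lim in auto)
    then show "(\<lambda>n. l (y n)) \<longlonglongrightarrow> 0" by (simp add: ly)
  qed
  with H obtain r :: "nat \<Rightarrow> nat" and h where r: "strict_mono r" and h: "h \<in> orlicz_space \<phi>" 
    and dom: "\<And>n. AE x in unit_leb. \<bar>cesaro (y \<circ> r) n x\<bar> \<le> h x"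
    unfolding property_H_def dominated_in_def ae_le_def by blast
  \<comment> \<open>Adding 2 \<kappa> makes up for the subtracted means: every \<open>y n\<close> is
    at least -2 \<kappa>, so in a Cesaro mean the earlier terms cannot cancel a bump of the last
    one.\<close>
  define k where "k = (\<lambda>x. h x + 2 * \<kappa>)"
  have "(\<lambda>x. 2 * \<kappa>) \<in> orlicz_space \<phi>" by (intro heart_subset heart_bounded[of _ "2 * \<kappa>"]) (use \<kappa> in auto)
  then have "k \<in> orlicz_space \<phi>" unfolding k_def by (intro space_add h)
  then obtain c where c: "c > 0" "modular \<phi> k c \<le> 1" by (auto simp: space_iff_le_1)
  have "\<exists>i. c < 2 ^ i" by (rule real_arch_pow) simp
  then obtain i where i: "c < 2 ^ i" by blast
  have "modular \<phi> k (2 ^ i) \<le> modular \<phi> k c" using i c by (intro modular_mono) auto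
  then have le: "modular \<phi> k (2 ^ i) \<le> 1" using c by simp
  have k_lower: "AE x in unit_leb. \<forall>j\<in>{i..<J i}. x \<in> A i (r j) \<longrightarrow> s i / (2 ^ i * real (Suc j)) \<le> k x"
  proof -
    have "AE x in unit_leb. \<forall>n. \<bar>cesaro (y \<circ> r) n x\<bar> \<le> h x" using dom by (simp add: AE_all_countable)
    then show ?thesis
    proof eventually_elim
      fix x assume x: "\<forall>n. \<bar>cesaro (y \<circ> r) n x\<bar> \<le> h x"
      show "\<forall>j\<in>{i..<J i}. x \<in> A i (r j) \<longrightarrow> s i / (2 ^ i * real (Suc j)) \<le> k x"
      proof (intro ballI impI)
        fix j assume j: "j \<in> {i..<J i}" "x \<in> A i (r j)"
        have y_ge: "y n x \<ge> (\<Sum>i\<le>n. (1 / 2) ^ i * (s i * indicator (A i n) x)) - 2 * \<kappa>" for n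
        proof -
          have "(\<Sum>i\<le>n. (1 / 2) ^ i * (s i / M i)) \<le> (\<Sum>i\<le>n. (1 / 2) ^ i * \<kappa>)"
            using sM by (intro sum_mono mult_left_mono) auto
          also have "\<dots> = (\<Sum>i\<le>n. (1 / 2) ^ i) * \<kappa>" by (simp add: sum_distrib_right)
          also have "\<dots> \<le> 2 * \<kappa>"
          proof -
            have "(\<Sum>i\<le>n. (1 / 2 :: real) ^ i) \<le> 2" by (simp add: sum_gp0)
            then show ?thesis using \<kappa> by (intro mult_right_mono) auto
          qed
          finally show ?thesis by (simp add: y_def z_def right_diff_distrib sum_subtractf)
        qed
        have y_ge': "y n x \<ge> - 2 * \<kappa>" for n
        proof -
          have "(\<Sum>i\<le>n. (1 / 2) ^ i * (s i * indicator (A i n) x)) \<ge> 0" using s by (intro sum_nonneg) auto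
          then show ?thesis using y_ge[of n] by linarith
        qed
        \<comment> \<open>Since j \<ge> i, level \<open>i\<close> is present in
          \<open>y (r j)\<close>.\<close>
        have "r j \<ge> j" using r by (rule strict_mono_imp_increasing)
        then have "i \<in> {..r j}" using j by auto
        then have "(1 / 2) ^ i * (s i * indicator (A i (r j)) x) \<le> (\<Sum>i\<le>r j. (1 / 2) ^ i * (s i * indicator (A i (r j)) x))"
          using s by (intro member_le_sum) auto
        then have yj: "y (r j) x \<ge> s i / 2 ^ i - 2 * \<kappa>" using y_ge[of "r j"] j by (simp add: power_divide)
        have "(\<Sum>n\<le>j. y (r n) x) = (\<Sum>n<j. y (r n) x) + y (r j) x" by (simp add: lessThan_Suc_atMost[symmetric])
        moreover have "(\<Sum>n<j. y (r n) x) \<ge> (\<Sum>n<j. - 2 * \<kappa>)" using y_ge' by (intro sum_mono) auto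
        ultimately have "(\<Sum>n\<le>j. y (r n) x) \<ge> s i / 2 ^ i - Suc j * (2 * \<kappa>)" using yj by (simp add: algebra_simps)
        then have "(\<Sum>n\<le>j. y (r n) x) / Suc j \<ge> (s i / 2 ^ i - Suc j * (2 * \<kappa>)) / Suc j" by (intro divide_right_mono) auto
        also have "(s i / 2 ^ i - Suc j * (2 * \<kappa>)) / Suc j = s i / (2 ^ i * real (Suc j)) - 2 * \<kappa>"
          by (simp add: diff_divide_distrib)
        finally have "cesaro (y \<circ> r) j x \<ge> s i / (2 ^ i * real (Suc j)) - 2 * \<kappa>" by (simp add: cesaro_def)
        moreover have "cesaro (y \<circ> r) j x \<le> h x" using x abs_le_D1 by blast
        ultimately show "s i / (2 ^ i * real (Suc j)) \<le> k x" by (simp add: k_def)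
      qed
    qed
  qed
  \<comment> \<open>The \<open>j\<close>-th set without its predecessors in the block; it keeps at
    least half of its measure, and the pieces are disjoint.\<close>
  define B where "B = (\<lambda>j. A i (r j) - (\<Union>j'\<in>{i..<j}. A i (r j')))"
  have [measurable]: "B j \<in> sets unit_leb" for j unfolding B_def by (intro sets.Diff sets.finite_UN) auto
  have Bm: "measure unit_leb (B j) \<ge> 1 / (2 * M i)" if j: "j \<in> {i..<J i}" for j
  proof -
    have "measure unit_leb (A i (r j) \<inter> (\<Union>j'\<in>{i..<j}. A i (r j'))) = measure unit_leb (\<Union>j'\<in>{i..<j}. A i (r j') \<inter> A i (r j))"
      by (intro arg_cong[of _ _ "measure unit_leb"]) auto
    also have "\<dots> \<le> (\<Sum>j'\<in>{i..<j}. measure unit_leb (A i (r j') \<inter> A i (r j)))"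
      by (intro unit_leb.finite_measure_subadditive_finite) auto
    also have "\<dots> = (\<Sum>j'\<in>{i..<j}. 1 / (M i)\<^sup>2)"
      using strict_mono_eq[OF r] by (intro sum.cong A2) auto
    also have "\<dots> = (j - i) / (M i)\<^sup>2" using j by simp
    also have "\<dots> \<le> (M i / 2) / (M i)\<^sup>2" using j M(4)[of i] by (intro divide_right_mono) auto
    also have "\<dots> = 1 / (2 * M i)" using M(1)[of i] by (simp add: power2_eq_square)
    finally have "measure unit_leb (A i (r j) \<inter> (\<Union>j'\<in>{i..<j}. A i (r j'))) \<le> 1 / (2 * M i)" .
    moreover have "measure unit_leb (B j) = measure unit_leb (A i (r j)) - measure unit_leb (A i (r j) \<inter> (\<Union>j'\<in>{i..<j}. A i (r j')))"
      unfolding B_def by (intro unit_leb.finite_measure_Diff') auto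
    moreover have "1 / real (M i) - 1 / (2 * M i) = 1 / (2 * M i)" using M(1)[of i] by (simp add: field_simps)
    ultimately show ?thesis using A1[of i "r j"] by linarith
  qed
  define e where "e = (\<lambda>j. \<phi> (s i) / (2 * (4 ^ i * real (Suc j))))"
  have e0: "e j \<ge> 0" for j unfolding e_def using nonneg[OF s] by auto
  have B_disj: "x \<notin> B j \<or> x \<notin> B j'" if "i \<le> j" "j < j'" for j j' x
    using that by (auto simp: B_def)
  have "(\<Sum>j=i..<J i. ennreal (e j) * emeasure unit_leb (B j)) = (\<integral>\<^sup>+x. (\<Sum>j=i..<J i. ennreal (e j) * indicator (B j) x) \<partial>unit_leb)"
    by (subst nn_integral_sum) (simp_all add: nn_integral_cmult_indicator)
  also have "\<dots> \<le> modular \<phi> k (2 ^ i)"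
    unfolding modular_def
  proof (rule nn_integral_mono_AE, use k_lower in eventually_elim)
    fix x assume x: "\<forall>j\<in>{i..<J i}. x \<in> A i (r j) \<longrightarrow> s i / (2 ^ i * real (Suc j)) \<le> k x"
    show "(\<Sum>j=i..<J i. ennreal (e j) * indicator (B j) x) \<le> ennreal (\<phi> (\<bar>k x\<bar> / 2 ^ i))"
    proof (cases "\<exists>j\<in>{i..<J i}. x \<in> B j")
      case True
      then obtain j where j: "j \<in> {i..<J i}" "x \<in> B j" by blast
      have "x \<notin> B j'" if "j' \<in> {i..<J i}" "j' \<noteq> j" for j'
        using B_disj[of j j' x] B_disj[of j' j x] that j by (cases j j' rule: linorder_cases) auto
      then have "(\<Sum>j=i..<J i. ennreal (e j) * indicator (B j) x) = (\<Sum>j\<in>{j}. ennreal (e j) * indicator (B j) x)"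
        using j by (intro sum.mono_neutral_right) auto
      also have "\<dots> = ennreal (e j)" using j by simp
      also have "\<dots> \<le> ennreal (\<phi> (\<bar>k x\<bar> / 2 ^ i))"
      proof (rule ennreal_leI)
        have "(1::real) * 1 \<le> 4 ^ i * real (Suc j)" by (intro mult_mono) auto
        moreover have "(4::real) ^ i * real (Suc j) \<le> 4 ^ i * real (J i)" using j by (intro mult_left_mono) auto
        ultimately have "e j \<le> \<phi> (s i / (4 ^ i * real (Suc j)))" unfolding e_def by (intro q) auto
        also have "\<dots> \<le> \<phi> (\<bar>k x\<bar> / 2 ^ i)"
        proof (intro mono)
          have "s i / (2 ^ i * real (Suc j)) \<le> \<bar>k x\<bar>" using x j by (force simp: B_def)
          then have "s i / (2 ^ i * real (Suc j)) / 2 ^ i \<le> \<bar>k x\<bar> / 2 ^ i" by (intro divide_right_mono) auto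
          moreover have "(4::real) ^ i = 2 ^ i * 2 ^ i" by (simp flip: power_mult_distrib)
          ultimately show "s i / (4 ^ i * real (Suc j)) \<le> \<bar>k x\<bar> / 2 ^ i" by (simp add: ac_simps)
        qed (use s in auto)
        finally show "e j \<le> \<phi> (\<bar>k x\<bar> / 2 ^ i)" .
      qed
      finally show ?thesis .
    qed (simp add: indicator_def sum.neutral)
  qed
  also note le
  finally have "(\<Sum>j=i..<J i. ennreal (e j) * emeasure unit_leb (B j)) \<le> 1" .
  moreover have "(\<Sum>j=i..<J i. ennreal (e j) * emeasure unit_leb (B j)) = ennreal (\<Sum>j=i..<J i. e j * measure unit_leb (B j))"
    using e0 by (subst sum_ennreal[symmetric]) (auto simp: unit_leb.emeasure_eq_measure ennreal_mult intro!: sum.cong)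
  ultimately have "(\<Sum>j=i..<J i. e j * measure unit_leb (B j)) \<le> 1" by simp
  moreover have "(\<Sum>j=i..<J i. e j * measure unit_leb (B j)) \<ge> (\<Sum>j=i..<J i. 1 / (8 * 4 ^ i) * (1 / real (Suc j)))"
  proof (rule sum_mono)
    fix j assume j: "j \<in> {i..<J i}"
    have "1 / (8 * 4 ^ i) * (1 / real (Suc j)) = (1 / 2) * (1 / (4 * 4 ^ i * real (Suc j)))" by simp
    also have "\<dots> \<le> (\<phi> (s i) / M i) * (1 / (4 * 4 ^ i * real (Suc j)))"
      using M(1,3)[of i] by (intro mult_right_mono) (auto simp: field_simps)
    also have "\<dots> = e j * (1 / (2 * M i))" by (simp add: e_def)
    also have "\<dots> \<le> e j * measure unit_leb (B j)" using Bm[OF j] e0 by (intro mult_left_mono) auto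
    finally show "1 / (8 * 4 ^ i) * (1 / real (Suc j)) \<le> e j * measure unit_leb (B j)" .
  qed
  moreover have "(\<Sum>j=i..<J i. 1 / (8 * 4 ^ i) * (1 / real (Suc j))) > 1 / (8 * 4 ^ i) * (16 * 4 ^ i)"
    unfolding sum_distrib_left[symmetric] using J(2)[of i] by (intro mult_strict_left_mono) auto
  ultimately show False by simp
qed

end

subsection \<open>Weak limits of truncations\<close>

lemma diagonal_convergent_subseq:
  fixes a :: "nat \<Rightarrow> nat \<Rightarrow> real"
  assumes bdd: "\<And>i. \<exists>B. \<forall>n. \<bar>a i n\<bar> \<le> B"
  shows "\<exists>s. strict_mono s \<and> (\<forall>i. convergent (\<lambda>n. a i (s n)))"
proof -
  interpret subseqs "\<lambda>i s. convergent (\<lambda>n. a i (s n))"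
  proof
    fix i and s :: "nat \<Rightarrow> nat" 
    obtain B where B: "\<And>n. \<bar>a i n\<bar> \<le> B" using bdd by blast
    then have "bounded (range (\<lambda>n. a i (s n)))" by (auto simp: bounded_iff)
    from bounded_imp_convergent_subsequence[OF this]
    obtain l r where "strict_mono r" "((\<lambda>n. a i (s n)) \<circ> r) \<longlonglongrightarrow> l" by blast
    then show "\<exists>r. strict_mono r \<and> convergent (\<lambda>n. a i ((s \<circ> r) n))"
      by (auto simp: convergent_def o_def)
  qed
  have "convergent (\<lambda>n. a i (diagseq n))" for i
  proof -
    have "convergent (\<lambda>n. a i ((diagseq \<circ> ((+) (Suc i))) n))"
    proof (rule diagseq_holds)
      fix r s :: "nat \<Rightarrow> nat" and n
      assume "strict_mono r" "convergent (\<lambda>k. a n (s k))"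
      then show "convergent (\<lambda>k. a n ((s \<circ> r) k))"
        using convergent_subseq_convergent[of "\<lambda>k. a n (s k)" r] by (simp add: o_def)
    qed
    then have "convergent (\<lambda>n. a i (diagseq (n + Suc i)))" by (simp add: o_def add.commute)
    then show ?thesis by (rule convergent_ignore_initial_segment[THEN iffD1, of "\<lambda>n. a i (diagseq n)"])
  qed
  then show ?thesis using subseq_diagseq by blast
qed

text \<open>Finite intersections of a countable basis, the empty one giving \<open>UNIV\<close>.
  Countability allows a diagonal argument over test sets, stability under intersections a Dynkin
  argument from them to all Borel sets.\<close>

lemma countable_Int_stable_generator_borel:
  obtains G :: "real set set" where "countable G" "Int_stable G" "UNIV \<in> G" "sets borel = sigma_sets UNIV G"
proof -
  obtain B :: "real set set" where B: "countable B" "topological_basis B" using ex_countable_basis by blast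
  define G where "G = Inter ` {F. F \<subseteq> B \<and> finite F}"
  have open_B: "open b" if "b \<in> B" for b using B(2) that by (rule topological_basis_open)
  have "sets borel = sigma_sets UNIV {S::real set. open S}" by (simp add: borel_def)
  also have "\<dots> = sigma_sets UNIV G"
  proof (rule sigma_sets_eqI)
    fix S :: "real set" assume "S \<in> {S. open S}"
    then obtain B' where B': "B' \<subseteq> B" "S = \<Union>B'" using B(2) by (auto simp: topological_basis_def)
    have "b \<in> sigma_sets UNIV G" if "b \<in> B'" for b
      using that B'(1) by (intro sigma_sets.Basic) (auto simp: G_def intro!: image_eqI[of _ _ "{b}"])
    then show "S \<in> sigma_sets UNIV G"
      unfolding B' using B' B(1) countable_subset by (intro sigma_sets_UNION) auto
  next
    fix S assume "S \<in> G"
    then have "open S" using open_B by (auto simp: G_def intro!: open_Inter)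
    then show "S \<in> sigma_sets UNIV {S. open S}" by (intro sigma_sets.Basic) auto
  qed
  finally have "sets borel = sigma_sets UNIV G" .
  moreover have "countable G" unfolding G_def using countable_Collect_finite_subset[OF B(1)]
    by (intro countable_image) (simp add: conj_commute)
  moreover have "Int_stable G"
  proof (rule Int_stableI)
    fix S T assume "S \<in> G" "T \<in> G"
    then obtain E F where "S = \<Inter>E" "E \<subseteq> B" "finite E" "T = \<Inter>F" "F \<subseteq> B" "finite F" by (auto simp: G_def)
    then show "S \<inter> T \<in> G" by (auto simp: G_def intro!: image_eqI[of _ _ "E \<union> F"])
  qed
  moreover have "UNIV \<in> G" by (auto simp: G_def intro!: image_eqI[of _ _ "{}"])
  ultimately show ?thesis by (intro that)
qed

lemma set_integrable_unit_leb:
  fixes g :: "real \<Rightarrow> real"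
  assumes "g \<in> borel_measurable unit_leb" "\<And>x. \<bar>g x\<bar> \<le> K" "A \<in> sets unit_leb"
  shows "set_integrable unit_leb A g"
  unfolding set_integrable_def
  by (rule unit_leb_integrable_bounded[of _ "\<bar>K\<bar>"]) 
    (use assms order_trans[OF assms(2) abs_ge_self] in \<open>auto simp: indicator_def\<close>)

lemma set_integral_unit_leb_bounds:
  fixes g :: "real \<Rightarrow> real"
  assumes g: "g \<in> borel_measurable unit_leb" "\<And>x. 0 \<le> g x" "\<And>x. g x \<le> K" and A: "A \<in> sets unit_leb"
  shows "0 \<le> (LINT x:A|unit_leb. g x)" "(LINT x:A|unit_leb. g x) \<le> K * measure unit_leb A"
proof -
  show "0 \<le> (LINT x:A|unit_leb. g x)"
    unfolding set_lebesgue_integral_def using g by (intro integral_nonneg_AE) auto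
  have "(LINT x:A|unit_leb. g x) \<le> (LINT x:A|unit_leb. K)"
    using g A by (intro set_integral_mono set_integrable_unit_leb[of _ "\<bar>K\<bar>"]) (auto simp: abs_le_iff intro: order_trans[of _ K])
  also have "\<dots> = K * measure unit_leb A"
    using sets.sets_into_space[OF A] by (simp add: set_lebesgue_integral_def Int_absorb2 mult.commute)
  finally show "(LINT x:A|unit_leb. g x) \<le> K * measure unit_leb A" .
qed

text \<open>Countable additivity passes to the limit by dominated convergence of series: the uniform
  bound \<open>K\<close> gives the summable majorant K times the measure of
  \<open>A i\<close>.\<close>

lemma set_integral_Union_tendsto:
  fixes g :: "nat \<Rightarrow> real \<Rightarrow> real"
  assumes g: "\<And>n. g n \<in> borel_measurable unit_leb" "\<And>n x. 0 \<le> g n x" "\<And>n x. g n x \<le> K"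
    and A: "range A \<subseteq> sets unit_leb" "disjoint_family A"
    and lim: "\<And>i::nat. (\<lambda>n. LINT x:A i|unit_leb. g n x) \<longlonglongrightarrow> b i"
  shows "summable b" "(\<lambda>n. LINT x:(\<Union>i. A i)|unit_leb. g n x) \<longlonglongrightarrow> suminf b"
proof -
  have Ai: "A i \<in> sets unit_leb" for i using A by auto
  have K: "K \<ge> 0" using g(2,3)[of 0 0] by linarith
  have bnd: "norm (LINT x:A i|unit_leb. g n x) \<le> K * measure unit_leb (A i)" for i n
    using set_integral_unit_leb_bounds[OF g(1) g(2) g(3) Ai[of i], of n] by simp
  have 1: "summable (\<lambda>i. K * measure unit_leb (A i))"
    using unit_leb.finite_measure_UNION[OF A] by (intro summable_mult) (auto simp: sums_iff)
  have 2: "(LINT x:(\<Union>i. A i)|unit_leb. g n x) = (\<Sum>i. LINT x:A i|unit_leb. g n x)" for n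
    using A g by (intro lebesgue_integral_countable_add set_integrable_unit_leb[of _ K])
      (auto simp: disjoint_family_on_def intro!: sets.countable_UN)
  have "((\<lambda>n. \<Sum>i. LINT x:A i|unit_leb. g n x) \<longlongrightarrow> suminf b) sequentially \<and> summable (\<lambda>n. norm (b n))"
  proof -
    have "\<forall>\<^sub>F (i, n) in sequentially \<times>\<^sub>F sequentially. norm (LINT x:A i|unit_leb. g n x) \<le> K * measure unit_leb (A i)"
      by (intro always_eventually) (use bnd in auto)
    from tannerys_theorem[of "\<lambda>i n. LINT x:A i|unit_leb. g n x" b sequentially, OF lim this 1] show ?thesis by simp
  qed
  then show "summable b" "(\<lambda>n. LINT x:(\<Union>i. A i)|unit_leb. g n x) \<longlonglongrightarrow> suminf b"
    using 2 by (auto intro: summable_rabs_cancel)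
qed

text \<open>The sets with convergent integrals form a Dynkin system: complements use convergence on
  [0,1] itself, disjoint unions the limit theorem for series. A Lebesgue set differs from a Borel
  set only within a null set.\<close>

lemma convergent_set_integrals:
  fixes g :: "nat \<Rightarrow> real \<Rightarrow> real"
  assumes g: "\<And>n. g n \<in> borel_measurable unit_leb" "\<And>n x. 0 \<le> g n x" "\<And>n x. g n x \<le> K"
    and G: "Int_stable G" "UNIV \<in> G" "sets borel = sigma_sets UNIV G"
    and conv: "\<And>A. A \<in> G \<Longrightarrow> convergent (\<lambda>n. LINT x:(A \<inter> {0..1})|unit_leb. g n x)"
    and A: "A \<in> sets unit_leb"
  shows "convergent (\<lambda>n. LINT x:A|unit_leb. g n x)"
proof -
  have unit: "S \<inter> {0..1} \<in> sets unit_leb" if "S \<in> sets borel" for S :: "real set"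
    using that by (auto simp: sets_restrict_space_iff)
  have G_sub: "G \<subseteq> Pow UNIV" by simp
  have borel: "convergent (\<lambda>n. LINT x:(S \<inter> {0..1})|unit_leb. g n x)" if "S \<in> sets borel" for S
    using G(1) G_sub that[unfolded G(3)]
  proof (induction rule: sigma_sets_induct_disjoint)
    case (basic A)
    then show ?case by (rule conv)
  next
    case empty
    then show ?case by (simp add: set_lebesgue_integral_def convergent_const)
  next
    case (compl A)
    have [measurable]: "A \<in> sets borel" using compl G(3) by simp
    have "(LINT x:(UNIV \<inter> {0..1})|unit_leb. g n x) = 
      (LINT x:((A \<inter> {0..1}) \<union> ((UNIV - A) \<inter> {0..1}))|unit_leb. g n x)" for n
      by (intro arg_cong[of _ _ "\<lambda>S. set_lebesgue_integral unit_leb S (g n)"]) auto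
    also have "(LINT x:((A \<inter> {0..1}) \<union> ((UNIV - A) \<inter> {0..1}))|unit_leb. g n x) = 
      (LINT x:(A \<inter> {0..1})|unit_leb. g n x) + (LINT x:((UNIV - A) \<inter> {0..1})|unit_leb. g n x)" for n
      using g by (intro set_integral_Un set_integrable_unit_leb[of _ K] unit) auto
    finally have "(LINT x:((UNIV - A) \<inter> {0..1})|unit_leb. g n x) = 
       (LINT x:(UNIV \<inter> {0..1})|unit_leb. g n x) - (LINT x:(A \<inter> {0..1})|unit_leb. g n x)" for n by simp
    then show ?case using convergent_diff[OF conv[OF G(2)] compl(2)] by simp
  next
    case (union A)
    have Ab: "A i \<in> sets borel" for i using union(2) G(3) by auto
    have "\<exists>b. \<forall>i. (\<lambda>n. LINT x:(A i \<inter> {0..1})|unit_leb. g n x) \<longlonglongrightarrow> b i"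
      using union(3) unfolding convergent_def by (intro choice allI) auto
    then obtain b where b: "\<And>i. (\<lambda>n. LINT x:(A i \<inter> {0..1})|unit_leb. g n x) \<longlonglongrightarrow> b i" by blast
    have "(\<lambda>n. LINT x:(\<Union>i. A i \<inter> {0..1})|unit_leb. g n x) \<longlonglongrightarrow> suminf b"
      using union(1) by (intro set_integral_Union_tendsto[OF g _ _ b]) (auto simp: disjoint_family_on_def intro!: unit Ab)
    moreover have "(\<Union>i. A i \<inter> {0..1}) = (\<Union>i. A i) \<inter> {0..1}" by auto
    ultimately show ?case by (auto simp: convergent_def)
  qed
  have "A \<in> sets lebesgue" "A \<subseteq> {0..1}" using A by (auto simp: sets_restrict_space_iff)
  from sets_completionE[OF this(1)] obtain S N N' where 
    S: "A = S \<union> N" "N \<subseteq> N'" "N' \<in> null_sets lborel" "S \<in> sets lborel" by blast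
  have N': "N' \<in> null_sets lebesgue" using S(3) by (rule null_sets_completionI)
  have "AE x in lebesgue. x \<notin> N'" using N' by (rule AE_not_in)
  then have ae: "AE x in unit_leb. x \<notin> N'" by (auto simp: AE_restrict_space_iff elim: eventually_mono)
  have "(LINT x:A|unit_leb. g n x) = (LINT x:(S \<inter> {0..1})|unit_leb. g n x)" for n
    unfolding set_lebesgue_integral_def
  proof (rule integral_cong_AE)
    show "AE x in unit_leb. indicator A x *\<^sub>R g n x = indicator (S \<inter> {0..1}) x *\<^sub>R g n x"
      using ae by eventually_elim (use S \<open>A \<subseteq> {0..1}\<close> in \<open>auto simp: indicator_def\<close>)
    show "(\<lambda>x. indicator A x *\<^sub>R g n x) \<in> borel_measurable unit_leb"
      using g(1)[of n] A by measurable
    show "(\<lambda>x. indicator (S \<inter> {0..1}) x *\<^sub>R g n x) \<in> borel_measurable unit_leb"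
      using S(4) by (intro borel_measurable_scaleR borel_measurable_indicator unit g(1)) auto
  qed
  then show ?thesis using borel[of S] S(4) by simp
qed

text \<open>\<open>h\<close> is rounded down to the grid of mesh \<epsilon>; by boundedness only
  finitely many levels occur.\<close>

lemma simple_uniform_approx:
  fixes h :: "'a \<Rightarrow> real"
  assumes h: "h \<in> borel_measurable M" "\<And>x. \<bar>h x\<bar> \<le> B" and \<epsilon>: "\<epsilon> > 0"
  obtains I :: "int set" and S c where "finite I" "\<And>i. i \<in> I \<Longrightarrow> S i \<in> sets M" 
    "\<And>x. x \<in> space M \<Longrightarrow> \<bar>h x - (\<Sum>i\<in>I. c i * indicator (S i) x)\<bar> \<le> \<epsilon>"
proof -
  define m where "m = \<lceil>B / \<epsilon>\<rceil> + 1"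
  define S where "S = (\<lambda>i::int. {x \<in> space M. \<lfloor>h x / \<epsilon>\<rfloor> = i})"
  have Sm: "S i \<in> sets M" for i unfolding S_def using h(1) by measurable
  have "\<bar>h x - (\<Sum>i\<in>{-m..m}. (of_int i * \<epsilon>) * indicator (S i) x)\<bar> \<le> \<epsilon>" if x: "x \<in> space M" for x
  proof -
    define k where "k = \<lfloor>h x / \<epsilon>\<rfloor>"
    have "- B \<le> h x" "h x \<le> B" using h(2)[of x] by linarith+
    then have "- (B / \<epsilon>) \<le> h x / \<epsilon>" "h x / \<epsilon> \<le> B / \<epsilon>" 
      using \<epsilon> by (simp_all add: field_simps)
    moreover have "real_of_int k \<le> h x / \<epsilon>" "h x / \<epsilon> \<le> real_of_int k + 1" "B / \<epsilon> \<le> real_of_int \<lceil>B / \<epsilon>\<rceil>"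
      unfolding k_def by linarith+
    ultimately have "real_of_int (- m) \<le> real_of_int k" "real_of_int k \<le> real_of_int m"
      unfolding m_def of_int_minus of_int_add of_int_1 by linarith+
    then have k: "k \<in> {-m..m}" by (simp only: of_int_le_iff atLeastAtMost_iff)
    have "(\<Sum>i\<in>{-m..m}. (of_int i * \<epsilon>) * indicator (S i) x) = (\<Sum>i\<in>{-m..m}. if i = k then of_int i * \<epsilon> else 0)"
      using x by (intro sum.cong) (auto simp: S_def k_def indicator_def)
    also have "\<dots> = of_int k * \<epsilon>" using k by simp
    finally have eq: "(\<Sum>i\<in>{-m..m}. (of_int i * \<epsilon>) * indicator (S i) x) = of_int k * \<epsilon>" .
    have "of_int k \<le> h x / \<epsilon>" "h x / \<epsilon> \<le> of_int k + 1" unfolding k_def by linarith+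
    then have "of_int k * \<epsilon> \<le> h x" "h x \<le> (of_int k + 1) * \<epsilon>" using \<epsilon> by (simp_all add: field_simps)
    then show ?thesis unfolding eq by (simp add: algebra_simps)
  qed
  then show ?thesis using Sm by (intro that[of "{-m..m}" S "\<lambda>i. of_int i * \<epsilon>"]) auto
qed

text \<open>The limits of the set integrals form a measure \<nu> with \<nu>(A) at most
  \<open>K\<close> times the measure of \<open>A\<close>, and its Radon-Nikodym density is the weak
  limit. Convergence against indicators extends to bounded \<open>h\<close> by uniform
  approximation, since all functions involved lie between 0 and \<open>K\<close>.\<close>

lemma weak_limit_of_convergent:
  fixes g :: "nat \<Rightarrow> real \<Rightarrow> real"
  assumes g: "\<And>n. g n \<in> borel_measurable unit_leb" "\<And>n x. 0 \<le> g n x" "\<And>n x. g n x \<le> K"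
    and conv: "\<And>A. A \<in> sets unit_leb \<Longrightarrow> convergent (\<lambda>n. LINT x:A|unit_leb. g n x)"
  shows "\<exists>G. G \<in> borel_measurable unit_leb \<and> (\<forall>x. 0 \<le> G x) \<and> (\<forall>x. G x \<le> K) \<and>
    (\<forall>h B. h \<in> borel_measurable unit_leb \<longrightarrow> (\<forall>x. \<bar>h x\<bar> \<le> B) \<longrightarrow>
       (\<lambda>n. \<integral>x. g n x * h x \<partial>unit_leb) \<longlonglongrightarrow> (\<integral>x. G x * h x \<partial>unit_leb))"
proof -
  note [measurable] = g(1)
  have K: "K \<ge> 0" using g(2,3)[of 0 0] by linarith
  define \<nu> where "\<nu> = (\<lambda>A. lim (\<lambda>n. LINT x:A|unit_leb. g n x))"
  have lim: "(\<lambda>n. LINT x:A|unit_leb. g n x) \<longlonglongrightarrow> \<nu> A" if "A \<in> sets unit_leb" for A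
    using conv[OF that] by (simp add: \<nu>_def convergent_LIMSEQ_iff)
  have \<nu>: "0 \<le> \<nu> A" "\<nu> A \<le> K * measure unit_leb A" if "A \<in> sets unit_leb" for A
    using lim[OF that] set_integral_unit_leb_bounds[OF g that] 
    by (auto intro: LIMSEQ_le_const LIMSEQ_le_const2)
  define N where "N = measure_of {0..1} (sets unit_leb) (\<lambda>A. ennreal (\<nu> A))"
  have sets_sub: "sets unit_leb \<subseteq> Pow {0..1}" using sets.space_closed[of unit_leb] by simp
  have alg: "sigma_algebra {0..1} (sets unit_leb)" using sets.sigma_algebra_axioms[of unit_leb] by simp
  have sets_N: "sets N = sets unit_leb"
    unfolding N_def using sets_sub sigma_algebra.sigma_sets_eq[OF alg] by simp
  have em_N: "emeasure N A = ennreal (\<nu> A)" if A: "A \<in> sets unit_leb" for A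
  proof (rule emeasure_measure_of[OF N_def])
    show "positive (sets N) (\<lambda>A. ennreal (\<nu> A))" 
      using lim[of "{}"] by (simp add: positive_def set_lebesgue_integral_def LIMSEQ_const_iff)
    show "countably_additive (sets N) (\<lambda>A. ennreal (\<nu> A))"
    proof (rule countably_additiveI)
      fix A :: "nat \<Rightarrow> real set" assume A: "range A \<subseteq> sets N" "disjoint_family A"
      have Ai: "A i \<in> sets unit_leb" for i using A(1) sets_N by auto
      have U: "(\<Union>i. A i) \<in> sets unit_leb" using Ai by auto
      have r: "range A \<subseteq> sets unit_leb" using Ai by blast
      have s: "summable (\<lambda>i. \<nu> (A i))" "(\<lambda>n. LINT x:(\<Union>i. A i)|unit_leb. g n x) \<longlonglongrightarrow> (\<Sum>i. \<nu> (A i))"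
        using set_integral_Union_tendsto[where g = g and b = "\<lambda>i. \<nu> (A i)", OF g r A(2)] lim[OF Ai] by auto
      have "\<nu> (\<Union>i. A i) = (\<Sum>i. \<nu> (A i))" using LIMSEQ_unique[OF lim[OF U] s(2)] .
      then show "(\<Sum>i. ennreal (\<nu> (A i))) = ennreal (\<nu> (\<Union>i. A i))"
        using s(1) \<nu>(1)[OF Ai] by (simp add: suminf_ennreal2)
    qed
  qed (use A sets_sub sets_N in auto)
  have "absolutely_continuous unit_leb N"
    unfolding absolutely_continuous_def
  proof
    fix A assume "A \<in> null_sets unit_leb"
    then have A: "A \<in> sets unit_leb" "measure unit_leb A = 0" by (auto simp: null_sets_def measure_def)
    then have "\<nu> A = 0" using \<nu>[OF A(1)] by simp
    then show "A \<in> null_sets N" using A em_N sets_N by (auto simp: null_sets_def)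
  qed
  from unit_leb.Radon_Nikodym[OF this sets_N] obtain f where 
    f [measurable]: "f \<in> borel_measurable unit_leb" and dens: "density unit_leb f = N" by blast
  have f_int: "(\<integral>\<^sup>+x. f x * indicator A x \<partial>unit_leb) = ennreal (\<nu> A)" if "A \<in> sets unit_leb" for A
    using that em_N[OF that] by (simp add: dens[symmetric] emeasure_density)
  have f_le: "AE x in unit_leb. f x \<le> ennreal K"
  proof -
    define E where "E = (\<lambda>m::nat. {x \<in> space unit_leb. ennreal (K + 1 / Suc m) \<le> f x})"
    have [measurable]: "E m \<in> sets unit_leb" for m unfolding E_def by measurable
    have "AE x in unit_leb. x \<notin> E m" for m
    proof -
      have "ennreal ((K + 1 / Suc m) * measure unit_leb (E m)) = (\<integral>\<^sup>+x. ennreal (K + 1 / Suc m) * indicator (E m) x \<partial>unit_leb)"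
        using K by (simp add: nn_integral_cmult_indicator unit_leb.emeasure_eq_measure ennreal_mult)
      also have "\<dots> \<le> (\<integral>\<^sup>+x. f x * indicator (E m) x \<partial>unit_leb)"
        by (intro nn_integral_mono) (auto simp: E_def indicator_def)
      also have "\<dots> = ennreal (\<nu> (E m))" by (rule f_int) auto
      also have "\<dots> \<le> ennreal (K * measure unit_leb (E m))" using \<nu>(2)[of "E m"] by (intro ennreal_leI) auto
      finally have "(K + 1 / Suc m) * measure unit_leb (E m) \<le> K * measure unit_leb (E m)" 
        using K by (simp add: ennreal_le_iff)
      then have "(1 / Suc m) * measure unit_leb (E m) \<le> 0" by (simp add: algebra_simps)
      then have "measure unit_leb (E m) \<le> 0" by (simp add: divide_le_0_iff)
      then have "measure unit_leb (E m) = 0" using measure_nonneg[of unit_leb "E m"] by linarith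
      then have "E m \<in> null_sets unit_leb" by (simp add: null_sets_def unit_leb.emeasure_eq_measure)
      then show ?thesis by (rule AE_not_in)
    qed
    then have "AE x in unit_leb. \<forall>m. x \<notin> E m" by (simp add: AE_all_countable)
    then show ?thesis using AE_space
    proof eventually_elim
      fix x assume x: "\<forall>m. x \<notin> E m" "x \<in> space unit_leb"
      show "f x \<le> ennreal K"
      proof (rule ennreal_le_epsilon)
        fix e :: real assume "e > 0"
        then obtain m where m: "1 / real (Suc m) < e" using nat_approx_posE by blast
        have "f x \<le> ennreal (K + 1 / Suc m)" using x by (auto simp: E_def not_le intro: less_imp_le)
        also have "\<dots> \<le> ennreal (K + e)" using m by (intro ennreal_leI) auto
        also have "\<dots> = ennreal K + ennreal e" using K \<open>e > 0\<close> by simp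
        finally show "f x \<le> ennreal K + ennreal e" .
      qed
    qed
  qed
  \<comment> \<open>Cutting at \<open>K\<close> changes the density on a null set only and makes the
    bounds hold at every point.\<close>
  define G where "G = (\<lambda>x. min K (enn2real (f x)))"
  have Gm [measurable]: "G \<in> borel_measurable unit_leb" unfolding G_def by measurable
  have G: "0 \<le> G x" "G x \<le> K" for x using K by (auto simp: G_def)
  have G_f: "AE x in unit_leb. ennreal (G x) = f x"
    using f_le
  proof eventually_elim
    fix x assume x: "f x \<le> ennreal K"
    then have "f x < top" by (auto intro: order_le_less_trans)
    moreover have "enn2real (f x) \<le> K" using x K by (metis enn2real_mono enn2real_ennreal ennreal_less_top)
    ultimately show "ennreal (G x) = f x" by (simp add: G_def min_def)
  qed
  have G_int: "(LINT x:A|unit_leb. G x) = \<nu> A" if [measurable]: "A \<in> sets unit_leb" for A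
  proof -
    have "ennreal (LINT x:A|unit_leb. G x) = (\<integral>\<^sup>+x. ennreal (indicator A x *\<^sub>R G x) \<partial>unit_leb)"
      unfolding set_lebesgue_integral_def using set_integrable_unit_leb[of G K A] G
      by (intro nn_integral_eq_integral[symmetric]) (auto simp: set_integrable_def abs_le_iff intro: order_trans[of _ 0])
    also have "\<dots> = (\<integral>\<^sup>+x. f x * indicator A x \<partial>unit_leb)"
      using G_f by (intro nn_integral_cong_AE) (auto elim!: eventually_mono simp: indicator_def)
    also have "\<dots> = ennreal (\<nu> A)" by (rule f_int) fact
    finally show ?thesis using \<nu>(1)[OF that] set_integral_unit_leb_bounds(1)[OF Gm G that] by simp
  qed
  have weak: "(\<lambda>n. \<integral>x. g n x * h x \<partial>unit_leb) \<longlonglongrightarrow> (\<integral>x. G x * h x \<partial>unit_leb)"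
    if h [measurable]: "h \<in> borel_measurable unit_leb" and hB: "\<And>x. \<bar>h x\<bar> \<le> B" for h B
  proof (rule LIMSEQ_I)
    fix e :: real assume e: "e > 0"
    define \<epsilon> where "\<epsilon> = e / (4 * (K + 1))"
    have \<epsilon>: "\<epsilon> > 0" using e K by (simp add: \<epsilon>_def)
    obtain I :: "int set" and S c where S: "finite I" "\<And>i. i \<in> I \<Longrightarrow> S i \<in> sets unit_leb" 
      "\<And>x. x \<in> space unit_leb \<Longrightarrow> \<bar>h x - (\<Sum>i\<in>I. c i * indicator (S i) x)\<bar> \<le> \<epsilon>"
      using simple_uniform_approx[OF h hB \<epsilon>] by blast
    define u where "u = (\<lambda>x. \<Sum>i\<in>I. c i * indicator (S i) x :: real)"
    have um [measurable]: "u \<in> borel_measurable unit_leb" unfolding u_def using S(2) by measurable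
    have est: "\<bar>(\<integral>x. w x * h x \<partial>unit_leb) - (\<Sum>i\<in>I. c i * (LINT x:S i|unit_leb. w x))\<bar> \<le> e / 4"
      if w [measurable]: "w \<in> borel_measurable unit_leb" and w0: "\<And>x. 0 \<le> w x" "\<And>x. w x \<le> K" for w
    proof -
      have wh: "integrable unit_leb (\<lambda>x. w x * h x)"
        by (rule unit_leb_integrable_bounded[of _ "K * B"]) (use w0 hB K in \<open>auto simp: abs_mult intro!: mult_mono\<close>)
      have wS: "integrable unit_leb (\<lambda>x. indicator (S i) x *\<^sub>R w x)" if "i \<in> I" for i
        using set_integrable_unit_leb[OF w, of K "S i"] w0 S(2)[OF that] 
        by (auto simp: set_integrable_def abs_le_iff intro: order_trans[of _ 0])
      have wu_eq: "w x * u x = (\<Sum>i\<in>I. c i * (indicator (S i) x *\<^sub>R w x))" for x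
        by (simp add: u_def sum_distrib_left ac_simps)
      have wu: "integrable unit_leb (\<lambda>x. w x * u x)"
        unfolding wu_eq using wS by (intro Bochner_Integration.integrable_sum integrable_mult_right)
      have "(\<integral>x. w x * u x \<partial>unit_leb) = (\<Sum>i\<in>I. c i * (LINT x:S i|unit_leb. w x))"
        unfolding wu_eq set_lebesgue_integral_def using wS 
        by (subst Bochner_Integration.integral_sum) auto
      then have "\<bar>(\<integral>x. w x * h x \<partial>unit_leb) - (\<Sum>i\<in>I. c i * (LINT x:S i|unit_leb. w x))\<bar> 
        = \<bar>\<integral>x. w x * h x - w x * u x \<partial>unit_leb\<bar>"
        using wh wu by simp
      also have "\<dots> \<le> (\<integral>x. \<bar>w x * h x - w x * u x\<bar> \<partial>unit_leb)" by (rule integral_abs_bound)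
      also have "\<dots> \<le> (\<integral>x. K * \<epsilon> \<partial>unit_leb)"
      proof (rule integral_mono)
        show "integrable unit_leb (\<lambda>x. \<bar>w x * h x - w x * u x\<bar>)" using wh wu by auto
        fix x assume "x \<in> space unit_leb"
        then have "\<bar>h x - u x\<bar> \<le> \<epsilon>" using S(3) by (simp add: u_def)
        then have "w x * \<bar>h x - u x\<bar> \<le> K * \<epsilon>" using w0[of x] K by (intro mult_mono) auto
        then show "\<bar>w x * h x - w x * u x\<bar> \<le> K * \<epsilon>" using w0[of x] by (simp add: abs_mult flip: right_diff_distrib)
      qed auto
      also have "\<dots> = K * \<epsilon>" by simp
      also have "\<dots> \<le> (K + 1) * \<epsilon>" using \<epsilon> by simp
      also have "\<dots> = e / 4" using K by (simp add: \<epsilon>_def field_simps)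
      finally show ?thesis .
    qed
    have "(\<lambda>n. \<Sum>i\<in>I. c i * (LINT x:S i|unit_leb. g n x)) \<longlonglongrightarrow> (\<Sum>i\<in>I. c i * (LINT x:S i|unit_leb. G x))"
      using lim S(2) by (intro tendsto_sum tendsto_mult tendsto_const) (auto simp: G_int)
    from LIMSEQ_D[OF this, of "e / 4"] obtain n0 where n0: "\<And>n. n \<ge> n0 \<Longrightarrow>
       \<bar>(\<Sum>i\<in>I. c i * (LINT x:S i|unit_leb. g n x)) - (\<Sum>i\<in>I. c i * (LINT x:S i|unit_leb. G x))\<bar> < e / 4"
      using e by auto
    show "\<exists>no. \<forall>n\<ge>no. norm ((\<integral>x. g n x * h x \<partial>unit_leb) - (\<integral>x. G x * h x \<partial>unit_leb)) < e"
    proof (intro exI allI impI)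
      fix n assume "n \<ge> n0"
      from n0[OF this] est[OF g(1) g(2) g(3), of n] est[OF Gm G]
      show "norm ((\<integral>x. g n x * h x \<partial>unit_leb) - (\<integral>x. G x * h x \<partial>unit_leb)) < e"
        unfolding real_norm_def using e by linarith
    qed
  qed
  show ?thesis
  proof (intro exI conjI allI impI)
    fix h :: "real \<Rightarrow> real" and B :: real assume "h \<in> borel_measurable unit_leb" "\<forall>x. \<bar>h x\<bar> \<le> B"
    then show "(\<lambda>n. \<integral>x. g n x * h x \<partial>unit_leb) \<longlonglongrightarrow> (\<integral>x. G x * h x \<partial>unit_leb)" by (intro weak) auto
  qed (fact Gm G)+
qed

text \<open>For each fixed height \<open>k\<close>, \<open>F k\<close> is the weak L^1 limit of the
  truncations at \<open>k\<close>. The bounds on it are required at every point, which keeps later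
  pointwise arguments free of exceptional sets.\<close>

definition truncation_limits :: "(nat \<Rightarrow> real \<Rightarrow> real) \<Rightarrow> (nat \<Rightarrow> real \<Rightarrow> real) \<Rightarrow> bool" where
  "truncation_limits f F \<longleftrightarrow> (\<forall>k. F k \<in> borel_measurable unit_leb) \<and> (\<forall>k x. 0 \<le> F k x \<and> F k x \<le> real k) \<and>
    (\<forall>k h B. h \<in> borel_measurable unit_leb \<longrightarrow> (\<forall>x. \<bar>h x\<bar> \<le> B) \<longrightarrow>
       (\<lambda>n. \<integral>x. min (f n x) (real k) * h x \<partial>unit_leb) \<longlonglongrightarrow> (\<integral>x. F k x * h x \<partial>unit_leb))"

lemma truncation_limitsD:
  assumes "truncation_limits f F"
  shows "F k \<in> borel_measurable unit_leb" "0 \<le> F k x" "F k x \<le> real k"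
    "h \<in> borel_measurable unit_leb \<Longrightarrow> (\<And>x. \<bar>h x\<bar> \<le> B) \<Longrightarrow>
       (\<lambda>n. \<integral>x. min (f n x) (real k) * h x \<partial>unit_leb) \<longlonglongrightarrow> (\<integral>x. F k x * h x \<partial>unit_leb)"
  using assms unfolding truncation_limits_def by blast+

text \<open>A single diagonal subsequence serves all pairs of a height and a test set, of which
  there are countably many.\<close>

lemma ex_weak_limits_of_truncations:
  fixes f :: "nat \<Rightarrow> real \<Rightarrow> real"
  assumes f: "\<And>n. f n \<in> borel_measurable unit_leb" "\<And>n x. 0 \<le> f n x"
  shows "\<exists>s F. strict_mono s \<and> truncation_limits (\<lambda>n. f (s n)) F"
proof -
  note [measurable] = f(1)
  obtain G :: "real set set" where G: "countable G" "Int_stable G" "UNIV \<in> G" "sets borel = sigma_sets UNIV G"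
    by (rule countable_Int_stable_generator_borel)
  have Gu: "A \<inter> {0..1} \<in> sets unit_leb" if "A \<in> G" for A
  proof -
    have "A \<in> sets borel" using that G(4) by (simp add: sigma_sets.Basic)
    then show ?thesis by (auto simp: sets_restrict_space_iff)
  qed
  define P where "P = (UNIV :: nat set) \<times> G"
  have P: "countable P" "P \<noteq> {}" using G by (auto simp: P_def)
  define a where "a = (\<lambda>i n. LINT x:(snd (from_nat_into P i) \<inter> {0..1})|unit_leb. min (f n x) (fst (from_nat_into P i)))"
  have "\<exists>B. \<forall>n. \<bar>a i n\<bar> \<le> B" for i
  proof -
    obtain k A where kA: "from_nat_into P i = (k, A)" "A \<in> G" using from_nat_into[OF P(2), of i] by (auto simp: P_def)
    have "\<bar>a i n\<bar> \<le> real k * measure unit_leb (A \<inter> {0..1})" for n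
      using set_integral_unit_leb_bounds[of "\<lambda>x. min (f n x) (real k)" "real k" "A \<inter> {0..1}"] f(2) Gu[OF kA(2)]
      by (simp add: a_def kA)
    then show ?thesis by blast
  qed
  from diagonal_convergent_subseq[of a, OF this] obtain s where s: "strict_mono s" "\<And>i. convergent (\<lambda>n. a i (s n))"
    by blast
  have conv: "convergent (\<lambda>n. LINT x:(A \<inter> {0..1})|unit_leb. min (f (s n) x) (real k))" if "A \<in> G" for A k
  proof -
    have "(k, A) \<in> P" using that by (simp add: P_def)
    then obtain i where "from_nat_into P i = (k, A)" using from_nat_into_surj[OF P(1)] by blast
    then show ?thesis using s(2)[of i] by (simp add: a_def)
  qed
  define W where "W = (\<lambda>(k::nat) F. F \<in> borel_measurable unit_leb \<and> (\<forall>x. 0 \<le> F x) \<and> (\<forall>x. F x \<le> real k) \<and>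
    (\<forall>h B. h \<in> borel_measurable unit_leb \<longrightarrow> (\<forall>x. \<bar>h x\<bar> \<le> B) \<longrightarrow>
       (\<lambda>n. \<integral>x. min (f (s n) x) k * h x \<partial>unit_leb) \<longlonglongrightarrow> (\<integral>x. F x * h x \<partial>unit_leb)))"
  have "\<exists>F. W k F" for k :: nat
  proof -
    have m: "(\<lambda>x. min (f (s n) x) (real k)) \<in> borel_measurable unit_leb" for n by measurable
    have b: "0 \<le> min (f (s n) x) (real k)" "min (f (s n) x) (real k) \<le> real k" for n x using f(2) by auto
    have "convergent (\<lambda>n. LINT x:A|unit_leb. min (f (s n) x) (real k))" if "A \<in> sets unit_leb" for A
      by (rule convergent_set_integrals[OF m b G(2,3,4) conv that])
    then show ?thesis unfolding W_def by (rule weak_limit_of_convergent[OF m b])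
  qed
  then have "\<forall>k. \<exists>F. W k F" by blast
  from choice[OF this] obtain F where F: "\<And>k. W k (F k)" by blast
  have "truncation_limits (\<lambda>n. f (s n)) F"
    unfolding truncation_limits_def
  proof (intro allI conjI)
    fix k
    show "F k \<in> borel_measurable unit_leb" using F[of k] by (simp add: W_def)
  next
    fix k x
    show "0 \<le> F k x" "F k x \<le> real k" using F[of k] by (simp_all add: W_def)
  next
    fix k h B
    show "h \<in> borel_measurable unit_leb \<longrightarrow> (\<forall>x. \<bar>h x\<bar> \<le> B) \<longrightarrow>
       (\<lambda>n. \<integral>x. min (f (s n) x) (real k) * h x \<partial>unit_leb) \<longlonglongrightarrow> (\<integral>x. F k x * h x \<partial>unit_leb)"
      using F[of k] unfolding W_def by blast
  qed
  then show ?thesis using s(1) by blast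
qed

subsection \<open>Almost everywhere convergence of Cesaro means\<close>

lemma tendsto_mean:
  fixes x :: "nat \<Rightarrow> real"
  assumes "x \<longlonglongrightarrow> L"
  shows "(\<lambda>m. (\<Sum>n<m. x n) / m) \<longlonglongrightarrow> L"
proof (rule LIMSEQ_I)
  fix e :: real assume e: "e > 0"
  then have "e / 2 > 0" by simp
  from LIMSEQ_D[OF assms this] obtain n0 where n0: "\<And>n. n \<ge> n0 \<Longrightarrow> \<bar>x n - L\<bar> < e / 2" by auto
  define C where "C = (\<Sum>n<n0. \<bar>x n - L\<bar>)"
  have C: "C \<ge> 0" by (auto simp: C_def intro: sum_nonneg)
  obtain M :: nat where M: "real M > 2 * C / e" using reals_Archimedean2 by blast
  show "\<exists>no. \<forall>m\<ge>no. norm ((\<Sum>n<m. x n) / m - L) < e"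
  proof (intro exI allI impI)
    fix m assume m: "m \<ge> max (Suc n0) (Suc M)"
    then have m0: "real m > 0" by simp
    have "(\<Sum>n<m. x n) - m * L = (\<Sum>n<m. x n - L)" by (simp add: sum_subtractf)
    also have "\<bar>\<dots>\<bar> \<le> (\<Sum>n<m. \<bar>x n - L\<bar>)" by (rule sum_abs)
    also have "\<dots> \<le> (\<Sum>n<m. (if n < n0 then \<bar>x n - L\<bar> else 0) + e / 2)"
      using n0 e by (intro sum_mono) (auto simp: not_less less_imp_le)
    also have "\<dots> = (\<Sum>n<m. if n < n0 then \<bar>x n - L\<bar> else 0) + m * (e / 2)" by (simp add: sum.distrib)
    also have "(\<Sum>n<m. if n < n0 then \<bar>x n - L\<bar> else 0) = C"
      unfolding C_def using m by (intro sum.mono_neutral_cong_right) auto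
    finally have 1: "\<bar>(\<Sum>n<m. x n) - m * L\<bar> \<le> C + m * (e / 2)" .
    have "real m > 2 * C / e" using m M by simp
    then have "C < m * (e / 2)" using e by (simp add: field_simps)
    with 1 have "\<bar>(\<Sum>n<m. x n) - m * L\<bar> < m * e" by (simp add: field_simps)
    moreover have "(\<Sum>n<m. x n) / m - L = ((\<Sum>n<m. x n) - m * L) / m" using m0 by (simp add: field_simps)
    ultimately show "norm ((\<Sum>n<m. x n) / m - L) < e" using m0 by (simp add: field_simps)
  qed
qed

text \<open>
  Since the partial sums increase and consecutive terms of \<open>(i + 1)\<^sup>q\<close> have ratio tending to \<open>1\<close>,
  convergence along this subsequence suffices (Etemadi's device).
\<close>

lemma tendsto_mean_if_subseq:
  fixes a :: "nat \<Rightarrow> real"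
  assumes a: "\<And>n. 0 \<le> a n" and q: "q > 0"
    and lim: "(\<lambda>i. (\<Sum>n<Suc i ^ q. a n) / (Suc i ^ q)) \<longlonglongrightarrow> L"
  shows "(\<lambda>m. (\<Sum>n<m. a n) / m) \<longlonglongrightarrow> L"
proof -
  define S where "S = (\<lambda>m. \<Sum>n<m. a n)"
  have S_mono: "S i \<le> S j" if "i \<le> j" for i j
    unfolding S_def using that a by (intro sum_mono2) auto
  have S0: "S m \<ge> 0" for m unfolding S_def using a by (intro sum_nonneg) auto
  have "\<exists>i. Suc i ^ q \<le> m \<and> m < Suc (Suc i) ^ q" if m: "m \<ge> 1" for m
  proof -
    \<comment> \<open>\<open>i\<close> locates \<open>m\<close> between consecutive terms of the
      subsequence.\<close>
    define i where "i = (LEAST i. m < Suc (Suc i) ^ q)"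
    have "m < Suc (Suc m) ^ q" using q self_le_power[of "Suc (Suc m)" q] by linarith
    then have 1: "m < Suc (Suc i) ^ q" unfolding i_def by (rule LeastI)
    have "Suc i ^ q \<le> m"
    proof (cases i)
      case (Suc k)
      then have "k < (LEAST i. m < Suc (Suc i) ^ q)" by (simp add: i_def[symmetric])
      from not_less_Least[OF this] Suc show ?thesis by simp
    qed (use m in simp)
    then show ?thesis using 1 by blast
  qed
  then have "\<forall>m. \<exists>i. m \<ge> 1 \<longrightarrow> Suc i ^ q \<le> m \<and> m < Suc (Suc i) ^ q" by blast
  from choice[OF this] obtain \<iota> where \<iota>: "\<And>m. m \<ge> 1 \<Longrightarrow> Suc (\<iota> m) ^ q \<le> m" "\<And>m. m \<ge> 1 \<Longrightarrow> m < Suc (Suc (\<iota> m)) ^ q"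
    by blast
  have \<iota>_lim: "filterlim \<iota> at_top at_top"
    unfolding filterlim_at_top
  proof
    fix N
    show "\<forall>\<^sub>F m in at_top. N \<le> \<iota> m"
      using eventually_ge_at_top[of "max 1 (Suc N ^ q)"]
    proof eventually_elim
      case (elim m)
      then have m: "Suc N ^ q \<le> m" by simp
      moreover have "Suc N ^ q \<ge> 1" by simp
      ultimately have "m \<ge> 1" by linarith
      then have "Suc N ^ q < Suc (Suc (\<iota> m)) ^ q" using \<iota>(2)[of m] m by linarith
      then have "Suc N < Suc (Suc (\<iota> m))" using power_less_imp_less_base by blast
      then show ?case by simp
    qed
  qed
  \<comment> \<open>Moving \<open>m\<close> to an endpoint in the denominator costs a factor \<rho>,
    which tends to 1; monotone partial sums give the two sides of the sandwich.\<close>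
  define \<rho> where "\<rho> = (\<lambda>i. (real (Suc (Suc i)) / real (Suc i)) ^ q)"
  have "(\<lambda>i. real (Suc (Suc i)) / real (Suc i)) \<longlonglongrightarrow> 1"
  proof -
    have "real (Suc (Suc i)) / real (Suc i) = 1 + inverse (real (Suc i))" for i by (simp add: field_simps)
    then show ?thesis using tendsto_add[OF tendsto_const LIMSEQ_inverse_real_of_nat, of 1] by simp
  qed
  then have "\<rho> \<longlonglongrightarrow> 1 ^ q" unfolding \<rho>_def by (rule tendsto_power)
  then have \<rho>: "\<rho> \<longlonglongrightarrow> 1" by simp
  define T where "T = (\<lambda>i. S (Suc i ^ q) / (Suc i ^ q))"
  have T: "T \<longlonglongrightarrow> L" using lim by (simp add: T_def S_def)
  have up: "(\<lambda>i. T (Suc i) * \<rho> i) \<longlonglongrightarrow> L * 1" by (intro tendsto_mult LIMSEQ_Suc T \<rho>)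
  have lo: "(\<lambda>i. T i / \<rho> i) \<longlonglongrightarrow> L / 1" by (intro tendsto_divide T \<rho>) auto
  have "(\<lambda>m. S m / m) \<longlonglongrightarrow> L"
  proof (rule tendsto_sandwich)
    show "(\<lambda>m. T (\<iota> m) / \<rho> (\<iota> m)) \<longlonglongrightarrow> L" using filterlim_compose[OF lo \<iota>_lim] by simp
    show "(\<lambda>m. T (Suc (\<iota> m)) * \<rho> (\<iota> m)) \<longlonglongrightarrow> L" using filterlim_compose[OF up \<iota>_lim] by simp
    show "\<forall>\<^sub>F m in sequentially. S m / m \<le> T (Suc (\<iota> m)) * \<rho> (\<iota> m)"
      using eventually_ge_at_top[of 1]
    proof eventually_elim
      case (elim m)
      have "S m / m \<le> S (Suc (Suc (\<iota> m)) ^ q) / real (Suc (\<iota> m) ^ q)"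
        using \<iota>[OF elim] elim S0 by (intro frac_le S_mono) (auto simp del: power_Suc of_nat_power intro: zero_less_power)
      also have "\<dots> = T (Suc (\<iota> m)) * \<rho> (\<iota> m)"
        by (simp add: T_def \<rho>_def power_divide del: power_Suc)
      finally show ?case .
    qed
    show "\<forall>\<^sub>F m in sequentially. T (\<iota> m) / \<rho> (\<iota> m) \<le> S m / m"
      using eventually_ge_at_top[of 1]
    proof eventually_elim
      case (elim m)
      have "T (\<iota> m) / \<rho> (\<iota> m) = S (Suc (\<iota> m) ^ q) / real (Suc (Suc (\<iota> m)) ^ q)"
        by (simp add: T_def \<rho>_def power_divide del: power_Suc)
      also have "\<dots> \<le> S m / m"
        using \<iota>[OF elim] elim S0 by (intro frac_le S_mono) (auto simp del: power_Suc of_nat_power)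
      finally show ?case .
    qed
  qed
  then show ?thesis by (simp add: S_def)
qed

text \<open>Each condition holds for all large \<open>b\<close>, and a new index faces only the
  finitely many conditions imposed by its predecessors. Positions and chosen values are passed
  separately so that tolerances may depend on the position.\<close>

lemma strict_mono_selection:
  fixes Q :: "nat \<Rightarrow> nat \<Rightarrow> nat \<Rightarrow> nat \<Rightarrow> bool"
  assumes "\<And>i a j. \<forall>\<^sub>F b in sequentially. Q i a j b"
  shows "\<exists>r. strict_mono r \<and> (\<forall>i j. i < j \<longrightarrow> Q i (r i) j (r j))"
proof -
  have "\<exists>r. \<forall>j::nat. (\<forall>i<j. r i < r j \<and> Q i (r i) j (r j))"
  proof (rule dependent_wellorder_choice)
    fix j :: nat and r :: "nat \<Rightarrow> nat"
    have "\<forall>\<^sub>F b in sequentially. r i < b \<and> Q i (r i) j b" for i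
      using assms eventually_gt_at_top by (intro eventually_conj)
    then have "\<forall>\<^sub>F b in sequentially. \<forall>i\<in>{..<j}. r i < b \<and> Q i (r i) j b"
      by (intro eventually_ball_finite) auto
    then obtain b where "\<forall>i\<in>{..<j}. r i < b \<and> Q i (r i) j b"
      using eventually_happens'[OF sequentially_bot] by blast
    then show "\<exists>b. \<forall>i<j. r i < b \<and> Q i (r i) j b" by auto
  qed auto
  then obtain r where "\<And>i j. i < j \<Longrightarrow> r i < r j \<and> Q i (r i) j (r j)" by blast
  then show ?thesis by (intro exI[of _ r]) (auto simp: strict_mono_def)
qed

section \<open>Order convergence, and almost everywhere convergence by second moments\<close>

context orlicz
begin

text \<open>The regulating sequence is the tail supremum of |c m - g|. Domination bounds it by h +
  |g|, which places it in the space, and it decreases to 0 wherever \<open>c m\<close> converges to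
  \<open>g\<close>.\<close>

lemma order_converges_in_if_dominated:
  assumes cm: "\<And>m. c m \<in> borel_measurable unit_leb" and dom: "dominated_in (orlicz_space \<phi>) c"
    and g: "g \<in> orlicz_space \<phi>" and lim: "AE x in unit_leb. (\<lambda>m. c m x) \<longlonglongrightarrow> g x"
  shows "order_converges_in (orlicz_space \<phi>) c g"
proof -
  note [measurable] = cm space_measurable[OF g]
  obtain h where h: "h \<in> orlicz_space \<phi>" "\<And>n. AE x in unit_leb. \<bar>c n x\<bar> \<le> h x"
    using dom unfolding dominated_in_def ae_le_def by blast
  have hm [measurable]: "h \<in> borel_measurable unit_leb" by (rule space_measurable[OF h(1)])
  have h_all: "AE x in unit_leb. \<forall>n. \<bar>c n x\<bar> \<le> h x" using h(2) by (simp add: AE_all_countable)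
  define w where "w = (\<lambda>n x. enn2real (SUP m\<in>{n..}. ennreal \<bar>c m x - g x\<bar>))"
  have wm: "w n \<in> borel_measurable unit_leb" for n unfolding w_def by measurable
  have good: "AE x in unit_leb. (\<forall>n. \<bar>w n x\<bar> \<le> h x + \<bar>g x\<bar> \<and> w (Suc n) x \<le> w n x \<and> \<bar>c n x - g x\<bar> \<le> w n x) \<and> (\<lambda>n. w n x) \<longlonglongrightarrow> 0"
    using h_all lim
  proof eventually_elim
    fix x assume hx: "\<forall>n. \<bar>c n x\<bar> \<le> h x" and lx: "(\<lambda>m. c m x) \<longlonglongrightarrow> g x"
    define b where "b = h x + \<bar>g x\<bar>"
    have cb: "\<bar>c m x - g x\<bar> \<le> b" for m using hx[rule_format, of m] by (simp add: b_def)
    then have b0: "b \<ge> 0" by (meson abs_ge_zero order_trans)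
    have le: "(SUP m\<in>{n..}. ennreal \<bar>c m x - g x\<bar>) \<le> ennreal e" if "\<And>m. m \<ge> n \<Longrightarrow> \<bar>c m x - g x\<bar> \<le> e" for n e
      using that by (intro SUP_least ennreal_leI) auto
    have eq: "(SUP m\<in>{n..}. ennreal \<bar>c m x - g x\<bar>) = ennreal (w n x)" for n
      unfolding w_def using le[of n b] cb by (intro ennreal_enn2real[symmetric]) (auto intro: order_le_less_trans)
    have w0: "w n x \<ge> 0" for n by (simp add: w_def)
    have 1: "w n x \<le> e" if "\<And>m. m \<ge> n \<Longrightarrow> \<bar>c m x - g x\<bar> \<le> e" for n e
    proof -
      have "e \<ge> 0" using that[of n] by (meson abs_ge_zero order_refl order_trans)
      then show ?thesis using le[OF that] unfolding eq by (simp add: ennreal_le_iff)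
    qed
    have 2: "\<bar>c m x - g x\<bar> \<le> w n x" if "m \<ge> n" for m n
    proof -
      have "ennreal \<bar>c m x - g x\<bar> \<le> ennreal (w n x)" unfolding eq[symmetric] using that by (intro SUP_upper) auto
      then show ?thesis using w0 by (simp add: ennreal_le_iff)
    qed
    have "(\<lambda>n. w n x) \<longlonglongrightarrow> 0"
    proof (rule LIMSEQ_I)
      fix e :: real assume e: "e > 0"
      then have "e / 2 > 0" by simp
      from LIMSEQ_D[OF lx this] obtain n0 where n0: "\<And>m. m \<ge> n0 \<Longrightarrow> \<bar>c m x - g x\<bar> < e / 2" by auto
      have "w n x \<le> e / 2" if "n \<ge> n0" for n using n0 that by (intro 1) (auto intro: less_imp_le)
      then show "\<exists>no. \<forall>n\<ge>no. norm (w n x - 0) < e" using e w0 by (intro exI[of _ n0]) fastforce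
    qed
    moreover have "\<bar>w n x\<bar> \<le> h x + \<bar>g x\<bar>" for n using 1[of n b] cb w0[of n] by (simp add: b_def)
    moreover have "w (Suc n) x \<le> w n x" for n using 2 by (intro 1) auto
    moreover have "\<bar>c n x - g x\<bar> \<le> w n x" for n by (rule 2) simp
    ultimately show "(\<forall>n. \<bar>w n x\<bar> \<le> h x + \<bar>g x\<bar> \<and> w (Suc n) x \<le> w n x \<and> \<bar>c n x - g x\<bar> \<le> w n x) \<and> (\<lambda>n. w n x) \<longlonglongrightarrow> 0"
      by blast
  qed
  have gabs: "(\<lambda>x. \<bar>g x\<bar>) \<in> orlicz_space \<phi>" by (rule space_solid[OF _ g]) auto
  have wL: "w n \<in> orlicz_space \<phi>" for n
  proof (rule space_solid[OF wm space_add[OF h(1) gabs]])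
    show "AE x in unit_leb. \<bar>w n x\<bar> \<le> \<bar>h x + \<bar>g x\<bar>\<bar>"
      using good
    proof eventually_elim
      case (elim x)
      then have "\<bar>w n x\<bar> \<le> h x + \<bar>g x\<bar>" by blast
      then show ?case by linarith
    qed
  qed
  have "decreases_to_zero_in (orlicz_space \<phi>) w"
    unfolding decreases_to_zero_in_def ae_le_def
  proof (intro conjI allI ballI impI wL)
    fix n
    show "AE x in unit_leb. w (Suc n) x \<le> w n x" using good by eventually_elim blast
    show "AE x in unit_leb. 0 \<le> w n x" by (simp add: w_def)
  next
    fix k assume "\<forall>n. AE x in unit_leb. k x \<le> w n x"
    then have "AE x in unit_leb. \<forall>n. k x \<le> w n x" by (simp add: AE_all_countable)
    then show "AE x in unit_leb. k x \<le> 0"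
      using good by eventually_elim (auto intro: LIMSEQ_le_const)
  qed
  moreover have "AE x in unit_leb. \<bar>c n x - g x\<bar> \<le> w n x" for n
    using good by eventually_elim blast
  ultimately show ?thesis unfolding order_converges_in_def ae_le_def by blast
qed

text \<open>The first term of the regulating sequence together with |h| is a majorant.\<close>

lemma dominated_in_if_order_converges:
  assumes "order_converges_in (orlicz_space \<phi>) c h" "h \<in> orlicz_space \<phi>"
  shows "dominated_in (orlicz_space \<phi>) c"
proof -
  obtain g where g: "decreases_to_zero_in (orlicz_space \<phi>) g" "\<And>n. AE x in unit_leb. \<bar>c n x - h x\<bar> \<le> g n x"
    using assms(1) unfolding order_converges_in_def ae_le_def by blast
  have g': "g 0 \<in> orlicz_space \<phi>" "\<And>n. AE x in unit_leb. g (Suc n) x \<le> g n x" "AE x in unit_leb. 0 \<le> g 0 x"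
    using g(1) unfolding decreases_to_zero_in_def ae_le_def by blast+
  have hm [measurable]: "h \<in> borel_measurable unit_leb" by (rule space_measurable[OF assms(2)])
  have gn: "AE x in unit_leb. g n x \<le> g 0 x" for n
  proof (induction n)
    case (Suc n)
    then show ?case using g'(2)[of n] by eventually_elim linarith
  qed simp
  have habs: "(\<lambda>x. \<bar>h x\<bar>) \<in> orlicz_space \<phi>" by (rule space_solid[OF _ assms(2)]) auto
  have "AE x in unit_leb. \<bar>c n x\<bar> \<le> g 0 x + \<bar>h x\<bar>" for n
    using gn[of n] g(2)[of n] by eventually_elim linarith
  moreover have "AE x in unit_leb. 0 \<le> g 0 x + \<bar>h x\<bar>" using g'(3) by eventually_elim simp
  ultimately show ?thesis
    unfolding dominated_in_def ae_le_def by (intro bexI[OF _ space_add[OF g'(1) habs]] conjI allI)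
qed

lemma nn_integral_power_bound:
  assumes A: "\<And>t. 0 \<le> t \<Longrightarrow> t powr p \<le> A * (1 + \<phi> t)" "0 \<le> A"
    and [measurable]: "f \<in> borel_measurable unit_leb" and f: "\<And>x. 0 \<le> f x" "modular \<phi> f 1 \<le> 1"
  shows "(\<integral>\<^sup>+x. ennreal (f x powr p) \<partial>unit_leb) \<le> ennreal (2 * A)"
proof -
  have [measurable]: "(\<lambda>x. \<phi> (f x)) \<in> borel_measurable unit_leb" using measurable_comp[of f unit_leb] f by simp
  have "(\<integral>\<^sup>+x. ennreal (f x powr p) \<partial>unit_leb) \<le> (\<integral>\<^sup>+x. ennreal A * (1 + ennreal (\<phi> (f x))) \<partial>unit_leb)"
  proof (rule nn_integral_mono)
    fix x
    have "ennreal (f x powr p) \<le> ennreal (A * (1 + \<phi> (f x)))" using A f by (intro ennreal_leI) auto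
    also have "\<dots> = ennreal A * (1 + ennreal (\<phi> (f x)))" using A(2) nonneg[OF f(1)] by (simp add: ennreal_mult)
    finally show "ennreal (f x powr p) \<le> \<dots>" .
  qed
  also have "\<dots> = ennreal A * (1 + modular \<phi> f 1)"
    unfolding modular_def using f by (simp add: nn_integral_cmult nn_integral_add)
  also have "\<dots> \<le> ennreal A * (1 + 1)" using f by (intro mult_left_mono add_left_mono) auto
  also have "\<dots> = ennreal (2 * A)" using A(2) by (simp add: ennreal_mult mult.commute)
  finally show ?thesis .
qed

text \<open>Boundedness in L^p gives, by Chebyshev's inequality, measure at most 2 A n^(-p) for the
  set where f n > n. As p > 1 these measures are summable and the Borel-Cantelli lemma
  applies.\<close>

lemma AE_eventually_le:
  assumes n2: "nabla2 \<phi>" and fm: "\<And>n. f n \<in> borel_measurable unit_leb" and f: "\<And>n x. 0 \<le> f n x" "\<And>n. modular \<phi> (f n) 1 \<le> 1"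
  shows "AE x in unit_leb. \<forall>\<^sub>F n in sequentially. f n x \<le> real n"
proof -
  note [measurable] = fm
  obtain p A where p: "1 < p" "1 \<le> A" "\<And>t. 0 \<le> t \<Longrightarrow> t powr p \<le> A * (1 + \<phi> t)"
    by (rule nabla2E[OF n2]) (rule that)
  define E where "E = (\<lambda>n. {x \<in> space unit_leb. f (Suc n) x > real (Suc n)})"
  have [measurable]: "E n \<in> sets unit_leb" for n unfolding E_def by measurable
  have le: "measure unit_leb (E n) \<le> 2 * A * real (Suc n) powr - p" for n
  proof -
    have "ennreal (real (Suc n) powr p * measure unit_leb (E n)) = (\<integral>\<^sup>+x. ennreal (real (Suc n) powr p) * indicator (E n) x \<partial>unit_leb)"
      by (simp add: nn_integral_cmult_indicator unit_leb.emeasure_eq_measure ennreal_mult)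
    also have "\<dots> \<le> (\<integral>\<^sup>+x. ennreal (f (Suc n) x powr p) \<partial>unit_leb)"
      using p(1) by (intro nn_integral_mono) (auto simp: E_def indicator_def intro!: ennreal_leI powr_mono2)
    also have "\<dots> \<le> ennreal (2 * A)" using p f by (intro nn_integral_power_bound) auto
    finally have "real (Suc n) powr p * measure unit_leb (E n) \<le> 2 * A" using p(2) by (simp add: ennreal_le_iff)
    then have "(real (Suc n) powr p * measure unit_leb (E n)) * real (Suc n) powr - p \<le> 2 * A * real (Suc n) powr - p"
      by (intro mult_right_mono) auto
    also have "(real (Suc n) powr p * measure unit_leb (E n)) * real (Suc n) powr - p = 
        measure unit_leb (E n) * (real (Suc n) powr p * real (Suc n) powr - p)"
      by (simp only: ac_simps)
    also have "real (Suc n) powr p * real (Suc n) powr - p = 1" by (simp flip: powr_add)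
    finally show ?thesis by (simp only: mult_1_right)
  qed
  have "summable (\<lambda>n. measure unit_leb (E n))"
    by (rule summable_comparison_test'[OF summable_mult[OF summable_powr[OF p(1)], of "2 * A"], of 0]) (use le in simp)
  then have "AE x in unit_leb. \<forall>\<^sub>F n in sequentially. x \<in> space unit_leb - E n"
    by (intro borel_cantelli_AE1) (auto simp: unit_leb.emeasure_eq_measure)
  then show ?thesis
  proof (rule AE_mp, intro AE_I2 impI)
    fix x assume x: "x \<in> space unit_leb" "\<forall>\<^sub>F n in sequentially. x \<in> space unit_leb - E n"
    from x(2) have "\<forall>\<^sub>F n in sequentially. f (Suc n) x \<le> real (Suc n)"
      by eventually_elim (use x(1) in \<open>auto simp: E_def not_less\<close>)
    then show "\<forall>\<^sub>F n in sequentially. f n x \<le> real n"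
      by (subst (asm) eventually_sequentially_Suc[of "\<lambda>n. f n x \<le> real n"])
  qed
qed

text \<open>Let \<open>w n\<close> be the truncation of \<open>g n\<close> at height
  \<open>n\<close> minus \<open>F n\<close>. The L^p bounds give it second moment O(n^(2 - p)), and
  near orthogonality gives O(m^(3 - p)) for the sum of the first \<open>m\<close> terms. Divided by
  m^2 this is O(m^(1 - p)), summable along m = (i + 1)^q for large \<open>q\<close>. The gaps are
  filled for the truncations, which are nonnegative, and not for \<open>w\<close>.\<close>

lemma AE_cesaro_tendsto:
  assumes n2: "nabla2 \<phi>" 
    and gm: "\<And>n. g n \<in> borel_measurable unit_leb" and g: "\<And>n x. 0 \<le> g n x" "\<And>n. modular \<phi> (g n) 1 \<le> 1"
    and Fm: "\<And>n. F n \<in> borel_measurable unit_leb" and F: "\<And>n x. 0 \<le> F n x" "\<And>n x. F n x \<le> real n" "\<And>n. modular \<phi> (F n) 1 \<le> 1"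
    and lim: "AE x in unit_leb. (\<lambda>n. F n x) \<longlonglongrightarrow> G x"
    and orth: "\<And>i j. i < j \<Longrightarrow> 
      \<bar>\<integral>x. (min (g i x) (real i) - F i x) * (min (g j x) (real j) - F j x) \<partial>unit_leb\<bar> \<le> (1 / 2) ^ j"
  shows "AE x in unit_leb. (\<lambda>m. cesaro g m x) \<longlonglongrightarrow> G x"
proof -
  note [measurable] = gm Fm
  obtain p A where p: "1 < p" "p \<le> 2" "1 \<le> A" "\<And>t. 0 \<le> t \<Longrightarrow> t powr p \<le> A * (1 + \<phi> t)"
    by (rule nabla2E[OF n2]) (rule that)
  define a where "a = (\<lambda>n x. min (g n x) (real n))"
  define w where "w = (\<lambda>n x. a n x - F n x)"
  have am [measurable]: "a n \<in> borel_measurable unit_leb" for n unfolding a_def by measurable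
  have wm [measurable]: "w n \<in> borel_measurable unit_leb" for n unfolding w_def by measurable
  have a: "0 \<le> a n x" "a n x \<le> n" for n x using g by (auto simp: a_def)
  have wb: "\<bar>w n x\<bar> \<le> real n" for n x using a[of n x] F(1,2)[of n x] by (auto simp: w_def abs_le_iff)
  have ww: "integrable unit_leb (\<lambda>x. w i x * w j x)" for i j
    by (rule unit_leb_integrable_bounded[of _ "real i * real j"]) (use wb in \<open>auto simp: abs_mult intro!: mult_mono\<close>)
  \<comment> \<open>Here truncation at height \<open>n\<close> is used: the power of
    \<open>t\<close> in excess of \<open>p\<close> is bounded by its maximum.\<close>
  have sq: "t\<^sup>2 \<le> real n powr (2 - p) * t powr p" if "0 \<le> t" "t \<le> real n" for t n
  proof (cases "t = 0")
    case False
    then have "t\<^sup>2 = t powr (2 - p) * t powr p" using that by (simp flip: powr_add add: powr_numeral)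
    also have "\<dots> \<le> real n powr (2 - p) * t powr p" using that p by (intro mult_right_mono powr_mono2) auto
    finally show ?thesis .
  qed simp
  have w2: "(\<integral>x. w n x * w n x \<partial>unit_leb) \<le> 4 * A * real n powr (2 - p)" for n
  proof -
    have "ennreal (\<integral>x. w n x * w n x \<partial>unit_leb) = (\<integral>\<^sup>+x. ennreal (w n x * w n x) \<partial>unit_leb)"
      using ww by (intro nn_integral_eq_integral[symmetric]) auto
    also have "\<dots> \<le> (\<integral>\<^sup>+x. ennreal (real n powr (2 - p)) * (ennreal (g n x powr p) + ennreal (F n x powr p)) \<partial>unit_leb)"
    proof (rule nn_integral_mono)
      fix x
      have "w n x * w n x = (a n x)\<^sup>2 + (F n x)\<^sup>2 - 2 * (a n x * F n x)"
        by (simp add: w_def power2_eq_square algebra_simps)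
      also have "\<dots> \<le> (a n x)\<^sup>2 + (F n x)\<^sup>2" using a F by simp
      also have "\<dots> \<le> real n powr (2 - p) * a n x powr p + real n powr (2 - p) * F n x powr p"
        using a F by (intro add_mono sq) auto
      also have "\<dots> \<le> real n powr (2 - p) * g n x powr p + real n powr (2 - p) * F n x powr p"
        using g p by (intro add_right_mono mult_left_mono powr_mono2) (auto simp: a_def)
      finally have "ennreal (w n x * w n x) \<le> ennreal (real n powr (2 - p) * (g n x powr p + F n x powr p))"
        by (intro ennreal_leI) (simp add: distrib_left)
      then show "ennreal (w n x * w n x) \<le> ennreal (real n powr (2 - p)) * (ennreal (g n x powr p) + ennreal (F n x powr p))"
        by (simp add: ennreal_mult)
    qed
    also have "\<dots> = ennreal (real n powr (2 - p)) * ((\<integral>\<^sup>+x. ennreal (g n x powr p) \<partial>unit_leb) + (\<integral>\<^sup>+x. ennreal (F n x powr p) \<partial>unit_leb))"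
      by (simp add: nn_integral_cmult nn_integral_add)
    also have "\<dots> \<le> ennreal (real n powr (2 - p)) * (ennreal (2 * A) + ennreal (2 * A))"
      using p g F by (intro mult_left_mono add_mono nn_integral_power_bound) auto
    also have "\<dots> = ennreal (4 * A * real n powr (2 - p))"
      using p(3) by (simp add: mult.commute flip: ennreal_plus ennreal_mult)
    finally show ?thesis using p(3) by (simp add: ennreal_le_iff)
  qed
  define S where "S = (\<lambda>m x. \<Sum>n<m. w n x)"
  have Sm [measurable]: "S m \<in> borel_measurable unit_leb" for m unfolding S_def by measurable
  have S_int: "integrable unit_leb (\<lambda>x. S m x * w n x)" for m n
    unfolding S_def sum_distrib_right using ww by (intro Bochner_Integration.integrable_sum) auto
  have SS_int: "integrable unit_leb (\<lambda>x. S m x * S m x)" for m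
    using S_int[of m] by (subst (2) S_def) (simp add: sum_distrib_left)
  have S2: "(\<integral>x. S m x * S m x \<partial>unit_leb) \<le> (\<Sum>n<m. 4 * A * real n powr (2 - p) + 2)" for m
  proof (induction m)
    case 0
    then show ?case by (simp add: S_def)
  next
    case (Suc m)
    have "(\<integral>x. S (Suc m) x * S (Suc m) x \<partial>unit_leb) = (\<integral>x. S m x * S m x + 2 * (S m x * w m x) + w m x * w m x \<partial>unit_leb)"
      by (intro Bochner_Integration.integral_cong) (auto simp: S_def algebra_simps)
    also have "\<dots> = (\<integral>x. S m x * S m x \<partial>unit_leb) + 2 * (\<integral>x. S m x * w m x \<partial>unit_leb) + (\<integral>x. w m x * w m x \<partial>unit_leb)"
      using S_int SS_int ww by simp
    also have "(\<integral>x. S m x * w m x \<partial>unit_leb) = (\<Sum>n<m. \<integral>x. w n x * w m x \<partial>unit_leb)"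
      unfolding S_def sum_distrib_right using ww by (intro Bochner_Integration.integral_sum) auto
    also have "\<dots> \<le> (\<Sum>n<m. (1 / 2) ^ m)"
    proof (rule sum_mono)
      fix n assume "n \<in> {..<m}"
      then show "(\<integral>x. w n x * w m x \<partial>unit_leb) \<le> (1 / 2) ^ m"
        using orth[of n m] unfolding w_def a_def by (auto dest: abs_le_D1)
    qed
    \<comment> \<open>The \<open>m\<close> cross terms with the new summand total at most m / 2^m
      \<le> 1; doubled, this is the summand 2 in the bound.\<close>
    also have "\<dots> = real m / 2 ^ m" by (simp add: power_divide)
    also have "\<dots> \<le> 1"
      using of_nat_less_two_power[of m, where 'a = real] by simp
    finally show ?case using Suc w2[of m] by simp
  qed
  have S2': "(\<integral>x. S m x * S m x \<partial>unit_leb) \<le> (4 * A + 2) * real m powr (3 - p)" if "m \<ge> 1" for m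
  proof -
    have m1: "1 \<le> real m powr (2 - p)" using that p by (intro ge_one_powr_ge_zero) auto
    have "(\<integral>x. S m x * S m x \<partial>unit_leb) \<le> (\<Sum>n<m. 4 * A * real n powr (2 - p) + 2)" by (rule S2)
    also have "\<dots> \<le> (\<Sum>n<m. 4 * A * real m powr (2 - p) + 2 * real m powr (2 - p))"
      using p m1 by (intro sum_mono add_mono mult_left_mono powr_mono2) auto
    also have "\<dots> = (4 * A + 2) * (real m powr 1 * real m powr (2 - p))" using that by (simp add: algebra_simps)
    also have "real m powr 1 * real m powr (2 - p) = real m powr (3 - p)" by (simp only: powr_add[symmetric]) simp
    finally show ?thesis .
  qed
  \<comment> \<open>Then q (p - 1) \<ge> 2, so the second moment of \<open>T i\<close> is of order
    (i + 1)^(-2).\<close>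
  obtain q :: nat where q: "real q > 2 / (p - 1)" using reals_Archimedean2 by blast
  have "2 / (p - 1) > 0" using p by simp
  with q have "real q > 0" by linarith
  then have q0: "q > 0" by simp
  have qp: "real q * (1 - p) \<le> - 2" using q p(1) by (simp add: field_simps)
  define T where "T = (\<lambda>i x. S (Suc i ^ q) x / real (Suc i ^ q))"
  have [measurable]: "T i \<in> borel_measurable unit_leb" for i unfolding T_def by measurable
  have T2: "(\<integral>\<^sup>+x. ennreal (T i x * T i x) \<partial>unit_leb) \<le> ennreal ((4 * A + 2) * real (Suc i) powr - 2)" for i
  proof -
    define m where "m = Suc i ^ q"
    have m: "m \<ge> 1" by (simp add: m_def)
    have "(\<integral>\<^sup>+x. ennreal (T i x * T i x) \<partial>unit_leb) = (\<integral>\<^sup>+x. ennreal (S m x * S m x / (real m)\<^sup>2) \<partial>unit_leb)"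
      by (simp add: T_def m_def power2_eq_square del: power_Suc)
    also have "\<dots> = ennreal (\<integral>x. S m x * S m x / (real m)\<^sup>2 \<partial>unit_leb)"
      using SS_int by (intro nn_integral_eq_integral) auto
    also have "(\<integral>x. S m x * S m x / (real m)\<^sup>2 \<partial>unit_leb) = (\<integral>x. S m x * S m x \<partial>unit_leb) / (real m)\<^sup>2" by simp
    also have "\<dots> \<le> (4 * A + 2) * real m powr (3 - p) / (real m)\<^sup>2"
      using S2'[OF m] by (intro divide_right_mono) auto
    also have "\<dots> = (4 * A + 2) * (real m powr (3 - p) / real m powr 2)" using m by (simp add: powr_numeral)
    also have "real m powr (3 - p) / real m powr 2 = real m powr (1 - p)" by (subst powr_diff[symmetric]) simp
    also have "real m = real (Suc i) powr real q" by (simp add: m_def powr_realpow del: power_Suc)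
    also have "(real (Suc i) powr real q) powr (1 - p) = real (Suc i) powr (real q * (1 - p))" by (rule powr_powr)
    also have "(4 * A + 2) * real (Suc i) powr (real q * (1 - p)) \<le> (4 * A + 2) * real (Suc i) powr - 2"
      using qp p(3) by (intro mult_left_mono powr_mono) auto
    finally show ?thesis by (simp add: ennreal_leI)
  qed
  have "(\<integral>\<^sup>+x. (\<Sum>i. ennreal (T i x * T i x)) \<partial>unit_leb) = (\<Sum>i. \<integral>\<^sup>+x. ennreal (T i x * T i x) \<partial>unit_leb)"
    by (rule nn_integral_suminf) measurable
  also have "\<dots> \<le> (\<Sum>i. ennreal ((4 * A + 2) * real (Suc i) powr - 2))"
    using T2 by (intro suminf_le) auto
  also have "\<dots> = ennreal (\<Sum>i. (4 * A + 2) * real (Suc i) powr - 2)"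
    using p(3) summable_powr[of 2] by (intro suminf_ennreal2) (auto intro!: summable_mult)
  finally have "(\<integral>\<^sup>+x. (\<Sum>i. ennreal (T i x * T i x)) \<partial>unit_leb) \<noteq> \<infinity>" by (auto simp: top_unique)
  then have "AE x in unit_leb. (\<Sum>i. ennreal (T i x * T i x)) \<noteq> \<infinity>" by (intro nn_integral_PInf_AE) auto
  then show ?thesis using lim AE_eventually_le[OF n2 gm g]
  proof eventually_elim
    fix x assume fin: "(\<Sum>i. ennreal (T i x * T i x)) \<noteq> \<infinity>" and Fx: "(\<lambda>n. F n x) \<longlonglongrightarrow> G x"
      and ev: "\<forall>\<^sub>F n in sequentially. g n x \<le> real n"
    have "summable (\<lambda>i. T i x * T i x)" using fin by (intro summable_suminf_not_top) auto
    then have "(\<lambda>i. T i x * T i x) \<longlonglongrightarrow> 0" by (rule summable_LIMSEQ_zero)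
    then have "(\<lambda>i. sqrt (T i x * T i x)) \<longlonglongrightarrow> sqrt 0" by (rule tendsto_real_sqrt)
    then have T0: "(\<lambda>i. T i x) \<longlonglongrightarrow> 0" by (simp add: tendsto_rabs_zero_iff)
    have FG: "(\<lambda>m. (\<Sum>n<m. F n x) / m) \<longlonglongrightarrow> G x" using Fx by (rule tendsto_mean)
    have pw: "filterlim (\<lambda>i. Suc i ^ q) sequentially sequentially"
    proof (rule filterlim_at_top_mono[OF filterlim_Suc])
      show "\<forall>\<^sub>F i in sequentially. Suc i \<le> Suc i ^ q" using q0 self_le_power[of "Suc _" q] by simp
    qed
    have "(\<lambda>i. T i x + (\<Sum>n<Suc i ^ q. F n x) / real (Suc i ^ q)) \<longlonglongrightarrow> 0 + G x"
      by (intro tendsto_add T0 filterlim_compose[OF FG pw])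
    moreover have "T i x + (\<Sum>n<Suc i ^ q. F n x) / real (Suc i ^ q) = (\<Sum>n<Suc i ^ q. a n x) / real (Suc i ^ q)" for i
      by (simp add: T_def S_def w_def sum_subtractf diff_divide_distrib del: power_Suc)
    ultimately have "(\<lambda>i. (\<Sum>n<Suc i ^ q. a n x) / real (Suc i ^ q)) \<longlonglongrightarrow> G x" by simp
    then have am: "(\<lambda>m. (\<Sum>n<m. a n x) / m) \<longlonglongrightarrow> G x"
      using a q0 by (intro tendsto_mean_if_subseq[of "\<lambda>n. a n x" q]) auto
    \<comment> \<open>At almost every point truncation changes only finitely many terms.\<close>
    have "(\<lambda>n. g n x - a n x) \<longlonglongrightarrow> 0"
      using ev by (intro tendsto_eventually) (auto elim!: eventually_mono simp: a_def)
    then have "(\<lambda>m. (\<Sum>n<m. g n x - a n x) / m) \<longlonglongrightarrow> 0" by (rule tendsto_mean)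
    from tendsto_add[OF this am] have "(\<lambda>m. (\<Sum>n<m. g n x) / m) \<longlonglongrightarrow> G x"
      by (simp add: sum_subtractf diff_divide_distrib)
    from LIMSEQ_Suc[OF this] show "(\<lambda>m. cesaro g m x) \<longlonglongrightarrow> G x"
      by (simp add: cesaro_def lessThan_Suc_atMost)
  qed
qed

end

section \<open>Centred truncations and their weak nullity\<close>

context orlicz
begin

text \<open>\<open>g\<close> is split at a small height \<kappa>. The part below has norm at most
  \<open>c\<close>; the part above lives, by Chebyshev's inequality, on a set of small measure,
  where \<open>functional_small_support\<close> applies.\<close>

lemma functional_small_L1:
  assumes n2: "nabla2 \<phi>" and l: "bounded_functional \<phi> (orlicz_heart \<phi>) l" and \<epsilon>: "\<epsilon> > 0"
  shows "\<exists>\<delta>>0. \<forall>g B. g \<in> borel_measurable unit_leb \<longrightarrow> (\<forall>x. \<bar>g x\<bar> \<le> B) \<longrightarrow> modular \<phi> g 1 \<le> 1 \<longrightarrow>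
    (\<integral>x. \<bar>g x\<bar> \<partial>unit_leb) \<le> \<delta> \<longrightarrow> \<bar>l g\<bar> \<le> \<epsilon>"
proof -
  obtain C where C: "C > 0" "\<And>f c. f \<in> orlicz_heart \<phi> \<Longrightarrow> c > 0 \<Longrightarrow> modular \<phi> f c \<le> 1 \<Longrightarrow> \<bar>l f\<bar> \<le> C * c"
    using bounded_functionalE[OF l] by blast
  have "\<epsilon> / 2 > 0" using \<epsilon> by simp
  from functional_small_support[OF n2 l this] obtain \<eta> where \<eta>: "\<eta> > 0"
    "\<And>g B. g \<in> borel_measurable unit_leb \<Longrightarrow> (\<And>x. \<bar>g x\<bar> \<le> B) \<Longrightarrow> modular \<phi> g 1 \<le> 1 \<Longrightarrow>
    measure unit_leb {x \<in> space unit_leb. g x \<noteq> 0} \<le> \<eta> \<Longrightarrow> \<bar>l g\<bar> \<le> \<epsilon> / 2"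
    by blast
  define c where "c = \<epsilon> / (2 * C)"
  have c: "c > 0" using C \<epsilon> by (simp add: c_def)
  obtain u where u: "u > 0" "\<phi> u > 0" using ex_pos by blast
  \<comment> \<open>Shrinking \<open>u\<close> achieves \<phi>(t) \<le> 1, so a function bounded by
    \<kappa> = c t has modular at most 1 at scale \<open>c\<close>.\<close>
  define t where "t = u / max 1 (\<phi> u)"
  have t: "t > 0" using u by (simp add: t_def)
  have "\<phi> ((1 / max 1 (\<phi> u)) * u) \<le> (1 / max 1 (\<phi> u)) * \<phi> u" using u by (intro scale_le) auto
  also have "\<dots> \<le> 1" using u by simp
  finally have \<phi>t: "\<phi> t \<le> 1" by (simp add: t_def)
  define \<kappa> where "\<kappa> = c * t"
  have \<kappa>: "\<kappa> > 0" using c t by (simp add: \<kappa>_def)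
  have "\<bar>l g\<bar> \<le> \<epsilon>" if g [measurable]: "g \<in> borel_measurable unit_leb" and gB: "\<And>x. \<bar>g x\<bar> \<le> B"
    and g1: "modular \<phi> g 1 \<le> 1" and small: "(\<integral>x. \<bar>g x\<bar> \<partial>unit_leb) \<le> \<eta> * \<kappa>" for g B
  proof -
    define a where "a = (\<lambda>x. if \<bar>g x\<bar> \<le> \<kappa> then g x else 0)"
    define b where "b = (\<lambda>x. if \<bar>g x\<bar> \<le> \<kappa> then 0 else g x)"
    have [measurable]: "a \<in> borel_measurable unit_leb" "b \<in> borel_measurable unit_leb"
      unfolding a_def b_def by measurable
    have ab: "a x + b x = g x" "\<bar>a x\<bar> \<le> \<kappa>" "\<bar>b x\<bar> \<le> \<bar>g x\<bar>" for x using \<kappa> by (auto simp: a_def b_def)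
    have bB: "\<bar>b x\<bar> \<le> B" for x using ab(3) gB order_trans by blast
    have heart: "a \<in> orlicz_heart \<phi>" "b \<in> orlicz_heart \<phi>"
      using ab bB by (auto intro: heart_bounded[of a \<kappa>] heart_bounded[of b B])
    have "modular \<phi> a c \<le> ennreal (\<phi> (\<bar>\<kappa>\<bar> / c))" using ab c by (intro modular_bounded) auto
    also have "\<dots> \<le> 1" using \<phi>t c \<kappa> by (simp add: \<kappa>_def)
    finally have "\<bar>l a\<bar> \<le> C * c" using c heart by (intro C(2)) auto
    then have la: "\<bar>l a\<bar> \<le> \<epsilon> / 2" using C(1) by (simp add: c_def)
    have "\<bar>l b\<bar> \<le> \<epsilon> / 2"
    proof (rule \<eta>(2))
      show "modular \<phi> b 1 \<le> 1" using modular_mono[of b g 1 1] ab g1 by (auto intro: order_trans)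
      define E where "E = {x \<in> space unit_leb. b x \<noteq> 0}"
      have [measurable]: "E \<in> sets unit_leb" unfolding E_def by measurable
      have "\<kappa> * measure unit_leb E = (\<integral>x. \<kappa> * indicator E x \<partial>unit_leb)"
        using sets.sets_into_space[of E unit_leb] by (simp add: Int_absorb2)
      also have "\<dots> \<le> (\<integral>x. \<bar>g x\<bar> \<partial>unit_leb)"
      proof (rule integral_mono)
        show "integrable unit_leb (\<lambda>x. \<kappa> * indicator E x)" 
          by (rule unit_leb_integrable_bounded[of _ \<kappa>]) (use \<kappa> in \<open>auto simp: indicator_def\<close>)
        show "integrable unit_leb (\<lambda>x. \<bar>g x\<bar>)" by (rule unit_leb_integrable_bounded[of _ B]) (use gB in auto)
        show "\<kappa> * indicator E x \<le> \<bar>g x\<bar>" for x by (auto simp: E_def b_def indicator_def)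
      qed
      also have "\<dots> \<le> \<kappa> * \<eta>" using small by (simp add: mult.commute)
      finally have "measure unit_leb E \<le> \<eta>" using \<kappa> by simp
      then show "measure unit_leb {x \<in> space unit_leb. b x \<noteq> 0} \<le> \<eta>" by (simp add: E_def)
    qed (use bB in auto)
    moreover have "l g = l a + l b" using bounded_functional_add[OF l heart] ab(1) by simp
    ultimately show ?thesis using la by linarith
  qed
  moreover have "\<eta> * \<kappa> > 0" using \<eta> \<kappa> by simp
  ultimately show ?thesis by blast
qed

text \<open>Weak limits preserve order, so the limits at increasing heights increase, and weak lower
  semicontinuity of the modular keeps them in the unit ball. Monotone convergence of their modulars
  puts the pointwise limit \<open>G\<close> into the space.\<close>

lemma ex_monotone_truncation_limits:
  fixes f :: "nat \<Rightarrow> real \<Rightarrow> real"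
  assumes fm: "\<And>n. f n \<in> borel_measurable unit_leb" and f: "\<And>n x. 0 \<le> f n x" "\<And>n. modular \<phi> (f n) 1 \<le> 1"
  obtains s :: "nat \<Rightarrow> nat" and F :: "nat \<Rightarrow> real \<Rightarrow> real" and G where "strict_mono s" 
    "truncation_limits (\<lambda>n. f (s n)) F"
    "\<And>j k x. j \<le> k \<Longrightarrow> F j x \<le> F k x" "\<And>k. modular \<phi> (F k) 1 \<le> 1"
    "G \<in> orlicz_space \<phi>" "AE x in unit_leb. (\<lambda>k. F k x) \<longlonglongrightarrow> G x"
proof -
  note [measurable] = fm
  obtain s :: "nat \<Rightarrow> nat" and H :: "nat \<Rightarrow> real \<Rightarrow> real" where s: "strict_mono s" and
    H_lim: "truncation_limits (\<lambda>n. f (s n)) H"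
    using ex_weak_limits_of_truncations[where f = f, OF fm f(1)] by blast
  note Hm [measurable] = truncation_limitsD(1)[OF H_lim] and H = truncation_limitsD(2,3)[OF H_lim] and weak = truncation_limitsD(4)[OF H_lim]
  have int: "integrable unit_leb (\<lambda>x. u x * h x)" if "u \<in> borel_measurable unit_leb" "h \<in> borel_measurable unit_leb"
    "\<And>x. 0 \<le> u x" "\<And>x. u x \<le> K" "\<And>x. \<bar>h x\<bar> \<le> B" for u h :: "real \<Rightarrow> real" and K B :: real
  proof (rule unit_leb_integrable_bounded[of _ "K * B"])
    fix x
    have "\<bar>u x\<bar> * \<bar>h x\<bar> \<le> K * B" using that(3,4,5)[of x] by (intro mult_mono) auto
    then show "\<bar>u x * h x\<bar> \<le> K * B" by (simp add: abs_mult)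
  qed (use that in measurable)
  have H_mono: "AE x in unit_leb. H k x \<le> H (Suc k) x" for k
  proof -
    \<comment> \<open>The two weak limits are compared on the set where monotonicity fails.\<close>
    define E where "E = {x \<in> space unit_leb. H (Suc k) x < H k x}"
    have [measurable]: "E \<in> sets unit_leb" unfolding E_def by measurable
    define h where "h = (indicator E :: real \<Rightarrow> real)"
    have hm [measurable]: "h \<in> borel_measurable unit_leb" and hb: "\<bar>h x\<bar> \<le> 1" for x
      unfolding h_def by (auto simp: indicator_def)
    have "(\<integral>x. H k x * h x \<partial>unit_leb) \<le> (\<integral>x. H (Suc k) x * h x \<partial>unit_leb)"
    proof (rule LIMSEQ_le[OF weak[OF hm hb, of k] weak[OF hm hb, of "Suc k"]], intro exI allI impI)
      fix n
      show "(\<integral>x. min (f (s n) x) (real k) * h x \<partial>unit_leb) \<le> (\<integral>x. min (f (s n) x) (real (Suc k)) * h x \<partial>unit_leb)"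
        using f(1) hb
        by (intro integral_mono int[of _ _ "real k" 1] int[of _ _ "real (Suc k)" 1] mult_right_mono) (auto simp: h_def)
    qed
    moreover have ii: "integrable unit_leb (\<lambda>x. H k x * h x)" "integrable unit_leb (\<lambda>x. H (Suc k) x * h x)"
      using int[OF Hm[of k] hm H(1) H(2) hb] int[OF Hm[of "Suc k"] hm H(1) H(2) hb] by auto
    ultimately have le: "(\<integral>x. H k x * h x - H (Suc k) x * h x \<partial>unit_leb) \<le> 0" by simp
    have nn: "0 \<le> H k x * h x - H (Suc k) x * h x" for x by (auto simp: h_def E_def indicator_def)
    have "(\<integral>x. H k x * h x - H (Suc k) x * h x \<partial>unit_leb) \<ge> 0"
      using nn by (intro integral_nonneg_AE) auto
    with le have "(\<integral>x. H k x * h x - H (Suc k) x * h x \<partial>unit_leb) = 0" by linarith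
    then have "AE x in unit_leb. H k x * h x - H (Suc k) x * h x = 0"
      using ii nn by (subst (asm) integral_nonneg_eq_0_iff_AE) auto
    then show ?thesis using AE_space
    proof eventually_elim
      fix x assume "H k x * h x - H (Suc k) x * h x = 0" "x \<in> space unit_leb"
      then show "H k x \<le> H (Suc k) x" by (cases "x \<in> E") (auto simp: h_def E_def)
    qed
  qed
  \<comment> \<open>The running maximum changes each limit on a null set only and makes monotonicity
    hold at every point.\<close>
  define F where "F = (\<lambda>k x. Max ((\<lambda>j. H j x) ` {..k}))"
  have Fm [measurable]: "F k \<in> borel_measurable unit_leb" for k
    unfolding F_def by (intro borel_measurable_Max) auto
  have F_ge: "H j x \<le> F k x" if "j \<le> k" for j k x unfolding F_def using that by (intro Max_ge) auto
  have F_le: "F k x \<le> c" if "\<And>j. j \<le> k \<Longrightarrow> H j x \<le> c" for k x c unfolding F_def using that by (intro Max.boundedI) auto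
  have F0: "0 \<le> F k x" for k x using H(1) F_ge order_trans by blast
  have Fk: "F k x \<le> real k" for k x
  proof (rule F_le)
    fix j assume "j \<le> k"
    then show "H j x \<le> real k" using H(2)[of j x] by (meson of_nat_le_iff order_trans)
  qed
  have F_mono: "F j x \<le> F k x" if "j \<le> k" for j k x using that F_ge by (intro F_le) auto
  have FH: "AE x in unit_leb. F k x = H k x" for k
  proof -
    have "AE x in unit_leb. \<forall>k. H k x \<le> H (Suc k) x" using H_mono by (simp add: AE_all_countable)
    then show ?thesis
    proof eventually_elim
      fix x assume "\<forall>k. H k x \<le> H (Suc k) x"
      then have "incseq (\<lambda>k. H k x)" by (simp add: incseq_SucI)
      then show "F k x = H k x" using F_ge[of k k x] by (intro antisym F_le) (auto simp: incseq_def)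
    qed
  qed
  have weakF: "(\<lambda>n. \<integral>x. min (f (s n) x) (real k) * h x \<partial>unit_leb) \<longlonglongrightarrow> (\<integral>x. F k x * h x \<partial>unit_leb)"
    if hm [measurable]: "h \<in> borel_measurable unit_leb" and hb: "\<And>x. \<bar>h x\<bar> \<le> B" for k h B
  proof -
    have "(\<integral>x. F k x * h x \<partial>unit_leb) = (\<integral>x. H k x * h x \<partial>unit_leb)"
      using FH[of k] by (intro integral_cong_AE) (auto elim!: eventually_mono)
    then show ?thesis using weak[OF hm hb] by simp
  qed
  obtain d where d: "\<And>s t. 0 \<le> s \<Longrightarrow> s \<le> t \<Longrightarrow> d s \<le> d t" "\<And>t. 0 \<le> t \<Longrightarrow> 0 \<le> d t"
    "\<And>s t. 0 \<le> s \<Longrightarrow> 0 \<le> t \<Longrightarrow> \<phi> t + d t * (s - t) \<le> \<phi> s" and dm: "(\<lambda>t. d \<bar>t\<bar>) \<in> borel_measurable borel"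
    using subgradient by blast
  have F1: "modular \<phi> (F k) 1 \<le> 1" for k
  proof -
    \<comment> \<open>The subgradient at \<open>F k\<close> is bounded because F k \<le> k, hence an
      admissible test function; the tangent inequality \<phi>(F k) + h (u - F k) \<le> \<phi>(u) is
      integrated and passed to the limit.\<close>
    define h where "h = (\<lambda>x. d (F k x))"
    have hm [measurable]: "h \<in> borel_measurable unit_leb"
      using measurable_compose[OF Fm[of k] dm] F0 by (simp add: h_def)
    have hb: "\<bar>h x\<bar> \<le> d (real k)" for x using d(1)[OF F0 Fk, of k x] d(2)[OF F0, of k x] by (simp add: h_def)
    have [measurable]: "(\<lambda>x. \<phi> (F k x)) \<in> borel_measurable unit_leb" using measurable_comp[OF Fm[of k]] F0 by simp
    have \<phi>F: "integrable unit_leb (\<lambda>x. \<phi> (F k x))"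
      by (rule unit_leb_integrable_bounded[of _ "\<phi> (real k)"]) (use F0 Fk mono nonneg in \<open>auto simp: abs_of_nonneg\<close>)
    have Fh: "integrable unit_leb (\<lambda>x. F k x * h x)" using F0 Fk hb by (intro int[of _ _ "real k" "d (real k)"]) auto
    have le: "(\<integral>x. \<phi> (F k x) \<partial>unit_leb) + ((\<integral>x. min (f (s n) x) (real k) * h x \<partial>unit_leb) - (\<integral>x. F k x * h x \<partial>unit_leb)) \<le> 1" for n
    proof -
      define u where "u = (\<lambda>x. min (f (s n) x) (real k))"
      have u: "0 \<le> u x" "u x \<le> real k" "u x \<le> f (s n) x" for x using f(1) by (auto simp: u_def)
      have [measurable]: "u \<in> borel_measurable unit_leb" unfolding u_def by measurable
      have [measurable]: "(\<lambda>x. \<phi> (u x)) \<in> borel_measurable unit_leb" using measurable_comp[of u unit_leb] u by simp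
      have \<phi>u: "integrable unit_leb (\<lambda>x. \<phi> (u x))"
        by (rule unit_leb_integrable_bounded[of _ "\<phi> (real k)"]) (use u mono nonneg in \<open>auto simp: abs_of_nonneg\<close>)
      have uh: "integrable unit_leb (\<lambda>x. u x * h x)" using u hb by (intro int[of _ _ "real k" "d (real k)"]) auto
      have "ennreal (\<integral>x. \<phi> (u x) \<partial>unit_leb) = (\<integral>\<^sup>+x. ennreal (\<phi> (u x)) \<partial>unit_leb)"
        using \<phi>u u nonneg by (intro nn_integral_eq_integral[symmetric]) auto
      also have "\<dots> \<le> modular \<phi> (f (s n)) 1"
        unfolding modular_def using u f(1) by (intro nn_integral_mono ennreal_leI mono) auto
      also have "\<dots> \<le> 1" by (rule f(2))
      finally have 1: "(\<integral>x. \<phi> (u x) \<partial>unit_leb) \<le> 1" by simp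
      have "(\<integral>x. \<phi> (F k x) \<partial>unit_leb) + ((\<integral>x. u x * h x \<partial>unit_leb) - (\<integral>x. F k x * h x \<partial>unit_leb)) 
        = (\<integral>x. \<phi> (F k x) + (u x * h x - F k x * h x) \<partial>unit_leb)"
        using \<phi>F uh Fh by simp
      also have "\<dots> \<le> (\<integral>x. \<phi> (u x) \<partial>unit_leb)"
      proof (rule integral_mono)
        fix x
        show "\<phi> (F k x) + (u x * h x - F k x * h x) \<le> \<phi> (u x)"
          using d(3)[OF u(1)[of x] F0[of k x]] by (simp add: h_def algebra_simps)
      qed (use \<phi>F uh Fh \<phi>u in auto)
      finally show ?thesis using 1 by (simp add: u_def)
    qed
    have "(\<lambda>n. (\<integral>x. \<phi> (F k x) \<partial>unit_leb) + ((\<integral>x. min (f (s n) x) (real k) * h x \<partial>unit_leb) - (\<integral>x. F k x * h x \<partial>unit_leb)))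
       \<longlonglongrightarrow> (\<integral>x. \<phi> (F k x) \<partial>unit_leb) + ((\<integral>x. F k x * h x \<partial>unit_leb) - (\<integral>x. F k x * h x \<partial>unit_leb))"
      by (intro tendsto_intros weakF[OF hm hb])
    from LIMSEQ_le_const2[OF this] le have "(\<integral>x. \<phi> (F k x) \<partial>unit_leb) \<le> 1" by auto
    moreover have "modular \<phi> (F k) 1 = ennreal (\<integral>x. \<phi> (F k x) \<partial>unit_leb)"
      unfolding modular_def using \<phi>F F0 nonneg by (subst nn_integral_eq_integral[symmetric]) auto
    ultimately show ?thesis by simp
  qed
  define Z where "Z = (\<lambda>x. SUP k. ennreal (\<phi> (F k x)))"
  have \<phi>Fm [measurable]: "(\<lambda>x. \<phi> (F k x)) \<in> borel_measurable unit_leb" for k using measurable_comp[OF Fm[of k]] F0 by simp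
  have [measurable]: "Z \<in> borel_measurable unit_leb" unfolding Z_def by measurable
  have "(\<integral>\<^sup>+x. Z x \<partial>unit_leb) = (SUP k. modular \<phi> (F k) 1)"
    unfolding Z_def modular_def using F0 
    by (subst nn_integral_monotone_convergence_SUP) (auto simp: incseq_def le_fun_def intro!: ennreal_leI mono F_mono)
  also have "\<dots> \<le> 1" using F1 by (intro SUP_least)
  finally have Z: "(\<integral>\<^sup>+x. Z x \<partial>unit_leb) < \<infinity>" by (auto intro: order_le_less_trans)
  have "dominated_in (orlicz_space \<phi>) F"
  proof (rule dominated_inI[where b = 1 and Z = Z])
    show "AE x in unit_leb. \<forall>m. ennreal (\<phi> (\<bar>F m x\<bar> / 1)) \<le> Z x"
      unfolding Z_def by (intro AE_I2 allI SUP_upper2) (use F0 in auto)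
  qed (use Z in auto)
  then obtain h where h: "h \<in> orlicz_space \<phi>" "\<And>k. AE x in unit_leb. \<bar>F k x\<bar> \<le> h x"
    unfolding dominated_in_def ae_le_def by blast
  define G where "G = (\<lambda>x. lim (\<lambda>k. F k x))"
  have Gm: "G \<in> borel_measurable unit_leb" unfolding G_def by (rule borel_measurable_lim_metric) measurable
  have "AE x in unit_leb. \<forall>k. \<bar>F k x\<bar> \<le> h x" using h(2) by (simp add: AE_all_countable)
  then have lim: "AE x in unit_leb. (\<lambda>k. F k x) \<longlonglongrightarrow> G x \<and> \<bar>G x\<bar> \<le> \<bar>h x\<bar>"
  proof eventually_elim
    fix x assume x: "\<forall>k. \<bar>F k x\<bar> \<le> h x"
    have "incseq (\<lambda>k. F k x)" using F_mono by (simp add: incseq_def)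
    moreover have le: "F k x \<le> h x" for k using x by (meson abs_le_D1)
    ultimately obtain L where L: "(\<lambda>k. F k x) \<longlonglongrightarrow> L" using incseq_convergent by blast
    then have "G x = L" by (simp add: G_def limI)
    moreover have "L \<le> h x" using L le by (intro LIMSEQ_le_const2) auto
    moreover have "0 \<le> L" using L F0 by (intro LIMSEQ_le_const) auto
    ultimately show "(\<lambda>k. F k x) \<longlonglongrightarrow> G x \<and> \<bar>G x\<bar> \<le> \<bar>h x\<bar>" using L by auto
  qed
  have "G \<in> orlicz_space \<phi>" by (rule space_solid[OF Gm h(1)]) (use lim in \<open>auto elim!: eventually_mono\<close>)
  moreover have "AE x in unit_leb. (\<lambda>k. F k x) \<longlonglongrightarrow> G x" using lim by eventually_elim simp
  moreover have "truncation_limits (\<lambda>n. f (s n)) F"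
    unfolding truncation_limits_def
  proof (intro conjI allI impI Fm F0 Fk)
    fix k and h :: "real \<Rightarrow> real" and B :: real assume "h \<in> borel_measurable unit_leb" "\<forall>x. \<bar>h x\<bar> \<le> B"
    then show "(\<lambda>n. \<integral>x. min (f (s n) x) (real k) * h x \<partial>unit_leb) \<longlonglongrightarrow> (\<integral>x. F k x * h x \<partial>unit_leb)"
      by (intro weakF) auto
  qed
  ultimately show ?thesis using F_mono F1 by (intro that[OF s])
qed

end

context orlicz_pair
begin

text \<open>Relative to a fixed height \<open>K\<close> the difference is \<open>y + t - T\<close>.
  Here \<open>y\<close> is the version at height \<open>K\<close>, for which uniform boundedness and
  asymptotic orthogonality suffice, while \<open>t\<close> and \<open>T\<close> are the increments
  of the truncations of \<open>f n\<close> and of the limits from height \<open>K\<close> to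
  \<open>n\<close>. Superlinearity makes their L^1 norms small uniformly in \<open>n\<close>, so
  \<open>functional_small_L1\<close> controls them.\<close>

lemma weakly_null_truncations:
  assumes n2: "nabla2 \<phi>"
    and fm: "\<And>n. f n \<in> borel_measurable unit_leb" and f: "\<And>n x. 0 \<le> f n x" "\<And>n. modular \<phi> (f n) 1 \<le> 1"
    and lim: "truncation_limits f F"
    and F_mono: "\<And>(j::nat) k x. j \<le> k \<Longrightarrow> F j x \<le> F k x" and F1: "\<And>k. modular \<phi> (F k) 1 \<le> 1"
  shows "weakly_null \<phi> (orlicz_heart \<phi>) (\<lambda>n x. min (f n x) (real n) - F n x)"
  unfolding weakly_null_def
proof (intro conjI allI impI)
  note Fm = truncation_limitsD(1)[OF lim] and F = truncation_limitsD(2,3)[OF lim] and weak = truncation_limitsD(4)[OF lim]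
  note [measurable] = fm Fm
  have bh: "u \<in> orlicz_heart \<phi>" if "u \<in> borel_measurable unit_leb" "\<And>x. \<bar>u x\<bar> \<le> B" for u :: "real \<Rightarrow> real" and B :: real
    using that by (intro heart_bounded[of u B]) auto
  show "(\<lambda>x. min (f n x) (real n) - F n x) \<in> orlicz_heart \<phi>" for n
  proof (rule bh[of _ "real n"])
    fix x show "\<bar>min (f n x) (real n) - F n x\<bar> \<le> real n" using f(1)[of n x] F[of n x] by (auto simp: abs_le_iff min_def)
  qed measurable
  fix l assume l: "bounded_functional \<phi> (orlicz_heart \<phi>) l"
  show "(\<lambda>n. l (\<lambda>x. min (f n x) (real n) - F n x)) \<longlonglongrightarrow> 0"
  proof (rule LIMSEQ_I)
    fix e :: real assume e: "e > 0"
    then have "e / 4 > 0" by simp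
    from functional_small_L1[OF n2 l this] obtain \<delta> where \<delta>: "\<delta> > 0" "\<And>g B. g \<in> borel_measurable unit_leb \<Longrightarrow> (\<And>x. \<bar>g x\<bar> \<le> B) \<Longrightarrow> modular \<phi> g 1 \<le> 1 \<Longrightarrow>
    (\<integral>x. \<bar>g x\<bar> \<partial>unit_leb) \<le> \<delta> \<Longrightarrow> \<bar>l g\<bar> \<le> e / 4" by blast
    \<comment> \<open>Above \<open>K0\<close> a value is at most \<delta> times its image under
      \<phi>, so the part above height \<open>K\<close> has L^1 norm at most \<delta> times a
      modular that is at most 1.\<close>
    obtain K0 where K0: "K0 > 0" "\<And>t. t \<ge> K0 \<Longrightarrow> t \<le> \<delta> * \<phi> t" using superlinear[OF \<delta>(1)] by blast
    obtain K :: nat where K: "real K \<ge> K0" using real_arch_simple by blast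
    define t where "t = (\<lambda>n m x. min (f n x) (real m) - min (f n x) (real K))"
    have tm [measurable]: "t n m \<in> borel_measurable unit_leb" for n m unfolding t_def by measurable
    have t: "0 \<le> t n m x" "t n m x \<le> f n x" "t n m x \<le> real m" "t n m x \<noteq> 0 \<longrightarrow> f n x \<ge> K0" if "m \<ge> K" for n m x
      using that f(1)[of n x] K by (auto simp: t_def min_def)
    have t_abs: "\<bar>t n m x\<bar> = t n m x" if "m \<ge> K" for n m x using t[OF that] by simp
    have t_small: "(\<integral>x. t n m x \<partial>unit_leb) \<le> \<delta>" if m: "m \<ge> K" for n m
    proof -
      have ti: "integrable unit_leb (t n m)" 
        by (rule unit_leb_integrable_bounded[of _ "real m"]) (use t[OF m] in auto)
      have "ennreal (\<integral>x. t n m x \<partial>unit_leb) = (\<integral>\<^sup>+x. ennreal (t n m x) \<partial>unit_leb)"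
        using ti t[OF m] by (intro nn_integral_eq_integral[symmetric]) auto
      also have "\<dots> \<le> (\<integral>\<^sup>+x. ennreal \<delta> * ennreal (\<phi> \<bar>f n x\<bar>) \<partial>unit_leb)"
      proof (rule nn_integral_mono)
        fix x
        have "t n m x \<le> \<delta> * \<phi> \<bar>f n x\<bar>"
        proof (cases "t n m x = 0")
          case True
          then show ?thesis using \<delta>(1) nonneg[of "\<bar>f n x\<bar>"] by simp
        next
          case False
          then have "f n x \<le> \<delta> * \<phi> (f n x)" using t(4)[OF m] by (intro K0) auto
          then show ?thesis using t(2)[OF m, of n x] f(1)[of n x] by simp
        qed
        then have "ennreal (t n m x) \<le> ennreal (\<delta> * \<phi> \<bar>f n x\<bar>)" by (rule ennreal_leI)
        then show "ennreal (t n m x) \<le> ennreal \<delta> * ennreal (\<phi> \<bar>f n x\<bar>)" using \<delta>(1) by (simp add: ennreal_mult')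
      qed
      also have "\<dots> = ennreal \<delta> * modular \<phi> (f n) 1"
        unfolding modular_def by (subst nn_integral_cmult) auto
      also have "\<dots> \<le> ennreal \<delta> * 1" using f(2) by (intro mult_left_mono) auto
      finally show ?thesis using \<delta>(1) by (simp add: ennreal_le_iff)
    qed
    have lt: "\<bar>l (t n m)\<bar> \<le> e / 4" if m: "m \<ge> K" for n m
    proof (rule \<delta>(2)[OF tm])
      show "\<bar>t n m x\<bar> \<le> real m" for x using t[OF m, of n x] by simp
      have "modular \<phi> (t n m) 1 \<le> modular \<phi> (f n) 1"
        by (intro modular_mono AE_I2) (use t[OF m, of n] f(1)[of n] in simp_all)
      then show "modular \<phi> (t n m) 1 \<le> 1" using f(2) by (rule order_trans)
      show "(\<integral>x. \<bar>t n m x\<bar> \<partial>unit_leb) \<le> \<delta>" using t_small[OF m] t_abs[OF m] by simp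
    qed
    define T where "T = (\<lambda>m x. F m x - F K x)"
    have Tm [measurable]: "T m \<in> borel_measurable unit_leb" for m unfolding T_def by measurable
    have T: "0 \<le> T m x" "T m x \<le> F m x" "T m x \<le> real m" if "m \<ge> K" for m x
      using F[of K x] F[of m x] F_mono[OF that, of x] by (auto simp: T_def)
    have FI: "integrable unit_leb (F k)" for k by (rule unit_leb_integrable_bounded[of _ "real k"]) (use F in auto)
    \<comment> \<open>\<open>T\<close> inherits the bound for \<open>t\<close> through the weak
      limits, tested against the constant 1.\<close>
    have T_small: "(\<integral>x. T m x \<partial>unit_leb) \<le> \<delta>" if m: "m \<ge> K" for m
    proof -
      have mi: "integrable unit_leb (\<lambda>x. min (f n x) (real k))" for n k
        by (rule unit_leb_integrable_bounded[of _ "real k"]) (use f in \<open>auto simp: abs_le_iff\<close>)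
      have "(\<lambda>n. (\<integral>x. min (f n x) (real m) \<partial>unit_leb) - (\<integral>x. min (f n x) (real K) \<partial>unit_leb)) \<longlonglongrightarrow> (\<integral>x. F m x \<partial>unit_leb) - (\<integral>x. F K x \<partial>unit_leb)"
        using tendsto_diff[OF weak[of "\<lambda>x. 1" 1 m] weak[of "\<lambda>x. 1" 1 K]] by simp
      moreover have "(\<integral>x. min (f n x) (real m) \<partial>unit_leb) - (\<integral>x. min (f n x) (real K) \<partial>unit_leb) \<le> \<delta>" for n
        using t_small[OF m, of n] mi unfolding t_def by simp
      ultimately have "(\<integral>x. F m x \<partial>unit_leb) - (\<integral>x. F K x \<partial>unit_leb) \<le> \<delta>" by (intro LIMSEQ_le_const2) auto
      then show ?thesis using FI by (simp add: T_def)
    qed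
    have lT: "\<bar>l (T m)\<bar> \<le> e / 4" if m: "m \<ge> K" for m
    proof (rule \<delta>(2)[OF Tm])
      show "\<bar>T m x\<bar> \<le> real m" for x using T[OF m, of x] by simp
      have "modular \<phi> (T m) 1 \<le> modular \<phi> (F m) 1" using T[OF m] F by (intro modular_mono) auto
      then show "modular \<phi> (T m) 1 \<le> 1" using F1 by (rule order_trans)
      show "(\<integral>x. \<bar>T m x\<bar> \<partial>unit_leb) \<le> \<delta>" using T_small[OF m] T(1)[OF m] by simp
    qed
    define y where "y = (\<lambda>n x. min (f n x) (real K) - F K x)"
    have ym [measurable]: "y n \<in> borel_measurable unit_leb" for n unfolding y_def by measurable
    have yb: "\<bar>y n x\<bar> \<le> real K" for n x using f(1)[of n x] F[of K x] by (auto simp: y_def abs_le_iff min_def)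
    \<comment> \<open>Each \<open>y m\<close> is bounded, hence itself a test function for the weak
      convergence; this gives the orthogonality.\<close>
    have "(\<lambda>n. l (y n)) \<longlonglongrightarrow> 0"
    proof (rule functional_bounded_L2_null[OF l ym yb])
      fix m
      have "(\<lambda>n. (\<integral>x. min (f n x) (real K) * y m x \<partial>unit_leb) - (\<integral>x. F K x * y m x \<partial>unit_leb)) \<longlonglongrightarrow> 
         (\<integral>x. F K x * y m x \<partial>unit_leb) - (\<integral>x. F K x * y m x \<partial>unit_leb)"
        by (intro tendsto_diff tendsto_const weak[OF ym yb])
      moreover have "(\<integral>x. min (f n x) (real K) * y m x \<partial>unit_leb) - (\<integral>x. F K x * y m x \<partial>unit_leb) = (\<integral>x. y m x * y n x \<partial>unit_leb)" for n
      proof -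
        have "integrable unit_leb (\<lambda>x. min (f n x) (real K) * y m x)" "integrable unit_leb (\<lambda>x. F K x * y m x)"
          using yb f F by (auto intro!: unit_leb_integrable_bounded[of _ "real K * real K"] mult_mono simp: abs_mult min_def)
        then have "(\<integral>x. min (f n x) (real K) * y m x \<partial>unit_leb) - (\<integral>x. F K x * y m x \<partial>unit_leb)
          = (\<integral>x. min (f n x) (real K) * y m x - F K x * y m x \<partial>unit_leb)" by simp
        also have "\<dots> = (\<integral>x. y m x * y n x \<partial>unit_leb)"
          by (intro Bochner_Integration.integral_cong) (auto simp: y_def algebra_simps)
        finally show ?thesis .
      qed
      ultimately show "(\<lambda>n. \<integral>x. y m x * y n x \<partial>unit_leb) \<longlonglongrightarrow> 0" by simp
    qed
    from LIMSEQ_D[OF this \<open>e / 4 > 0\<close>] obtain n0 where n0: "\<And>n. n \<ge> n0 \<Longrightarrow> \<bar>l (y n)\<bar> < e / 4" by auto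
    show "\<exists>no. \<forall>n\<ge>no. norm (l (\<lambda>x. min (f n x) (real n) - F n x) - 0) < e"
    proof (intro exI allI impI)
      fix n assume n: "n \<ge> max n0 K"
      then have nK: "n \<ge> K" by simp
      have yh: "y n \<in> orlicz_heart \<phi>" using yb by (intro bh[of _ "real K"]) auto
      have th: "t n n \<in> orlicz_heart \<phi>" using t_abs[OF nK] t(3)[OF nK] by (intro bh[of _ "real n"]) auto
      have Th: "T n \<in> orlicz_heart \<phi>" using T[OF nK] by (intro bh[of _ "real n"]) auto
      have "(\<lambda>x. min (f n x) (real n) - F n x) = (\<lambda>x. (y n x + t n n x) - T n x)"
        by (auto simp: y_def t_def T_def)
      then have "l (\<lambda>x. min (f n x) (real n) - F n x) = l (\<lambda>x. y n x + t n n x) - l (T n)"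
        using heart_functional_diff[OF l heart_add[OF yh th] Th] by simp
      also have "l (\<lambda>x. y n x + t n n x) = l (y n) + l (t n n)" by (rule bounded_functional_add[OF l yh th])
      finally show "norm (l (\<lambda>x. min (f n x) (real n) - F n x) - 0) < e"
        using n0[of n] n lt[OF nK, of n] lT[OF nK] e by simp
    qed
  qed
qed

end

subsection \<open>The equivalence\<close>

lemma weakly_null_diff:
  assumes "orlicz_function \<phi>" "weakly_null \<phi> (orlicz_heart \<phi>) a" "weakly_null \<phi> (orlicz_heart \<phi>) b"
  shows "weakly_null \<phi> (orlicz_heart \<phi>) (\<lambda>n x. a n x - b n x)"
proof -
  interpret orlicz \<phi> by standard fact
  show ?thesis
    unfolding weakly_null_def
  proof (intro conjI allI impI)
    show "(\<lambda>x. a n x - b n x) \<in> orlicz_heart \<phi>" for n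
      using assms unfolding weakly_null_def by (intro heart_diff) auto
    fix l assume l: "bounded_functional \<phi> (orlicz_heart \<phi>) l"
    have "(\<lambda>n. l (a n) - l (b n)) \<longlonglongrightarrow> 0 - 0"
      using assms l unfolding weakly_null_def by (intro tendsto_diff) auto
    moreover have "l (\<lambda>x. a n x - b n x) = l (a n) - l (b n)" for n
      using assms unfolding weakly_null_def by (intro heart_functional_diff[OF l]) auto
    ultimately show "(\<lambda>n. l (\<lambda>x. a n x - b n x)) \<longlonglongrightarrow> 0" by simp
  qed
qed

lemma weakly_null_subseq:
  assumes "weakly_null \<phi> X a" "strict_mono r"
  shows "weakly_null \<phi> X (\<lambda>n. a (r n))"
  using assms LIMSEQ_subseq_LIMSEQ[of _ 0 r] unfolding weakly_null_def by (auto simp: o_def)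

lemma dominated_in_cmult:
  assumes "orlicz_function \<phi>" "dominated_in (orlicz_space \<phi>) a"
  shows "dominated_in (orlicz_space \<phi>) (\<lambda>n x. c * a n x)"
proof -
  interpret orlicz \<phi> by standard fact
  obtain h where h: "h \<in> orlicz_space \<phi>" "AE x in unit_leb. 0 \<le> h x" "\<And>n. AE x in unit_leb. \<bar>a n x\<bar> \<le> h x"
    using assms(2) unfolding dominated_in_def ae_le_def by blast
  have "AE x in unit_leb. 0 \<le> \<bar>c\<bar> * h x" using h(2) by eventually_elim simp
  moreover have "AE x in unit_leb. \<bar>c * a n x\<bar> \<le> \<bar>c\<bar> * h x" for n
    using h(3)[of n] by eventually_elim (simp add: abs_mult mult_left_mono)
  ultimately show ?thesis unfolding dominated_in_def ae_le_def
    by (intro bexI[OF _ space_cmult[OF h(1), of "\<bar>c\<bar>"]] conjI allI)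
qed

context orlicz_pair
begin

text \<open>Both conclusions are stated for every strictly increasing \<open>s\<close> because
  property (H), applied to \<open>d\<close> afterwards, selects a further subsequence. What remains
  after subtracting \<open>d\<close> is the excess over the truncation height plus the increasing
  limits, and these lie below \<open>G\<close>.\<close>

lemma cesaro_subseq_decomposition:
  fixes f :: "nat \<Rightarrow> real \<Rightarrow> real"
  assumes n2: "nabla2 \<phi>"
    and fm: "\<And>n. f n \<in> borel_measurable unit_leb" and f: "\<And>n x. 0 \<le> f n x" "\<And>n. modular \<phi> (f n) 1 \<le> 1"
  obtains r :: "nat \<Rightarrow> nat" and d :: "nat \<Rightarrow> real \<Rightarrow> real" and G where "strict_mono r" "weakly_null \<phi> (orlicz_heart \<phi>) d" "G \<in> orlicz_space \<phi>"
    "\<And>s. strict_mono s \<Longrightarrow> dominated_in (orlicz_space \<phi>) (cesaro (\<lambda>n x. f (r (s n)) x - d (s n) x))"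
    "\<And>s. strict_mono s \<Longrightarrow> AE x in unit_leb. (\<lambda>m. cesaro (\<lambda>n. f (r (s n))) m x) \<longlonglongrightarrow> G x"
proof -
  obtain s0 :: "nat \<Rightarrow> nat" and F :: "nat \<Rightarrow> real \<Rightarrow> real" and G where s0: "strict_mono s0" and
    F_lim: "truncation_limits (\<lambda>n. f (s0 n)) F" and
    F_mono: "\<And>j k x. j \<le> k \<Longrightarrow> F j x \<le> F k x" and F1: "\<And>k. modular \<phi> (F k) 1 \<le> 1" and
    G: "G \<in> orlicz_space \<phi>" and FG: "AE x in unit_leb. (\<lambda>k. F k x) \<longlonglongrightarrow> G x"
    by (rule ex_monotone_truncation_limits[where f = f, OF fm f]) (rule that)
  note Fm = truncation_limitsD(1)[OF F_lim] and F = truncation_limitsD(2,3)[OF F_lim] and weak = truncation_limitsD(4)[OF F_lim]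
  define u where "u = (\<lambda>n. f (s0 n))"
  have um [measurable]: "u n \<in> borel_measurable unit_leb" for n using fm by (simp add: u_def)
  have u: "0 \<le> u n x" "modular \<phi> (u n) 1 \<le> 1" for n x using f by (simp_all add: u_def)
  note [measurable] = Fm
  have \<phi>u [measurable]: "(\<lambda>x. \<phi> (u n x)) \<in> borel_measurable unit_leb" for n using measurable_comp[OF um] u by simp
  define w where "w = (\<lambda>a k x. min (u a x) (real k) - F k x)"
  have wm [measurable]: "w a k \<in> borel_measurable unit_leb" for a k unfolding w_def by measurable
  have wb: "\<bar>w a k x\<bar> \<le> real k" for a k x using u(1)[of a x] F[of k x] by (auto simp: w_def abs_le_iff min_def)
  \<comment> \<open>The first condition makes the excess functions almost disjoint, the second makes
    the centred truncations almost orthogonal. The latter covers all heights up to the positions,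
    because after passage to a subsequence the truncation height is the new, smaller
    position.\<close>
  define Q where "Q = (\<lambda>i a j b. (\<integral>\<^sup>+x. ennreal (\<phi> (u a x)) * indicator {x. u b x > real b} x \<partial>unit_leb) \<le> ennreal ((1 / 2) ^ i * (1 / 2) ^ j) \<and>
    (\<forall>k\<in>{..i}. \<forall>k'\<in>{..j}. \<bar>\<integral>x. w a k x * w b k' x \<partial>unit_leb\<bar> \<le> (1 / 2) ^ j))"
  have "\<forall>\<^sub>F b in sequentially. Q i a j b" for i a j
    unfolding Q_def
  proof (intro eventually_conj eventually_ball_finite ballI)
    \<comment> \<open>At almost every point u b \<le> b for all large \<open>b\<close>, so the
      integrand tends to 0 under the integrable majorant \<phi>(u a).\<close>
    have "(\<lambda>b. \<integral>\<^sup>+x. ennreal (\<phi> (u a x)) * indicator {x. u b x > real b} x \<partial>unit_leb) \<longlonglongrightarrow> (\<integral>\<^sup>+x. 0 \<partial>unit_leb)"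
    proof (rule nn_integral_dominated_convergence[where w = "\<lambda>x. ennreal (\<phi> (u a x))"])
      show "(\<integral>\<^sup>+x. ennreal (\<phi> (u a x)) \<partial>unit_leb) < \<infinity>"
        using u(1) order_le_less_trans[OF u(2)[of a], of \<infinity>] by (simp add: modular_def)
      show "AE x in unit_leb. (\<lambda>b. ennreal (\<phi> (u a x)) * indicator {x. u b x > real b} x) \<longlonglongrightarrow> 0"
        using AE_eventually_le[OF n2 um u]
      proof eventually_elim
        fix x assume "\<forall>\<^sub>F b in sequentially. u b x \<le> real b"
        then have "\<forall>\<^sub>F b in sequentially. ennreal (\<phi> (u a x)) * indicator {x. u b x > real b} x = 0"
          by eventually_elim simp
        then show "(\<lambda>b. ennreal (\<phi> (u a x)) * indicator {x. u b x > real b} x) \<longlonglongrightarrow> 0" by (rule tendsto_eventually)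
      qed
      show "AE x in unit_leb. ennreal (\<phi> (u a x)) * indicator {x. u j x > real j} x \<le> ennreal (\<phi> (u a x))" for j
        by (intro AE_I2) (auto simp: indicator_def)
    qed measurable
    then have "\<forall>\<^sub>F b in sequentially. (\<integral>\<^sup>+x. ennreal (\<phi> (u a x)) * indicator {x. u b x > real b} x \<partial>unit_leb) < ennreal ((1 / 2) ^ i * (1 / 2) ^ j)"
      by (intro order_tendstoD(2)) auto
    then show "\<forall>\<^sub>F b in sequentially. (\<integral>\<^sup>+x. ennreal (\<phi> (u a x)) * indicator {x. u b x > real b} x \<partial>unit_leb) \<le> ennreal ((1 / 2) ^ i * (1 / 2) ^ j)"
      by eventually_elim (rule less_imp_le)
  next
    fix k k' assume "k \<in> {..i}" "k' \<in> {..j}"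
    have ub: "integrable unit_leb (\<lambda>x. min (u b x) (real k') * w a k x)" for b
      using u(1) wb by (intro unit_leb_integrable_bounded[of _ "real k' * real k"]) (auto simp: abs_mult intro!: mult_mono)
    have Fb: "integrable unit_leb (\<lambda>x. F k' x * w a k x)"
      using F wb by (intro unit_leb_integrable_bounded[of _ "real k' * real k"]) (auto simp: abs_mult intro!: mult_mono)
    have "(\<lambda>b. (\<integral>x. min (u b x) (real k') * w a k x \<partial>unit_leb) - (\<integral>x. F k' x * w a k x \<partial>unit_leb)) \<longlonglongrightarrow> 
      (\<integral>x. F k' x * w a k x \<partial>unit_leb) - (\<integral>x. F k' x * w a k x \<partial>unit_leb)"
      using weak[OF wm[of a k] wb, of k'] by (intro tendsto_diff tendsto_const) (simp add: u_def)
    moreover have "(\<integral>x. min (u b x) (real k') * w a k x \<partial>unit_leb) - (\<integral>x. F k' x * w a k x \<partial>unit_leb) = (\<integral>x. w a k x * w b k' x \<partial>unit_leb)" for b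
    proof -
      have "(\<integral>x. min (u b x) (real k') * w a k x \<partial>unit_leb) - (\<integral>x. F k' x * w a k x \<partial>unit_leb) = 
        (\<integral>x. min (u b x) (real k') * w a k x - F k' x * w a k x \<partial>unit_leb)" using ub Fb by simp
      also have "\<dots> = (\<integral>x. w a k x * w b k' x \<partial>unit_leb)"
        by (intro Bochner_Integration.integral_cong) (auto simp: w_def algebra_simps)
      finally show ?thesis .
    qed
    ultimately have "(\<lambda>b. \<integral>x. w a k x * w b k' x \<partial>unit_leb) \<longlonglongrightarrow> 0" by simp
    from tendstoD[OF this, of "(1 / 2) ^ j"]
    have "\<forall>\<^sub>F b in sequentially. \<bar>\<integral>x. w a k x * w b k' x \<partial>unit_leb\<bar> < (1 / 2) ^ j" by (simp add: dist_real_def)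
    then show "\<forall>\<^sub>F b in sequentially. \<bar>\<integral>x. w a k x * w b k' x \<partial>unit_leb\<bar> \<le> (1 / 2) ^ j"
      by eventually_elim (rule less_imp_le)
  qed auto
  from strict_mono_selection[of Q, OF this] obtain r where r: "strict_mono r" and Q: "\<And>i j. i < j \<Longrightarrow> Q i (r i) j (r j)"
    by blast
  define d where "d = (\<lambda>n x. min (u (r n) x) (real (r n)) - F (r n) x)"
  have "weakly_null \<phi> (orlicz_heart \<phi>) (\<lambda>n x. min (u n x) (real n) - F n x)"
    using F_lim by (intro weakly_null_truncations[OF n2 um u _ F_mono F1]) (auto simp: u_def)
  from weakly_null_subseq[OF this r] have d: "weakly_null \<phi> (orlicz_heart \<phi>) d" by (simp add: d_def)
  have dom: "dominated_in (orlicz_space \<phi>) (cesaro (\<lambda>n x. u (r (s n)) x - d (s n) x))" if s: "strict_mono s" for s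
  proof -
    have rs: "r (s i) \<ge> i" for i using strict_mono_imp_increasing[OF strict_mono_o[OF r s], of i] by simp
    define v where "v = (\<lambda>n x. max 0 (u (r (s n)) x - real (r (s n))))"
    have vm [measurable]: "v n \<in> borel_measurable unit_leb" for n unfolding v_def by measurable
    have v: "0 \<le> v n x" "v n x \<le> u (r (s n)) x" "v n x \<noteq> 0 \<longleftrightarrow> u (r (s n)) x > real (r (s n))" for n x
      using u(1)[of "r (s n)" x] by (auto simp: v_def)
    have "dominated_in (orlicz_space \<phi>) (cesaro v)"
    proof (rule dominated_cesaro_almost_disjoint[OF n2 vm v(1)])
      fix n
      have "modular \<phi> (v n) 1 \<le> modular \<phi> (u (r (s n))) 1" using v(1,2)[of n] u(1) by (intro modular_mono) auto
      then show "modular \<phi> (v n) 1 \<le> 1" using u(2) by (rule order_trans)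
    next
      fix i j :: nat assume "i < j"
      then have sij: "s i < s j" using s by (simp add: strict_mono_less)
      have "(\<integral>\<^sup>+x. ennreal (\<phi> (v i x)) * indicator {x. v j x \<noteq> 0} x \<partial>unit_leb) \<le>
        (\<integral>\<^sup>+x. ennreal (\<phi> (u (r (s i)) x)) * indicator {x. u (r (s j)) x > real (r (s j))} x \<partial>unit_leb)"
        unfolding v(3) using v by (intro nn_integral_mono mult_right_mono ennreal_leI mono) auto
      also have "\<dots> \<le> ennreal ((1 / 2) ^ s i * (1 / 2) ^ s j)" using Q[OF sij] by (simp add: Q_def)
      also have "\<dots> \<le> ennreal ((1 / 2) ^ i * (1 / 2) ^ j)"
        using strict_mono_imp_increasing[OF s] by (intro ennreal_leI mult_mono power_decreasing) auto
      finally show "(\<integral>\<^sup>+x. ennreal (\<phi> (v i x)) * indicator {x. v j x \<noteq> 0} x \<partial>unit_leb) \<le> ennreal ((1 / 2) ^ i * (1 / 2) ^ j)" .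
    qed
    moreover have "dominated_in (orlicz_space \<phi>) (\<lambda>_. G)"
    proof -
      have "(\<lambda>x. \<bar>G x\<bar>) \<in> orlicz_space \<phi>" using space_measurable[OF G] by (intro space_solid[OF _ G]) auto
      then show ?thesis unfolding dominated_in_def ae_le_def by (intro bexI[of _ "\<lambda>x. \<bar>G x\<bar>"]) auto
    qed
    moreover have "AE x in unit_leb. \<bar>cesaro (\<lambda>n x. u (r (s n)) x - d (s n) x) m x\<bar> \<le> \<bar>cesaro v m x\<bar> + \<bar>G x\<bar>" for m
      using FG
    proof eventually_elim
      case (elim x)
      have FGx: "F n x \<le> G x" for n
        using elim F_mono by (intro incseq_le[of "\<lambda>k. F k x"]) (auto simp: incseq_def)
      have eq: "u (r (s n)) x - d (s n) x = v n x + F (r (s n)) x" for n by (auto simp: d_def v_def)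
      define Y where "Y = (\<Sum>n\<le>m. F (r (s n)) x) / real (Suc m)"
      have "(\<Sum>n\<le>m. F (r (s n)) x) \<le> real (card {..m}) * G x" using FGx by (intro sum_bounded_above) auto
      then have "Y \<le> G x" by (simp add: Y_def field_simps)
      moreover have "0 \<le> Y" unfolding Y_def using F(1) by (intro divide_nonneg_nonneg sum_nonneg) auto
      moreover have "cesaro (\<lambda>n x. u (r (s n)) x - d (s n) x) m x = cesaro v m x + Y"
        by (simp add: cesaro_def eq sum.distrib add_divide_distrib Y_def)
      ultimately show ?case by linarith
    qed
    ultimately show ?thesis by (rule dominated_in_add)
  qed
  \<comment> \<open>The heights in this application are positions in the final subsequence, whereas
    \<open>d\<close> truncates at the index in \<open>u\<close>; \<open>Q\<close> covers them since
    i \<le> s i.\<close>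
  have conv: "AE x in unit_leb. (\<lambda>m. cesaro (\<lambda>n. u (r (s n))) m x) \<longlonglongrightarrow> G x" if s: "strict_mono s" for s
  proof (rule AE_cesaro_tendsto[OF n2 um u Fm F F1 FG])
    fix i j :: nat assume "i < j"
    then have sij: "s i < s j" using s by (simp add: strict_mono_less)
    have le: "i \<le> s i" "j \<le> s j" using strict_mono_imp_increasing[OF s] by auto
    have "\<bar>\<integral>x. w (r (s i)) i x * w (r (s j)) j x \<partial>unit_leb\<bar> \<le> (1 / 2) ^ s j"
      using Q[OF sij] le by (auto simp: Q_def)
    also have "\<dots> \<le> (1 / 2) ^ j" using le by (intro power_decreasing) auto
    finally show "\<bar>\<integral>x. (min (u (r (s i)) x) (real i) - F i x) * (min (u (r (s j)) x) (real j) - F j x) \<partial>unit_leb\<bar> \<le> (1 / 2) ^ j"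
      by (simp add: w_def)
  qed
  show ?thesis
    by (rule that[of "s0 \<circ> r" d G]) (use strict_mono_o[OF s0 r] d G dom conv in \<open>simp_all add: u_def\<close>)
qed

text \<open>Positive and negative parts are decomposed one after the other, the second along the
  subsequence of the first, and their weakly null parts are combined into one sequence
  \<open>d\<close>, so that a single application of (H) serves both. The scale \<open>c\<close>
  exceeds the norm bound strictly, which gives modulars at most 1.\<close>

lemma property_H_imp_oBSP:
  assumes H: "property_H \<phi>"
  shows "oBSP \<phi>"
  unfolding oBSP_def
proof (intro allI impI)
  note n2 = property_H_imp_nabla2[OF H]
  fix f assume "norm_bounded \<phi> f"
  then obtain C :: real where fL: "\<And>n. f n \<in> orlicz_space \<phi>" and C: "\<And>n. orlicz_norm \<phi> (f n) \<le> ennreal C"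
    unfolding norm_bounded_def by blast
  define c where "c = \<bar>C\<bar> + 1"
  have c: "c > 0" by (simp add: c_def)
  have fc: "modular \<phi> (f n) c \<le> 1" for n
    by (intro modular_le_1 order_le_less_trans[OF C] ennreal_lessI) (simp_all add: c_def)
  note fm [measurable] = space_measurable[OF fL]
  define a where "a = (\<lambda>n x. max 0 (f n x / c))"
  define b where "b = (\<lambda>n x. max 0 (- f n x / c))"
  have am: "a n \<in> borel_measurable unit_leb" and bm: "b n \<in> borel_measurable unit_leb" for n
    unfolding a_def b_def by measurable
  have ab0: "0 \<le> a n x" "0 \<le> b n x" for n x by (auto simp: a_def b_def)
  have f_eq: "f n x = c * (a n x - b n x)" for n x using c by (auto simp: a_def b_def max_def field_simps)
  have ab_le: "a n x \<le> \<bar>f n x\<bar> / c" "b n x \<le> \<bar>f n x\<bar> / c" for n x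
  proof -
    have "f n x / c \<le> \<bar>f n x\<bar> / c" by (rule divide_right_mono) (use c in auto)
    moreover have "- f n x / c \<le> \<bar>f n x\<bar> / c" by (rule divide_right_mono) (use c in auto)
    moreover have "0 \<le> \<bar>f n x\<bar> / c" using c by simp
    ultimately
    show "a n x \<le> \<bar>f n x\<bar> / c" "b n x \<le> \<bar>f n x\<bar> / c" unfolding a_def b_def by (simp_all only: max.bounded_iff simp_thms)
  qed
  have a1: "modular \<phi> (a n) 1 \<le> 1" and b1: "modular \<phi> (b n) 1 \<le> 1" for n
  proof -
    have "modular \<phi> (a n) 1 \<le> modular \<phi> (f n) c" "modular \<phi> (b n) 1 \<le> modular \<phi> (f n) c"
      unfolding modular_def using ab0 ab_le by (auto intro!: nn_integral_mono ennreal_leI mono)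
    then show "modular \<phi> (a n) 1 \<le> 1" "modular \<phi> (b n) 1 \<le> 1" using fc order_trans by blast+
  qed
  obtain r1 d1 G1 where r1: "strict_mono r1" and d1: "weakly_null \<phi> (orlicz_heart \<phi>) d1" and G1: "G1 \<in> orlicz_space \<phi>" and
    dom1: "\<And>s. strict_mono s \<Longrightarrow> dominated_in (orlicz_space \<phi>) (cesaro (\<lambda>n x. a (r1 (s n)) x - d1 (s n) x))" and
    lim1: "\<And>s. strict_mono s \<Longrightarrow> AE x in unit_leb. (\<lambda>m. cesaro (\<lambda>n. a (r1 (s n))) m x) \<longlonglongrightarrow> G1 x"
    by (rule cesaro_subseq_decomposition[where f = a, OF n2 am ab0(1) a1]) (rule that)
  obtain r2 d2 G2 where r2: "strict_mono r2" and d2: "weakly_null \<phi> (orlicz_heart \<phi>) d2" and G2: "G2 \<in> orlicz_space \<phi>" and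
    dom2: "\<And>s. strict_mono s \<Longrightarrow> dominated_in (orlicz_space \<phi>) (cesaro (\<lambda>n x. b (r1 (r2 (s n))) x - d2 (s n) x))" and
    lim2: "\<And>s. strict_mono s \<Longrightarrow> AE x in unit_leb. (\<lambda>m. cesaro (\<lambda>n. b (r1 (r2 (s n)))) m x) \<longlonglongrightarrow> G2 x"
    by (rule cesaro_subseq_decomposition[where f = "\<lambda>n. b (r1 n)", OF n2 bm ab0(2) b1]) (rule that)
  define d where "d = (\<lambda>n x. d1 (r2 n) x - d2 n x)"
  have "weakly_null \<phi> (orlicz_heart \<phi>) d"
    unfolding d_def by (intro weakly_null_diff orlicz weakly_null_subseq[OF d1 r2] d2)
  with H obtain s where s: "strict_mono s" and doms: "dominated_in (orlicz_space \<phi>) (cesaro (d \<circ> s))"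
    unfolding property_H_def by blast
  have r2s: "strict_mono (\<lambda>n. r2 (s n))" using strict_mono_o[OF r2 s] by (simp add: o_def)
  define \<rho> where "\<rho> = (\<lambda>n. r1 (r2 (s n)))"
  have \<rho>: "strict_mono \<rho>" using strict_mono_o[OF r1 r2s] by (simp add: o_def \<rho>_def)
  define X1 where "X1 = cesaro (\<lambda>n x. a (r1 (r2 (s n))) x - d1 (r2 (s n)) x)"
  define X2 where "X2 = cesaro (\<lambda>n x. b (r1 (r2 (s n))) x - d2 (s n) x)"
  have X: "dominated_in (orlicz_space \<phi>) X1" "dominated_in (orlicz_space \<phi>) X2"
    unfolding X1_def X2_def using dom1[OF r2s] dom2[OF s] by simp_all
  have "dominated_in (orlicz_space \<phi>) (\<lambda>m x. X1 m x - X2 m x)"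
    by (rule dominated_in_add[OF X]) auto
  then have "dominated_in (orlicz_space \<phi>) (\<lambda>m x. (X1 m x - X2 m x) + cesaro (d \<circ> s) m x)"
    by (rule dominated_in_add[OF _ doms]) auto
  from dominated_in_cmult[OF orlicz this, of c]
  have "dominated_in (orlicz_space \<phi>) (\<lambda>m x. c * ((X1 m x - X2 m x) + cesaro (d \<circ> s) m x))" .
  moreover have "(\<lambda>m x. c * ((X1 m x - X2 m x) + cesaro (d \<circ> s) m x)) = cesaro (f \<circ> \<rho>)"
  proof (intro ext)
    fix m x
    have "cesaro (f \<circ> \<rho>) m x = c * ((\<Sum>n\<le>m. a (\<rho> n) x - b (\<rho> n) x) / real (Suc m))"
      by (simp add: cesaro_def f_eq sum_distrib_left)
    also have "(\<Sum>n\<le>m. a (\<rho> n) x - b (\<rho> n) x) / real (Suc m) = (X1 m x - X2 m x) + cesaro (d \<circ> s) m x"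
      unfolding X1_def X2_def cesaro_def \<rho>_def d_def o_def
      by (simp add: add_divide_distrib[symmetric] diff_divide_distrib[symmetric] sum_subtractf algebra_simps)
    finally show "c * ((X1 m x - X2 m x) + cesaro (d \<circ> s) m x) = cesaro (f \<circ> \<rho>) m x" by (rule sym)
  qed
  ultimately have dom: "dominated_in (orlicz_space \<phi>) (cesaro (f \<circ> \<rho>))" by simp
  define G where "G = (\<lambda>x. c * (G1 x + (-1) * G2 x))"
  have G: "G \<in> orlicz_space \<phi>" unfolding G_def by (intro space_cmult space_add G1 G2)
  have lim: "AE x in unit_leb. (\<lambda>m. cesaro (f \<circ> \<rho>) m x) \<longlonglongrightarrow> G x"
    using lim1[OF r2s] lim2[OF s]
  proof eventually_elim
    case (elim x)
    have "(\<lambda>m. c * (cesaro (\<lambda>n. a (r1 (r2 (s n)))) m x + (-1) * cesaro (\<lambda>n. b (r1 (r2 (s n)))) m x)) \<longlonglongrightarrow> G x"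
      unfolding G_def by (intro tendsto_intros elim)
    moreover have "c * (cesaro (\<lambda>n. a (r1 (r2 (s n)))) m x + (-1) * cesaro (\<lambda>n. b (r1 (r2 (s n)))) m x) = cesaro (f \<circ> \<rho>) m x" for m
      by (simp add: cesaro_def f_eq \<rho>_def sum_distrib_left[symmetric] sum_subtractf diff_divide_distrib right_diff_distrib)
    ultimately show ?case by simp
  qed
  have "cesaro (f \<circ> \<rho>) m \<in> borel_measurable unit_leb" for m unfolding cesaro_def o_def by measurable
  from order_converges_in_if_dominated[OF this dom G lim]
  show "has_order_cesaro_subseq (orlicz_space \<phi>) f"
    unfolding has_order_cesaro_subseq_def using \<rho> G by blast
qed

lemma oBSP_imp_assoc_oBSP: "oBSP \<phi> \<Longrightarrow> assoc_oBSP \<phi> \<psi>"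
  by (simp add: oBSP_def assoc_oBSP_def)

lemma assoc_oBSP_imp_weak_oBSP:
  assumes "assoc_oBSP \<phi> \<psi>"
  shows "weak_oBSP \<phi>"
  unfolding weak_oBSP_def
proof (intro allI impI)
  fix f assume f: "weakly_null \<phi> (orlicz_space \<phi>) f"
  then have fL: "f n \<in> orlicz_space \<phi>" for n by (simp add: weakly_null_def)
  have null: "(\<lambda>n. \<integral>x. f n x * g x \<partial>unit_leb) \<longlonglongrightarrow> 0" if "g \<in> orlicz_space \<psi>" for g
    using f bounded_functional_integral[OF that] by (auto simp: weakly_null_def)
  from norm_bounded_if_weak_null[OF fL null] show "has_order_cesaro_subseq (orlicz_space \<phi>) f"
    using assms null unfolding assoc_oBSP_def by blast
qed

lemma weak_oBSP_imp_property_H: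
  assumes "weak_oBSP \<phi>"
  shows "property_H \<phi>"
  unfolding property_H_def
proof (intro allI impI)
  fix f assume f: "weakly_null \<phi> (orlicz_heart \<phi>) f"
  have "weakly_null \<phi> (orlicz_space \<phi>) f"
    unfolding weakly_null_def
  proof (intro conjI allI impI)
    show "f n \<in> orlicz_space \<phi>" for n using f heart_subset by (simp add: weakly_null_def)
    fix l assume "bounded_functional \<phi> (orlicz_space \<phi>) l"
    then have "bounded_functional \<phi> (orlicz_heart \<phi>) l"
      using heart_subset unfolding bounded_functional_def by blast
    then show "(\<lambda>n. l (f n)) \<longlonglongrightarrow> 0" using f by (simp add: weakly_null_def)
  qed
  with assms show "\<exists>r::nat \<Rightarrow> nat. strict_mono r \<and> dominated_in (orlicz_space \<phi>) (cesaro (f \<circ> r))"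
    unfolding weak_oBSP_def has_order_cesaro_subseq_def using dominated_in_if_order_converges by blast
qed

end

theorem theorem3p1:
  fixes \<phi> \<psi> :: "real \<Rightarrow> real"
  assumes "orlicz_function \<phi>"
    and "\<And>s. s \<ge> 0 \<Longrightarrow> ereal (\<psi> s) = conjugate \<phi> s"
    and "orlicz_function \<psi>"
  shows "(oBSP \<phi> \<longleftrightarrow> assoc_oBSP \<phi> \<psi>) \<and>
         (assoc_oBSP \<phi> \<psi> \<longleftrightarrow> weak_oBSP \<phi>) \<and>
         (weak_oBSP \<phi> \<longleftrightarrow> property_H \<phi>)"
proof -
  interpret orlicz_pair \<phi> \<psi>
    by (intro orlicz_pair.intro orlicz.intro orlicz_pair_axioms.intro assms)
  show ?thesis
    using oBSP_imp_assoc_oBSP assoc_oBSP_imp_weak_oBSP weak_oBSP_imp_property_H property_H_imp_oBSP by blast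
qed

end
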